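(* Let $A$ be a standard graded polynomial ring over an infinite field $K$ of characteristic zero, and let $I$ be a homogeneous almost complete intersection ideal of $A$ generated by a homogeneous $d$-sequence $\{f_1,\ldots,f_n\}$ with $\deg f_l=d_l$ for $l=1,\ldots,n$, such that $\{f_1,\ldots,f_{n-1}\}$ is a regular sequence. Assume that $\operatorname{reg}(A/I)<\sum_{l=1}^{n-1}d_l-n+1$ and that $d_n=\max\{d_i\mid i=1,\ldots,n\}$. Then for all $s\ge 2$ and all $i=0,\ldots,n-1$, $$\operatorname{reg}\left(\frac{A}{\langle f_1,\ldots,f_i\rangle+I^s}\right)=\sum_{l=1}^{n}d_l-n+(s-2)d_n.$$
   Context: A homogeneous ideal $I$ of a standard graded $K$-algebra $A$ is an almost complete intersection if its minimal number of generators is one more than its height and, for every minimal prime $\mathfrak p$ of $I$, the localization $I_{\mathfrak p}$ is a complete intersection. A sequence $a_1,\ldots,a_n$ in $A$, with $I=\langle a_1,\ldots,a_n\rangle$ and $I_i=\langle a_1,\ldots,a_i\rangle$ ($I_0=0$), is a $d$-sequence if $(I_{i-1}:a_i)\cap I=I_{i-1}$ for $i=1,\ldots,n$. $\operatorname{reg}$ is Castelnuovo-Mumford regularity over $A$: $\operatorname{reg}(M)=\sup\{j-i:\beta^A_{i,j}(M)\neq 0\}$, where $\beta^A_{i,j}(M)$ are the graded Betti numbers of the minimal graded free $A$-resolution of $M$. For $i=0$ the ideal $\langle f_1,\ldots,f_i\rangle$ is zero. *)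

theory Defs
  imports
    "HOL-Library.Poly_Mapping"
    "HOL-Library.Extended_Nat"
    "HOL-Library.Extended_Real"
    "HOL-Computational_Algebra.Fraction_Field"
    "HOL-Algebra.Ideal_Product"
    "HOL-Algebra.Algebraic_Closure_Type"
    "Jordan_Normal_Form.Matrix"
begin

section \<open>Ideals of commutative rings\<close>

text \<open>Sequences \<open>a\<^sub>1, \<dots>, a\<^sub>m\<close> are functions on \<^typ>\<open>nat\<close> of which only the values at
  \<open>1, \<dots>, m\<close> matter.\<close>

definition colon_ideal :: "('a, 'm) ring_scheme \<Rightarrow> 'a set \<Rightarrow> 'a \<Rightarrow> 'a set" where
  "colon_ideal R J a = {x \<in> carrier R. x \<otimes>\<^bsub>R\<^esub> a \<in> J}"

definition d_sequence :: "('a, 'm) ring_scheme \<Rightarrow> nat \<Rightarrow> (nat \<Rightarrow> 'a) \<Rightarrow> bool" where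
  "d_sequence R n a \<longleftrightarrow> a ` {1..n} \<subseteq> carrier R \<and>
     (\<forall>i\<in>{1..n}. colon_ideal R (Idl\<^bsub>R\<^esub> (a ` {1..i - 1})) (a i) \<inter> Idl\<^bsub>R\<^esub> (a ` {1..n})
        = Idl\<^bsub>R\<^esub> (a ` {1..i - 1}))"

definition regular_sequence :: "('a, 'm) ring_scheme \<Rightarrow> nat \<Rightarrow> (nat \<Rightarrow> 'a) \<Rightarrow> bool" where
  "regular_sequence R n a \<longleftrightarrow> a ` {1..n} \<subseteq> carrier R \<and>
     (\<forall>i\<in>{1..n}. \<forall>x\<in>carrier R.
        x \<otimes>\<^bsub>R\<^esub> a i \<in> Idl\<^bsub>R\<^esub> (a ` {1..i - 1}) \<longrightarrow> x \<in> Idl\<^bsub>R\<^esub> (a ` {1..i - 1})) \<and>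
     Idl\<^bsub>R\<^esub> (a ` {1..n}) \<noteq> carrier R"

definition complete_intersection :: "('a, 'm) ring_scheme \<Rightarrow> 'a set \<Rightarrow> bool" where
  "complete_intersection R I \<longleftrightarrow>
     (\<exists>n a. regular_sequence R n a \<and> I = Idl\<^bsub>R\<^esub> (a ` {1..n}))"

definition min_num_gens :: "('a, 'm) ring_scheme \<Rightarrow> 'a set \<Rightarrow> enat" where
  "min_num_gens R I = Inf {enat (card S) | S. finite S \<and> S \<subseteq> carrier R \<and> Idl\<^bsub>R\<^esub> S = I}"

definition prime_height :: "('a, 'm) ring_scheme \<Rightarrow> 'a set \<Rightarrow> enat" where
  "prime_height R P = Sup {enat m | m. \<exists>c :: nat \<Rightarrow> 'a set.
     (\<forall>i\<le>m. primeideal (c i) R) \<and> (\<forall>i<m. c i \<subset> c (Suc i)) \<and> c m = P}"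

definition height :: "('a, 'm) ring_scheme \<Rightarrow> 'a set \<Rightarrow> enat" where
  "height R I = Inf {prime_height R P | P. primeideal P R \<and> I \<subseteq> P}"

definition minimal_prime :: "('a, 'm) ring_scheme \<Rightarrow> 'a set \<Rightarrow> 'a set \<Rightarrow> bool" where
  "minimal_prime R I P \<longleftrightarrow> primeideal P R \<and> I \<subseteq> P \<and>
     (\<forall>Q. primeideal Q R \<and> I \<subseteq> Q \<and> Q \<subseteq> P \<longrightarrow> Q = P)"

text \<open>For a domain, the localization at a prime \<open>P\<close> and the extension of an ideal to it are
  realised inside the field of fractions.\<close>

definition localization :: "'a::idom set \<Rightarrow> 'a fract ring" where
  "localization P =
     \<lparr>carrier = {Fract a s | a s. s \<notin> P}, monoid.mult = (*), one = 1, zero = 0, add = (+)\<rparr>"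

definition localized_ideal :: "'a::idom set \<Rightarrow> 'a set \<Rightarrow> 'a fract set" where
  "localized_ideal P I = {Fract a s | a s. a \<in> I \<and> s \<notin> P}"

definition almost_complete_intersection :: "'a::idom set \<Rightarrow> bool" where
  "almost_complete_intersection I \<longleftrightarrow>
     min_num_gens ring_of_type_algebra I = height ring_of_type_algebra I + 1 \<and>
     (\<forall>P. minimal_prime ring_of_type_algebra I P \<longrightarrow>
        complete_intersection (localization P) (localized_ideal P I))"

section \<open>Standard graded polynomial rings\<close>

text \<open>Polynomials over \<open>'k\<close> in finitely many variables indexed by \<open>'v\<close>. The order on the
  variables plays no role; the library needs it to make this type an integral domain.\<close>

type_synonym ('v, 'k) mpoly = "('v \<Rightarrow>\<^sub>0 nat) \<Rightarrow>\<^sub>0 'k"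

definition monomial_degree :: "('v::finite \<Rightarrow>\<^sub>0 nat) \<Rightarrow> nat" where
  "monomial_degree t = (\<Sum>x\<in>UNIV. Poly_Mapping.lookup t x)"

text \<open>The graded component of degree \<open>d\<close>; it contains \<open>0\<close>, and is \<open>{0}\<close> if \<open>d < 0\<close>.\<close>

definition forms :: "int \<Rightarrow> ('v::finite, 'k::zero) mpoly set" where
  "forms d = {p. \<forall>t\<in>Poly_Mapping.keys p. int (monomial_degree t) = d}"

definition irrelevant_ideal :: "('v, 'k::zero) mpoly set" where
  "irrelevant_ideal = {p. Poly_Mapping.lookup p 0 = 0}"

section \<open>Minimal graded free resolutions and regularity\<close>

text \<open>
  A minimal graded free resolution
  \<open>\<dots> \<rightarrow> F 2 \<rightarrow> F 1 \<rightarrow> F 0 \<rightarrow> A/J \<rightarrow> 0\<close> of the module \<open>A/J\<close>: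
  \<^item> \<open>F i\<close> is the direct sum of the \<open>A(-b)\<close> for \<open>b\<close> in the list \<open>B i\<close>;
  \<^item> \<open>F 0 \<rightarrow> A/J\<close> sends the \<open>q\<close>-th basis vector to the class of \<open>e $ q\<close>;
  \<^item> \<open>F (i + 1) \<rightarrow> F i\<close> is given by the matrix \<open>D i\<close>; having degree \<open>0\<close> means that its
    \<open>(p, q)\<close> entry is a form of degree \<open>B (i + 1) ! q - B i ! p\<close>.\<close>

definition minimal_graded_free_resolution ::
  "('v::finite, 'k::field) mpoly set \<Rightarrow> (nat \<Rightarrow> int list) \<Rightarrow> ('v, 'k) mpoly vec
     \<Rightarrow> (nat \<Rightarrow> ('v, 'k) mpoly mat) \<Rightarrow> bool" where
  "minimal_graded_free_resolution J B e D \<longleftrightarrow>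
     (let r = (\<lambda>i. length (B i)) in
      \<comment> \<open>graded homomorphisms\<close>
      e \<in> carrier_vec (r 0) \<and> (\<forall>q<r 0. e $ q \<in> forms (B 0 ! q)) \<and>
      (\<forall>i. D i \<in> carrier_mat (r i) (r (i + 1)) \<and>
        (\<forall>p<r i. \<forall>q<r (i + 1). D i $$ (p, q) \<in> forms (B (i + 1) ! q - B i ! p))) \<and>
      \<comment> \<open>exactness at \<open>A/J\<close>, at \<open>F 0\<close> and at \<open>F (i + 1)\<close>\<close>
      (\<forall>g. \<exists>v\<in>carrier_vec (r 0). g - e \<bullet> v \<in> J) \<and>
      (\<forall>v\<in>carrier_vec (r 0).
        e \<bullet> v \<in> J \<longleftrightarrow> (\<exists>w\<in>carrier_vec (r 1). v = D 0 *\<^sub>v w)) \<and>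
      (\<forall>i. \<forall>v\<in>carrier_vec (r (i + 1)).
        D i *\<^sub>v v = 0\<^sub>v (r i) \<longleftrightarrow> (\<exists>w\<in>carrier_vec (r (i + 2)). v = D (i + 1) *\<^sub>v w)) \<and>
      \<comment> \<open>minimality\<close>
      (\<forall>i. \<forall>p<r i. \<forall>q<r (i + 1). D i $$ (p, q) \<in> irrelevant_ideal))"

text \<open>The graded Betti number \<open>\<beta>\<^sub>i\<^sub>,\<^sub>j(A/J)\<close>. A minimal graded free resolution is unique up to
  isomorphism, so the choice made here is immaterial.\<close>

definition betti :: "('v::finite, 'k::field) mpoly set \<Rightarrow> nat \<Rightarrow> int \<Rightarrow> nat" where
  "betti J i j =
     count_list ((SOME B. \<exists>e D. minimal_graded_free_resolution J B e D) i) j"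

text \<open>The Castelnuovo-Mumford regularity of \<open>A/J\<close>, which is \<open>- \<infinity>\<close> for the zero module.\<close>

definition reg_quotient :: "('v::finite, 'k::field) mpoly set \<Rightarrow> ereal" where
  "reg_quotient J = Sup {ereal (of_int (j - int i)) | i j. betti J i j \<noteq> 0}"

end

theory Submission
  imports Defs "HOL-Library.Function_Algebras" "HOL-Library.Product_Lexorder"
begin

text \<open>
  Let \<open>I\<^sub>i = \<langle>f\<^sub>1, \<dots>, f\<^sub>i\<rangle>\<close>, \<open>I = I\<^sub>n\<close>, and write \<open>reg J\<close> for the regularity of \<open>A/J\<close>.  For a form \<open>f\<close> of degree \<open>d\<close> the
  exact sequence
  \<open>0 \<rightarrow> (A/(J : f))(-d) \<rightarrow> A/J \<rightarrow> A/(J + \<langle>f\<rangle>) \<rightarrow> 0\<close>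
  bounds each of \<open>reg (J : f) + d\<close>, \<open>reg J\<close>, \<open>reg (J + \<langle>f\<rangle>)\<close> by the other two (\<open>reg_le_left\<close>, \<open>reg_le_middle\<close>,
  \<open>reg_le_right\<close>).  The theorem follows by applying this sequence three times.

  First, a regular sequence: \<open>I\<^sub>i : f\<^sub>i\<^sub>+\<^sub>1 = I\<^sub>i\<close> for \<open>i < n - 1\<close>, and hence \<open>reg I\<^sub>i\<close> is the sum of the numbers
  \<open>d\<^sub>l - 1\<close> for \<open>l \<le> i\<close> (\<open>reg_complete_intersection\<close>).

  Second, the case \<open>i = n - 1\<close>.  The hypothesis says that \<open>reg I < reg I\<^sub>n\<^sub>-\<^sub>1\<close>, and therefore
  \<open>reg (I\<^sub>n\<^sub>-\<^sub>1 : f\<^sub>n) + d\<^sub>n = reg I\<^sub>n\<^sub>-\<^sub>1\<close> (\<open>reg_colon_last\<close>).  For a d-sequence \<open>I\<^sub>n\<^sub>-\<^sub>1 : f\<^sub>n\<^sup>s = I\<^sub>n\<^sub>-\<^sub>1 : f\<^sub>n\<close> for \<open>s \<ge> 1\<close>, and \<open>I\<^sub>n\<^sub>-\<^sub>1 + I\<^sup>s\<close> is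
  \<open>I\<^sub>n\<^sub>-\<^sub>1 + \<langle>f\<^sub>n\<^sup>s\<rangle>\<close>.  If \<open>s \<ge> 2\<close>, then the left module \<open>(A/(I\<^sub>n\<^sub>-\<^sub>1 : f\<^sub>n))(-s d\<^sub>n)\<close> has regularity
  \<open>reg I\<^sub>n\<^sub>-\<^sub>1 + (s - 1) d\<^sub>n\<close>, which exceeds that of the middle module, and the regularity of the right module is one
  less.  This is the asserted value (\<open>reg_sum_pow_last\<close>).

  Third, descending induction on \<open>i\<close>.  A d-sequence satisfies
  \<open>I\<^sub>i \<inter> I\<^sup>s \<subseteq> I\<^sub>i I\<^sup>s\<^sup>-\<^sup>1\<close> (\<open>inter_pow\<close>), from which \<open>(I\<^sub>i + I\<^sup>s) : f\<^sub>i\<^sub>+\<^sub>1 = I\<^sub>i + I\<^sup>s\<^sup>-\<^sup>1\<close> for \<open>i < n - 1\<close>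
  (\<open>colon_sum_pow\<close>).  By induction on \<open>s\<close>, or by the hypothesis on \<open>reg I\<close> if \<open>s = 2\<close>, and since \<open>d\<^sub>n\<close> is the
  largest degree, \<open>reg (I\<^sub>i + I\<^sup>s\<^sup>-\<^sup>1) + d\<^sub>i\<^sub>+\<^sub>1\<close> is at most \<open>reg (I\<^sub>i\<^sub>+\<^sub>1 + I\<^sup>s)\<close>, so that \<open>reg (I\<^sub>i + I\<^sup>s) = reg (I\<^sub>i\<^sub>+\<^sub>1 + I\<^sup>s)\<close>
  (\<open>reg_descend\<close>).

  What remains is to justify the three bounds for a regularity that is defined through an arbitrary
  minimal graded free resolution.  Such resolutions exist, because graded submodules of
  free modules are finitely generated (\<open>graded_submodule_fg\<close>, by leading terms and Dickson's lemma) and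
  because syzygies of minimal generators have no constant entries (\<open>minimal_generators\<close>).  In particular the
  residue field \<open>K\<close> has a resolution, and \<open>\<beta>\<^sub>i\<^sub>,\<^sub>k(A/J)\<close> is nonzero iff \<open>Tor\<^sub>i(A/J, K)\<^sub>k\<close>, computed from the
  resolution of \<open>K\<close>, is nonzero.  This symmetry of \<open>Tor\<close> is proved by shifting along the diagonals of the
  double complex of the two resolutions (\<open>vanishes_shift\<close>, \<open>betti_nonzero_iff\<close>).  The bounds are then read off the long
  exact sequence of \<open>Tor\<close>.
\<close>

section \<open>Homogeneous components\<close>

abbreviation lookup where "lookup \<equiv> Poly_Mapping.lookup"
abbreviation keys where "keys \<equiv> Poly_Mapping.keys"

lemma monomial_degree_add: "monomial_degree (s + t) = monomial_degree s + monomial_degree t"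
  by (simp add: monomial_degree_def lookup_add sum.distrib)

lemma monomial_degree_0 [simp]: "monomial_degree 0 = 0"
  by (simp add: monomial_degree_def)

lemma monomial_degree_eq_0: "monomial_degree t = 0 \<longleftrightarrow> t = 0"
  by (auto simp: monomial_degree_def intro: poly_mapping_eqI)

lift_definition hcomp :: "int \<Rightarrow> ('v::finite, 'k::zero) mpoly \<Rightarrow> ('v, 'k) mpoly"
  is "\<lambda>k p t. if int (monomial_degree t) = k then p t else 0"
  by (auto elim: rev_finite_subset)

lemma lookup_hcomp: "lookup (hcomp k p) t = (if int (monomial_degree t) = k then lookup p t else 0)"
  by transfer simp

lemma forms_iff_lookup: "p \<in> forms d \<longleftrightarrow> (\<forall>t. lookup p t \<noteq> 0 \<longrightarrow> int (monomial_degree t) = d)"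
  by (auto simp: forms_def in_keys_iff)

lemma hcomp_in_forms [simp]: "hcomp k p \<in> forms k"
  by (auto simp: forms_iff_lookup lookup_hcomp split: if_splits)

lemma hcomp_id: "p \<in> forms k \<Longrightarrow> hcomp k p = p"
  by (rule poly_mapping_eqI) (auto simp: forms_iff_lookup lookup_hcomp)

lemma hcomp_other: "p \<in> forms k \<Longrightarrow> k \<noteq> l \<Longrightarrow> hcomp l p = 0"
  by (rule poly_mapping_eqI) (auto simp: forms_iff_lookup lookup_hcomp)

lemma hcomp_0 [simp]: "hcomp k 0 = 0"
  by (rule poly_mapping_eqI) (simp add: lookup_hcomp)

lemma hcomp_add: "hcomp k (p + q) = hcomp k p + hcomp k q"
  for p q :: "('v::finite, 'k::comm_monoid_add) mpoly"
  by (rule poly_mapping_eqI) (simp add: lookup_hcomp lookup_add)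

lemma hcomp_diff: "hcomp k (p - q) = hcomp k p - hcomp k q"
  for p q :: "('v::finite, 'k::ab_group_add) mpoly"
  by (rule poly_mapping_eqI) (simp add: lookup_hcomp lookup_minus)

lemma hcomp_sum: "hcomp k (sum f U) = (\<Sum>x\<in>U. hcomp k (f x))"
  for f :: "'i \<Rightarrow> ('v::finite, 'k::comm_monoid_add) mpoly"
  by (induction U rule: infinite_finite_induct) (simp_all add: hcomp_add)

lemma forms_0 [simp]: "0 \<in> forms k"
  by (simp add: forms_def)

lemma forms_add: "p \<in> forms k \<Longrightarrow> q \<in> forms k \<Longrightarrow> p + q \<in> forms k"
  for p q :: "('v::finite, 'k::comm_monoid_add) mpoly"
  by (metis hcomp_add hcomp_id hcomp_in_forms)

lemma forms_diff: "p \<in> forms k \<Longrightarrow> q \<in> forms k \<Longrightarrow> p - q \<in> forms k"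
  for p q :: "('v::finite, 'k::ab_group_add) mpoly"
  by (metis hcomp_diff hcomp_id hcomp_in_forms)

lemma forms_sum: "(\<And>x. x \<in> U \<Longrightarrow> f x \<in> forms k) \<Longrightarrow> sum f U \<in> forms k"
  for f :: "'i \<Rightarrow> ('v::finite, 'k::comm_monoid_add) mpoly"
  by (induction U rule: infinite_finite_induct) (simp_all add: forms_add)

lemma forms_mult: "p \<in> forms k \<Longrightarrow> q \<in> forms l \<Longrightarrow> p * q \<in> forms (k + l)"
  for p q :: "('v::finite, 'k::comm_semiring_0) mpoly"
  using keys_mult[of p q] by (fastforce simp: forms_def monomial_degree_add)

lemma forms_one: "1 \<in> forms 0"
  for dummy :: "('v::finite, 'k::comm_semiring_1) mpoly"
  by (simp add: forms_def)

lemma forms_power: "p \<in> forms k \<Longrightarrow> p ^ s \<in> forms (int s * k)"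
  for p :: "('v::finite, 'k::comm_semiring_1) mpoly"
proof (induction s)
  case 0
  show ?case by (simp add: forms_def)
next
  case (Suc s)
  then show ?case using forms_mult[of p k "p ^ s" "int s * k"] by (simp add: algebra_simps)
qed

lemma sum_hcomp:
  fixes p :: "('v::finite, 'k::comm_monoid_add) mpoly"
  assumes "\<And>t. t \<in> keys p \<Longrightarrow> int (monomial_degree t) \<in> U" "finite U"
  shows "(\<Sum>k\<in>U. hcomp k p) = p"
proof (rule poly_mapping_eqI)
  fix t
  have "lookup (\<Sum>k\<in>U. hcomp k p) t = (\<Sum>k\<in>U. if int (monomial_degree t) = k then lookup p t else 0)"
    by (simp add: lookup_sum lookup_hcomp)
  also have "\<dots> = (if int (monomial_degree t) \<in> U then lookup p t else 0)"
    using assms(2) by (subst sum.delta') auto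
  also have "\<dots> = lookup p t"
    using assms(1)[of t] by (auto simp: in_keys_iff)
  finally show "lookup (\<Sum>k\<in>U. hcomp k p) t = lookup p t" .
qed

lemma hcomp_decomposition:
  fixes p :: "('v::finite, 'k::comm_monoid_add) mpoly"
  obtains U where "finite U" "\<And>Y. finite Y \<Longrightarrow> U \<subseteq> Y \<Longrightarrow> (\<Sum>k\<in>Y. hcomp k p) = p"
proof
  show "finite ((\<lambda>t. int (monomial_degree t)) ` keys p)" by simp
  show "(\<Sum>k\<in>Y. hcomp k p) = p" if "finite Y" "(\<lambda>t. int (monomial_degree t)) ` keys p \<subseteq> Y" for Y
    using that by (intro sum_hcomp) auto
qed

text \<open>Multiplication by a form shifts the grading.  This is what allows every witness that the
  exactness statements below provide to be replaced by a homogeneous one.\<close>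

lemma hcomp_mult_form:
  fixes p q :: "('v::finite, 'k::comm_ring) mpoly"
  assumes "p \<in> forms d"
  shows "hcomp k (p * q) = p * hcomp (k - d) q"
proof -
  obtain U where U: "finite U" "\<And>Y. finite Y \<Longrightarrow> U \<subseteq> Y \<Longrightarrow> (\<Sum>k\<in>Y. hcomp k q) = q"
    using hcomp_decomposition by blast
  define Y where "Y = insert (k - d) U"
  have Y: "(\<Sum>j\<in>Y. hcomp j q) = q" "finite Y" using U by (auto simp: Y_def)
  have "hcomp k (p * q) = (\<Sum>j\<in>Y. hcomp k (p * hcomp j q))"
    by (subst Y(1)[symmetric]) (simp only: sum_distrib_left hcomp_sum)
  also have "\<dots> = (\<Sum>j\<in>Y. if j = k - d then p * hcomp (k - d) q else 0)"
  proof (rule sum.cong[OF refl])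
    fix j
    have f: "p * hcomp j q \<in> forms (d + j)"
      by (intro forms_mult assms) simp
    then show "hcomp k (p * hcomp j q) = (if j = k - d then p * hcomp (k - d) q else 0)"
      by (cases "j = k - d") (auto simp: hcomp_id hcomp_other)
  qed
  also have "\<dots> = p * hcomp (k - d) q"
    using Y(2) by (simp add: Y_def sum.delta)
  finally show ?thesis .
qed

lemma hcomp_zero_degree: "hcomp 0 p = Poly_Mapping.single 0 (lookup p 0)"
  by (rule poly_mapping_eqI) (auto simp: lookup_hcomp monomial_degree_eq_0 lookup_single when_def)

lemma lookup_form_at_0: "p \<in> forms k \<Longrightarrow> k \<noteq> 0 \<Longrightarrow> lookup p 0 = 0"
  by (auto simp: forms_iff_lookup)

text \<open>The constant term is the ring homomorphism to the field that annihilates the variables; a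
  product of monomials is \<open>1\<close> only if both of them are.\<close>

lemma lookup_mult_0:
  fixes p q :: "('v::finite, 'k::comm_ring) mpoly"
  shows "lookup (p * q) 0 = lookup p 0 * lookup q 0"
proof -
  have *: "lookup (p' * q) 0 = 0" if "lookup p' 0 = 0" for p' q :: "('v, 'k) mpoly"
  proof (rule ccontr)
    assume "lookup (p' * q) 0 \<noteq> 0"
    then have "0 \<in> keys (p' * q)" by (simp add: in_keys_iff)
    then obtain s t where st: "s \<in> keys p'" "0 = s + t" using keys_mult[of p' q] by blast
    from st(2) have "monomial_degree s + monomial_degree t = 0"
      by (metis monomial_degree_0 monomial_degree_add)
    then have "s = 0" by (simp add: monomial_degree_eq_0)
    with st(1) that show False by (simp add: in_keys_iff)
  qed
  define p0 where "p0 = Poly_Mapping.single (0 :: 'v \<Rightarrow>\<^sub>0 nat) (lookup p 0)"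
  define q0 where "q0 = Poly_Mapping.single (0 :: 'v \<Rightarrow>\<^sub>0 nat) (lookup q 0)"
  have "p * q = p0 * q0 + ((p - p0) * q + (q - q0) * p0)" by (simp add: algebra_simps)
  moreover have "lookup ((p - p0) * q) 0 = 0" "lookup ((q - q0) * p0) 0 = 0"
    by (rule *, simp add: p0_def q0_def lookup_minus)+
  moreover have "lookup (p0 * q0) 0 = lookup p 0 * lookup q 0"
    by (simp add: p0_def q0_def mult_single)
  ultimately show ?thesis by (simp add: lookup_add)
qed

section \<open>Ideals\<close>

definition is_ideal :: "'a::comm_ring_1 set \<Rightarrow> bool" where
  "is_ideal J \<longleftrightarrow> 0 \<in> J \<and> (\<forall>x\<in>J. \<forall>y\<in>J. x + y \<in> J) \<and> (\<forall>x\<in>J. \<forall>a. a * x \<in> J)"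

lemma is_idealD:
  assumes "is_ideal J"
  shows "0 \<in> J" "x \<in> J \<Longrightarrow> y \<in> J \<Longrightarrow> x + y \<in> J" "x \<in> J \<Longrightarrow> a * x \<in> J" "x \<in> J \<Longrightarrow> x * a \<in> J"
    "x \<in> J \<Longrightarrow> - x \<in> J" "x \<in> J \<Longrightarrow> y \<in> J \<Longrightarrow> x - y \<in> J"
proof -
  show 1: "0 \<in> J" and 2: "\<And>x y. x \<in> J \<Longrightarrow> y \<in> J \<Longrightarrow> x + y \<in> J"
    and 3: "\<And>x a. x \<in> J \<Longrightarrow> a * x \<in> J"
    using assms by (auto simp: is_ideal_def)
  show "\<And>x a. x \<in> J \<Longrightarrow> x * a \<in> J" using 3 by (metis mult.commute)
  show 4: "\<And>x. x \<in> J \<Longrightarrow> - x \<in> J" using 3[of _ "-1"] by simp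
  show "\<And>x y. x \<in> J \<Longrightarrow> y \<in> J \<Longrightarrow> x - y \<in> J" using 2 4 by (metis diff_conv_add_uminus)
qed

lemma is_ideal_sum: "is_ideal J \<Longrightarrow> (\<And>x. x \<in> U \<Longrightarrow> g x \<in> J) \<Longrightarrow> sum g U \<in> J"
  by (induction U rule: infinite_finite_induct) (auto simp: is_idealD)

definition homogeneous :: "('v::finite, 'k::comm_ring_1) mpoly set \<Rightarrow> bool" where
  "homogeneous J \<longleftrightarrow> is_ideal J \<and> (\<forall>x\<in>J. \<forall>k. hcomp k x \<in> J)"

lemma homogeneousD: "homogeneous J \<Longrightarrow> is_ideal J" "homogeneous J \<Longrightarrow> x \<in> J \<Longrightarrow> hcomp k x \<in> J"
  by (auto simp: homogeneous_def)

section \<open>Graded free modules\<close>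

text \<open>An element of a free module of rank \<open>r\<close> is a function on all of \<^typ>\<open>nat\<close> that vanishes from
  \<open>r\<close> on.  In this way the elements of free modules of all ranks share one type, which is an
  additive group, and the same holds for tensor products of free modules.\<close>

definition fvec :: "nat \<Rightarrow> (nat \<Rightarrow> 'a::zero) set" where
  "fvec r = {x. \<forall>p\<ge>r. x p = 0}"

text \<open>The component of degree \<open>k\<close> of the direct sum of the modules \<open>A(-b)\<close> for \<open>b\<close> in the list \<open>B\<close>.\<close>

definition gvec :: "int list \<Rightarrow> int \<Rightarrow> (nat \<Rightarrow> ('v::finite, 'k::zero) mpoly) set" where
  "gvec B k = {x \<in> fvec (length B). \<forall>p<length B. x p \<in> forms (k - B ! p)}"

definition gcomp :: "int list \<Rightarrow> int \<Rightarrow> (nat \<Rightarrow> ('v::finite, 'k::zero) mpoly) \<Rightarrow> nat \<Rightarrow> ('v, 'k) mpoly" where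
  "gcomp B k x = (\<lambda>p. if p < length B then hcomp (k - B ! p) (x p) else 0)"

definition gmat :: "int list \<Rightarrow> int list \<Rightarrow> (nat \<Rightarrow> nat \<Rightarrow> ('v::finite, 'k::zero) mpoly) \<Rightarrow> bool" where
  "gmat B C M \<longleftrightarrow> (\<forall>p<length B. \<forall>q<length C. M p q \<in> forms (C ! q - B ! p))"

definition mat_vec :: "nat \<Rightarrow> nat \<Rightarrow> (nat \<Rightarrow> nat \<Rightarrow> 'a::comm_ring_1) \<Rightarrow> (nat \<Rightarrow> 'a) \<Rightarrow> nat \<Rightarrow> 'a" where
  "mat_vec r s M x = (\<lambda>p. if p < r then \<Sum>q<s. M p q * x q else 0)"

definition smul :: "'a::comm_ring_1 \<Rightarrow> (nat \<Rightarrow> 'a) \<Rightarrow> nat \<Rightarrow> 'a" where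
  "smul a x = (\<lambda>p. a * x p)"

lemma smul_apply [simp]: "smul a x p = a * x p"
  by (simp add: smul_def)

lemma fvec_closed:
  "0 \<in> fvec r" "x \<in> fvec r \<Longrightarrow> y \<in> fvec r \<Longrightarrow> x + y \<in> fvec r"
  "x \<in> fvec r \<Longrightarrow> y \<in> fvec r \<Longrightarrow> x - y \<in> fvec r" "x \<in> fvec r \<Longrightarrow> smul a x \<in> fvec r"
  for x y :: "nat \<Rightarrow> 'a::comm_ring_1"
  by (auto simp: fvec_def)

lemma gvec_closed:
  "0 \<in> gvec B k" "x \<in> gvec B k \<Longrightarrow> y \<in> gvec B k \<Longrightarrow> x + y \<in> gvec B k"
  "x \<in> gvec B k \<Longrightarrow> y \<in> gvec B k \<Longrightarrow> x - y \<in> gvec B k"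
  for x y :: "nat \<Rightarrow> ('v::finite, 'k::comm_ring_1) mpoly"
  by (auto simp: gvec_def fvec_closed forms_add forms_diff)

lemma gvec_smul: "x \<in> gvec B k \<Longrightarrow> a \<in> forms d \<Longrightarrow> smul a x \<in> gvec B (k + d)"
  for x :: "nat \<Rightarrow> ('v::finite, 'k::comm_ring_1) mpoly"
  by (auto simp: gvec_def fvec_closed) (metis add.commute add_diff_eq forms_mult)

lemma gcomp_in_gvec [simp]: "gcomp B k x \<in> gvec B k"
  by (auto simp: gcomp_def gvec_def fvec_def)

lemma gcomp_id: "x \<in> gvec B k \<Longrightarrow> gcomp B k x = x"
  by (auto simp: gcomp_def gvec_def fvec_def hcomp_id fun_eq_iff)

lemma gcomp_0 [simp]: "gcomp B k 0 = 0"
  by (auto simp: gcomp_def fun_eq_iff)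

lemma gcomp_mat_vec:
  assumes "gmat B C M"
  shows "gcomp B k (mat_vec (length B) (length C) M w) = mat_vec (length B) (length C) M (gcomp C k w)"
proof
  fix p
  show "gcomp B k (mat_vec (length B) (length C) M w) p = mat_vec (length B) (length C) M (gcomp C k w) p"
  proof (cases "p < length B")
    case True
    have "hcomp (k - B ! p) (\<Sum>q<length C. M p q * w q)
        = (\<Sum>q<length C. M p q * gcomp C k w q)"
      unfolding hcomp_sum
    proof (rule sum.cong[OF refl])
      fix q assume "q \<in> {..<length C}"
      then have "M p q \<in> forms (C ! q - B ! p)" using True assms by (auto simp: gmat_def)
      from hcomp_mult_form[OF this, of "k - B ! p" "w q"]
      show "hcomp (k - B ! p) (M p q * w q) = M p q * gcomp C k w q"
        using \<open>q \<in> _\<close> by (simp add: gcomp_def)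
    qed
    with True show ?thesis by (simp add: gcomp_def mat_vec_def)
  qed (simp add: gcomp_def mat_vec_def)
qed

lemma mat_vec_in_fvec [simp]: "mat_vec r s M x \<in> fvec r"
  by (simp add: mat_vec_def fvec_def)

lemma mat_vec_in_gvec: "gmat B C M \<Longrightarrow> w \<in> gvec C k \<Longrightarrow> mat_vec (length B) (length C) M w \<in> gvec B k"
  by (metis gcomp_id gcomp_in_gvec gcomp_mat_vec)

lemma mat_vec_0 [simp]: "mat_vec r s M 0 = 0"
  by (auto simp: mat_vec_def)

lemma mat_vec_add: "mat_vec r s M (x + y) = mat_vec r s M x + mat_vec r s M y"
  by (auto simp: mat_vec_def fun_eq_iff sum.distrib distrib_left)

lemma mat_vec_diff: "mat_vec r s M (x - y) = mat_vec r s M x - mat_vec r s M y"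
  by (auto simp: mat_vec_def fun_eq_iff sum_subtractf right_diff_distrib)

lemma mat_vec_smul: "mat_vec r s M (smul a x) = smul a (mat_vec r s M x)"
  by (auto simp: mat_vec_def fun_eq_iff sum_distrib_left mult_ac)

lemma mat_vec_in_ideal: "is_ideal J \<Longrightarrow> (\<And>q. q < s \<Longrightarrow> x q \<in> J) \<Longrightarrow> mat_vec r s M x p \<in> J"
  by (auto simp: mat_vec_def is_idealD intro!: is_ideal_sum)

lemma sum_gcomp:
  fixes x :: "nat \<Rightarrow> ('v::finite, 'k::comm_ring_1) mpoly"
  assumes "x \<in> fvec (length B)"
  obtains U where "finite U" "(\<Sum>k\<in>U. gcomp B k x) = x"
proof -
  have "\<forall>p. \<exists>U. finite U \<and> (\<forall>Y. finite Y \<longrightarrow> U \<subseteq> Y \<longrightarrow> (\<Sum>k\<in>Y. hcomp k (x p)) = x p)"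
    using hcomp_decomposition by metis
  then obtain U where U: "\<And>p. finite (U p)"
      "\<And>p Y. finite Y \<Longrightarrow> U p \<subseteq> Y \<Longrightarrow> (\<Sum>k\<in>Y. hcomp k (x p)) = x p"
    by metis
  define Z where "Z = (\<Union>p<length B. (\<lambda>k. k + B ! p) ` U p)"
  have "finite Z" using U by (simp add: Z_def)
  moreover have "(\<Sum>k\<in>Z. gcomp B k x) = x"
  proof
    fix p
    have "(\<Sum>k\<in>Z. gcomp B k x) p = (\<Sum>k\<in>Z. gcomp B k x p)"
      by (induction Z rule: infinite_finite_induct) auto
    also have "\<dots> = x p"
    proof (cases "p < length B")
      case True
      have "(\<Sum>k\<in>Z. gcomp B k x p) = (\<Sum>k\<in>Z. hcomp (k - B ! p) (x p))"
        using True by (simp add: gcomp_def)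
      also have "\<dots> = (\<Sum>k\<in>(\<lambda>k. k - B ! p) ` Z. hcomp k (x p))"
        by (subst sum.reindex) (auto simp: inj_on_def)
      also have "\<dots> = x p"
      proof (rule U(2))
        show "U p \<subseteq> (\<lambda>k. k - B ! p) ` Z"
        proof
          fix k assume "k \<in> U p"
          then have "k + B ! p \<in> Z" using True by (auto simp: Z_def)
          then show "k \<in> (\<lambda>k. k - B ! p) ` Z" by (metis add_diff_cancel_right' imageI)
        qed
      qed (use \<open>finite Z\<close> in simp)
      finally show ?thesis .
    next
      case False
      with assms show ?thesis by (simp add: gcomp_def fvec_def)
    qed
    finally show "(\<Sum>k\<in>Z. gcomp B k x) p = x p" .
  qed
  ultimately show thesis by (rule that)
qed

section \<open>Finite generation of graded submodules\<close>

text \<open>A monotone subsequence can be chosen; if it decreases it is eventually constant.\<close>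

lemma mono_subseq_nat:
  fixes a :: "nat \<Rightarrow> nat"
  obtains h :: "nat \<Rightarrow> nat" where "strict_mono h" "mono (\<lambda>n. a (h n))"
proof -
  obtain g where g: "strict_mono g" "monoseq (\<lambda>n. a (g n))" using seq_monosub by metis
  from g(2) consider "incseq (\<lambda>n. a (g n))" | "decseq (\<lambda>n. a (g n))" by (auto simp: monoseq_iff)
  then show thesis
  proof cases
    case 1
    with g(1) show thesis by (intro that[of g]) auto
  next
    case 2
    define m where "m = (LEAST y. \<exists>n. a (g n) = y)"
    have "\<exists>n. a (g n) = m" unfolding m_def by (rule LeastI_ex) blast
    then obtain N where N: "a (g N) = m" by blast
    have c: "a (g (n + N)) = m" for n
    proof (rule antisym)
      show "a (g (n + N)) \<le> m" using decseqD[OF 2, of N "n + N"] N by simp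
      show "m \<le> a (g (n + N))" unfolding m_def by (rule Least_le) blast
    qed
    show thesis
    proof (rule that[of "\<lambda>n. g (n + N)"])
      show "strict_mono (\<lambda>n. g (n + N))" using g(1) by (simp add: strict_mono_def)
      show "mono (\<lambda>n. a (g (n + N)))" by (simp add: c mono_def)
    qed
  qed
qed

text \<open>The coordinates are treated one after the other, each time passing to a further subsequence.\<close>

lemma mono_subseq_monomials:
  fixes t :: "nat \<Rightarrow> ('v \<Rightarrow>\<^sub>0 nat)"
  assumes "finite V"
  shows "\<exists>h :: nat \<Rightarrow> nat. strict_mono h \<and> (\<forall>x\<in>V. mono (\<lambda>n. lookup (t (h n)) x))"
  using assms
proof (induction V)
  case empty
  show ?case by (rule exI[of _ id]) (auto simp: strict_mono_def)
next
  case (insert y V)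
  from insert.IH obtain h :: "nat \<Rightarrow> nat"
    where "strict_mono h \<and> (\<forall>x\<in>V. mono (\<lambda>n. lookup (t (h n)) x))" ..
  then have h: "strict_mono h" "\<And>x. x \<in> V \<Longrightarrow> mono (\<lambda>n. lookup (t (h n)) x)" by auto
  obtain g :: "nat \<Rightarrow> nat" where g: "strict_mono g" "mono (\<lambda>n. lookup (t (h (g n))) y)"
    by (rule mono_subseq_nat[of "\<lambda>n. lookup (t (h n)) y"])
  have "mono (\<lambda>n. lookup (t (h (g n))) x)" if "x \<in> V" for x
    using h(2)[OF that] g(1) by (simp add: mono_def strict_mono_less_eq)
  moreover have "strict_mono (h \<circ> g)" using h(1) g(1) by (rule strict_mono_o)
  ultimately show ?case using g(2) by (intro exI[of _ "h \<circ> g"]) (auto simp: o_def)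
qed

text \<open>Dickson's lemma.  Otherwise one could choose successively members of \<open>L\<close>, none of them a multiple
  of an earlier one; but a subsequence whose exponents are all monotone contradicts this.\<close>

lemma dickson:
  fixes L :: "('v::finite \<Rightarrow>\<^sub>0 nat) set"
  shows "\<exists>F\<subseteq>L. finite F \<and> (\<forall>t\<in>L. \<exists>s\<in>F. \<exists>u. t = s + u)"
proof (rule ccontr)
  assume neg: "\<not> ?thesis"
  have *: "\<exists>t\<in>L. \<forall>s\<in>F. \<forall>u. t \<noteq> s + u" if "finite F" "F \<subseteq> L" for F
  proof (rule ccontr)
    assume "\<not> ?thesis"
    then have "\<forall>t\<in>L. \<exists>s\<in>F. \<exists>u. t = s + u" by simp
    with that have F: "F \<subseteq> L \<and> finite F \<and> (\<forall>t\<in>L. \<exists>s\<in>F. \<exists>u. t = s + u)" by simp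
    show False by (rule notE[OF neg], rule exI[of _ F], rule F)
  qed
  have "\<exists>t :: nat \<Rightarrow> _. \<forall>n. t n \<in> L \<and> (\<forall>m<n. \<forall>u. t n \<noteq> t m + u)"
  proof (rule dependent_wellorder_choice[where P = "\<lambda>t n r. r \<in> L \<and> (\<forall>m<n. \<forall>u. r \<noteq> t m + u)"])
    fix n and t :: "nat \<Rightarrow> ('v \<Rightarrow>\<^sub>0 nat)"
    assume "\<And>m. m < n \<Longrightarrow> t m \<in> L \<and> (\<forall>l<m. \<forall>u. t m \<noteq> t l + u)"
    then have "t ` {..<n} \<subseteq> L" by auto
    from *[OF _ this] obtain r where "r \<in> L" "\<forall>s\<in>t ` {..<n}. \<forall>u. r \<noteq> s + u" by auto
    then show "\<exists>r. r \<in> L \<and> (\<forall>m<n. \<forall>u. r \<noteq> t m + u)" by (intro exI[of _ r]) simp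
  qed simp
  then obtain t :: "nat \<Rightarrow> _" where "\<forall>n. t n \<in> L \<and> (\<forall>m<n. \<forall>u. t n \<noteq> t m + u)" ..
  then have t: "t n \<noteq> t m + u" if "m < n" for n m u using that by auto
  from mono_subseq_monomials[of UNIV t] obtain h :: "nat \<Rightarrow> nat"
    where "strict_mono h \<and> (\<forall>x\<in>UNIV. mono (\<lambda>n. lookup (t (h n)) x))" by auto
  then have h: "strict_mono h" "\<And>x. mono (\<lambda>n. lookup (t (h n)) x)" by auto
  have "t (h 1) = t (h 0) + (t (h 1) - t (h 0))"
    using h(2) by (intro poly_mapping_eqI) (simp add: lookup_add lookup_minus mono_def)
  moreover have "h 0 < h 1" using h(1) by (simp add: strict_mono_def)
  ultimately show False using t by blast
qed

lemma finite_monomials_of_degree: "finite {t :: 'v::finite \<Rightarrow>\<^sub>0 nat. monomial_degree t = d}"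
proof (rule finite_imageD)
  have "lookup ` {t :: 'v \<Rightarrow>\<^sub>0 nat. monomial_degree t = d} \<subseteq> {h. \<forall>x. (x \<in> UNIV \<longrightarrow> h x \<in> {..d}) \<and> (x \<notin> UNIV \<longrightarrow> h x = 0)}"
  proof clarsimp
    fix t :: "'v \<Rightarrow>\<^sub>0 nat" and x
    show "lookup t x \<le> monomial_degree t"
      unfolding monomial_degree_def by (rule member_le_sum) auto
  qed
  then show "finite (lookup ` {t :: 'v \<Rightarrow>\<^sub>0 nat. monomial_degree t = d})"
    by (rule finite_subset) (intro finite_set_of_finite_funs finite_UNIV finite_atMost)
qed (auto simp: inj_on_def)

lemma lookup_single_mult:
  "lookup (Poly_Mapping.single u c * p) (u + t) = c * lookup p t"
  for p :: "('v, 'k::comm_ring_1) mpoly"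
proof -
  have "lookup (Poly_Mapping.single u c * p) (u + t)
      = (\<Sum>l. (c when u = l) * (\<Sum>q. lookup p q when u + t = l + q))"
    by (simp add: lookup_mult lookup_single)
  also have "\<dots> = (\<Sum>l. (c * (\<Sum>q. lookup p q when u + t = u + q)) when u = l)"
    by (rule Sum_any.cong) (auto simp: when_def)
  also have "\<dots> = c * lookup p t" by simp
  finally show ?thesis .
qed

interpretation fmod: Modules.module "smul :: 'a::comm_ring_1 \<Rightarrow> (nat \<Rightarrow> 'a) \<Rightarrow> nat \<Rightarrow> 'a"
  by unfold_locales (auto simp: fun_eq_iff algebra_simps)

definition graded_submodule :: "int list \<Rightarrow> (nat \<Rightarrow> ('v::finite, 'k::comm_ring_1) mpoly) set \<Rightarrow> bool" where
  "graded_submodule B S \<longleftrightarrow> S \<subseteq> fvec (length B) \<and> fmod.subspace S \<and> (\<forall>x\<in>S. \<forall>k. gcomp B k x \<in> S)"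

text \<open>The terms of a vector are pairs of a position and a monomial.  They are ordered
  lexicographically, position first.\<close>

definition vterms :: "nat \<Rightarrow> (nat \<Rightarrow> ('v, 'k::zero) mpoly) \<Rightarrow> (nat \<times> ('v \<Rightarrow>\<^sub>0 nat)) set" where
  "vterms r x = Sigma {..<r} (\<lambda>p. keys (x p))"

lemma finite_vterms [simp]: "finite (vterms r x)"
  by (simp add: vterms_def)

lemma vterms_eq_empty:
  assumes x: "x \<in> fvec r"
  shows "vterms r x = {} \<longleftrightarrow> x = 0"
proof
  assume e: "vterms r x = {}"
  show "x = 0"
  proof
    fix p
    show "x p = 0 p"
    proof (cases "p < r")
      case True
      with e have "keys (x p) = {}" unfolding vterms_def by blast
      then show ?thesis by simp
    qed (use x in \<open>simp add: fvec_def\<close>)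
  qed
qed (simp add: vterms_def)

lemma mem_vterms: "(p, t) \<in> vterms r x \<longleftrightarrow> p < r \<and> lookup (x p) t \<noteq> 0"
  by (auto simp: vterms_def in_keys_iff)

definition leading_term :: "nat \<Rightarrow> (nat \<Rightarrow> ('v::linorder, 'k::zero) mpoly) \<Rightarrow> nat \<times> ('v \<Rightarrow>\<^sub>0 nat)" where
  "leading_term r x = Max (vterms r x)"

lemma leading_term:
  assumes "x \<in> fvec r" "x \<noteq> 0"
  shows "leading_term r x \<in> vterms r x" "\<tau> \<in> vterms r x \<Longrightarrow> \<tau> \<le> leading_term r x"
proof -
  have "vterms r x \<noteq> {}" using vterms_eq_empty assms by blast
  then show "leading_term r x \<in> vterms r x" "\<tau> \<in> vterms r x \<Longrightarrow> \<tau> \<le> leading_term r x"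
    by (simp_all add: leading_term_def)
qed

text \<open>One division step: the multiple of \<open>g\<close> by the right monomial has the same leading term as \<open>x\<close>, and
  the order is compatible with multiplication by monomials.\<close>

lemma reduce_leading_term:
  fixes x g :: "nat \<Rightarrow> ('v::{finite,linorder}, 'k::field) mpoly"
  assumes x: "x \<in> gvec B k" "x \<noteq> 0" "leading_term (length B) x = (p, s + u)"
    and g: "g \<in> gvec B l" "g \<noteq> 0" "leading_term (length B) g = (p, s)"
  obtains a where "x - smul a g \<in> gvec B k"
    "x - smul a g \<noteq> 0 \<Longrightarrow> leading_term (length B) (x - smul a g) < leading_term (length B) x"
proof
  let ?r = "length B"
  define c where "c = lookup (x p) (s + u) / lookup (g p) s"
  define a where "a = Poly_Mapping.single u c"
  define y where "y = x - smul a g"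
  have xf: "x \<in> fvec ?r" and gf: "g \<in> fvec ?r" using x(1) g(1) by (auto simp: gvec_def)
  have px: "p < ?r" "lookup (x p) (s + u) \<noteq> 0"
    using leading_term(1)[OF xf x(2)] x(3) by (auto simp: mem_vterms)
  have pg: "lookup (g p) s \<noteq> 0"
    using leading_term(1)[OF gf g(2)] g(3) by (auto simp: mem_vterms)
  have "int (monomial_degree (s + u)) = k - B ! p" "int (monomial_degree s) = l - B ! p"
    using x(1) g(1) px pg by (auto simp: gvec_def forms_iff_lookup)
  then have "k = l + int (monomial_degree u)" by (simp add: monomial_degree_add)
  moreover have "a \<in> forms (int (monomial_degree u))"
    by (auto simp: a_def forms_def split: if_splits)
  ultimately have "smul a g \<in> gvec B k" using gvec_smul[OF g(1)] by simp
  then have yg: "y \<in> gvec B k" unfolding y_def by (intro gvec_closed x(1))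
  then show "x - smul a g \<in> gvec B k" by (simp add: y_def)
  show "leading_term ?r (x - smul a g) < leading_term ?r x" if "x - smul a g \<noteq> 0"
  proof -
    have y: "y \<noteq> 0" "y \<in> fvec ?r" using that yg by (auto simp: y_def gvec_def)
    obtain q w where qw: "leading_term ?r y = (q, w)" by force
    then have q: "q < ?r" "lookup (y q) w \<noteq> 0"
      using leading_term(1)[OF y(2,1)] by (auto simp: mem_vterms)
    have "(q, w) \<le> (p, s + u)"
    proof (cases "lookup (x q) w = 0")
      case False
      with q leading_term(2)[OF xf x(2), of "(q, w)"] x(3) show ?thesis by (simp add: mem_vterms)
    next
      case True
      with q have "lookup (a * g q) w \<noteq> 0" by (simp add: y_def lookup_minus)
      then have "w \<in> keys (a * g q)" by (simp add: in_keys_iff)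
      then obtain v where v: "v \<in> keys (g q)" "w = u + v"
        using keys_mult[of a "g q"] by (auto simp: a_def split: if_splits)
      then have "(q, v) \<le> (p, s)"
        using q leading_term(2)[OF gf g(2), of "(q, v)"] g(3) by (simp add: mem_vterms in_keys_iff)
      then show ?thesis using v(2) by (auto simp: less_eq_prod_def add.commute[of s u] intro: add_left_mono)
    qed
    moreover have "(q, w) \<noteq> (p, s + u)"
    proof
      assume "(q, w) = (p, s + u)"
      moreover have "lookup (a * g p) (s + u) = c * lookup (g p) s"
        using lookup_single_mult[of u c "g p" s] by (simp add: a_def add.commute)
      ultimately show False using q(2) pg by (simp add: y_def lookup_minus c_def)
    qed
    ultimately have "(q, w) < (p, s + u)" by (rule order.not_eq_order_implies_strict[rotated])
    then show ?thesis using qw x(3) unfolding y_def by simp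
  qed
qed

text \<open>Hilbert's basis theorem in graded form.  For each position the leading monomials of homogeneous
  elements have a finite basis by Dickson's lemma; elements that realise this basis generate. Division
  by them ends because there are only finitely many terms of a given degree.\<close>

lemma graded_submodule_fg:
  fixes S :: "(nat \<Rightarrow> ('v::{finite,linorder}, 'k::field) mpoly) set"
  assumes S: "graded_submodule B S"
  shows "\<exists>G. finite G \<and> (\<forall>g\<in>G. \<exists>k. g \<in> gvec B k) \<and> fmod.span G = S"
proof -
  let ?r = "length B"
  have sub: "fmod.subspace S" using S by (simp add: graded_submodule_def)
  define H where "H = {x \<in> S. x \<noteq> 0 \<and> (\<exists>k. x \<in> gvec B k)}"
  define L where "L p = {t. \<exists>x\<in>H. leading_term ?r x = (p, t)}" for p
  have "\<forall>p. \<exists>F. F \<subseteq> L p \<and> finite F \<and> (\<forall>t\<in>L p. \<exists>s\<in>F. \<exists>u. t = s + u)"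
    by (intro allI dickson)
  from choice[OF this] obtain F
    where "\<forall>p. F p \<subseteq> L p \<and> finite (F p) \<and> (\<forall>t\<in>L p. \<exists>s\<in>F p. \<exists>u. t = s + u)" ..
  then have F: "F p \<subseteq> L p" "finite (F p)" "\<forall>t\<in>L p. \<exists>s\<in>F p. \<exists>u. t = s + u" for p
    by simp_all
  define g where "g p t = (SOME x. x \<in> H \<and> leading_term ?r x = (p, t))" for p t
  have g: "g p t \<in> H \<and> leading_term ?r (g p t) = (p, t)" if "t \<in> F p" for p t
  proof -
    have "\<exists>x. x \<in> H \<and> leading_term ?r x = (p, t)" using F(1)[of p] that by (auto simp: L_def)
    then show ?thesis unfolding g_def by (rule someI_ex)
  qed
  define G where "G = (\<Union>p<?r. g p ` F p)"
  have GH: "G \<subseteq> H" using g by (auto simp: G_def)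
  have homog: "x \<in> fmod.span G" if "x \<in> S" "x \<in> gvec B k" for x k
  proof -
    define T where "T = Sigma {..<?r} (\<lambda>p. {t :: 'v \<Rightarrow>\<^sub>0 nat. int (monomial_degree t) = k - B ! p})"
    have "finite {t :: 'v \<Rightarrow>\<^sub>0 nat. int (monomial_degree t) = j}" for j
      by (rule finite_subset[OF _ finite_monomials_of_degree[of "nat j"]]) auto
    then have finT: "finite T" unfolding T_def by (intro finite_SigmaI finite_lessThan)
    have "x \<in> fmod.span G" if "x \<in> S" "x \<in> gvec B k" "x \<noteq> 0"
      using that
    proof (induction "card {\<tau> \<in> T. \<tau> < leading_term ?r x}" arbitrary: x rule: less_induct)
      case less
      obtain p t where pt: "leading_term ?r x = (p, t)" by force
      have xH: "x \<in> H" using less.prems by (auto simp: H_def)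
      obtain s u where s: "s \<in> F p" "t = s + u" using F(3)[of p] xH pt by (auto simp: L_def)
      have gs: "g p s \<in> H" "leading_term ?r (g p s) = (p, s)" using g[OF s(1)] by auto
      then obtain l where l: "g p s \<in> gvec B l" "g p s \<noteq> 0" "g p s \<in> S" by (auto simp: H_def)
      have xf: "x \<in> fvec ?r" using less.prems by (auto simp: gvec_def)
      have "p < ?r" using leading_term(1)[OF xf less.prems(3)] pt by (simp add: mem_vterms)
      with s(1) have gG: "g p s \<in> fmod.span G" by (intro fmod.span_base) (auto simp: G_def)
      obtain a where a: "x - smul a (g p s) \<in> gvec B k"
          "x - smul a (g p s) \<noteq> 0 \<Longrightarrow> leading_term ?r (x - smul a (g p s)) < leading_term ?r x"
        using reduce_leading_term[OF less.prems(2,3) pt[unfolded s(2)] l(1,2) gs(2)] by blast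
      define y where "y = x - smul a (g p s)"
      have "y \<in> fmod.span G"
      proof (cases "y = 0")
        case False
        have yS: "y \<in> S" unfolding y_def
          using sub less.prems(1) l(3) by (intro fmod.subspace_diff fmod.subspace_scale)
        have lt: "leading_term ?r y < leading_term ?r x" using a(2) False by (simp add: y_def)
        have yk: "y \<in> gvec B k" using a(1) by (simp add: y_def)
        then have "leading_term ?r y \<in> vterms ?r y"
          using False by (intro leading_term) (auto simp: gvec_def)
        then have "leading_term ?r y \<in> T"
          using yk by (auto simp: T_def vterms_def gvec_def forms_def)
        with lt have "{\<tau> \<in> T. \<tau> < leading_term ?r y} \<subset> {\<tau> \<in> T. \<tau> < leading_term ?r x}" by auto
        then have "card {\<tau> \<in> T. \<tau> < leading_term ?r y} < card {\<tau> \<in> T. \<tau> < leading_term ?r x}"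
          using finT by (intro psubset_card_mono) auto
        from less.hyps[OF this yS yk False] show ?thesis .
      qed (simp add: fmod.span_zero)
      then have "y + smul a (g p s) \<in> fmod.span G"
        by (intro fmod.span_add fmod.span_scale gG)
      then show ?case by (simp add: y_def)
    qed
    then show ?thesis using that by (cases "x = 0") (auto simp: fmod.span_zero)
  qed
  have "fmod.span G = S"
  proof
    show "fmod.span G \<subseteq> S"
      using sub GH by (intro fmod.span_minimal) (auto simp: H_def)
    show "S \<subseteq> fmod.span G"
    proof
      fix x assume x: "x \<in> S"
      then have "x \<in> fvec ?r" using S by (auto simp: graded_submodule_def)
      then obtain U where "finite U" "(\<Sum>k\<in>U. gcomp B k x) = x" by (rule sum_gcomp)
      moreover have "(\<Sum>k\<in>U. gcomp B k x) \<in> fmod.span G"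
        using S x by (intro fmod.span_sum homog[OF _ gcomp_in_gvec]) (auto simp: graded_submodule_def)
      ultimately show "x \<in> fmod.span G" by simp
    qed
  qed
  moreover have "finite G" using F(2) by (simp add: G_def)
  ultimately show ?thesis using GH by (intro exI[of _ G]) (auto simp: H_def)
qed


lemma mat_vec_as_sum:
  assumes "\<And>q. q < s \<Longrightarrow> (\<lambda>p. M p q) \<in> fvec r"
  shows "mat_vec r s M w = (\<Sum>q<s. smul (w q) (\<lambda>p. M p q))"
proof
  fix p
  have "(\<Sum>q<s. smul (w q) (\<lambda>p. M p q)) p = (\<Sum>q<s. w q * M p q)"
    by (induction s) auto
  also have "\<dots> = mat_vec r s M w p"
    using assms by (auto simp: mat_vec_def fvec_def mult.commute intro!: sum.neutral)
  finally show "mat_vec r s M w p = (\<Sum>q<s. smul (w q) (\<lambda>p. M p q)) p" by simp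
qed

text \<open>Generators as few as possible admit only relations with entries in the irrelevant ideal: the
  degree-\<open>0\<close> component of any other relation would have an invertible entry, and the generator
  at this place could be expressed by the others.\<close>

lemma minimal_generators:
  fixes S :: "(nat \<Rightarrow> ('v::{finite,linorder}, 'k::field) mpoly) set"
  assumes S: "graded_submodule B S"
  obtains C M where "gmat B C M"
    "S = mat_vec (length B) (length C) M ` fvec (length C)"
    "\<And>w q. w \<in> fvec (length C) \<Longrightarrow> mat_vec (length B) (length C) M w = 0 \<Longrightarrow> lookup (w q) 0 = 0"
proof -
  let ?r = "length B"
  define P where "P G \<longleftrightarrow> finite G \<and> (\<forall>g\<in>G. \<exists>k. g \<in> gvec B k) \<and> fmod.span G = S" for G
  have "\<exists>G. P G" using graded_submodule_fg[OF S] by (simp add: P_def)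
  from ex_has_least_nat[of P _ card] this
  obtain G where G: "P G" "\<And>G'. P G' \<Longrightarrow> card G \<le> card G'" by metis
  obtain gs where gs: "distinct gs" "set gs = G" using G(1) finite_distinct_list by (auto simp: P_def)
  define dg where "dg g = (SOME k. g \<in> gvec B k)" for g :: "nat \<Rightarrow> ('v, 'k) mpoly"
  have dg: "g \<in> gvec B (dg g)" if "g \<in> G" for g
  proof -
    have "\<exists>k. g \<in> gvec B k" using that G(1) by (simp add: P_def)
    then show ?thesis unfolding dg_def by (rule someI_ex)
  qed
  define C where "C = map dg gs"
  define n where "n = length gs"
  have lC: "length C = n" by (simp add: C_def n_def)
  define M where "M p q = (gs ! q) p" for p q
  have Mq: "(\<lambda>p. M p q) = gs ! q" for q by (simp add: M_def)
  have gsq: "gs ! q \<in> gvec B (C ! q)" "gs ! q \<in> G" if "q < n" for q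
    using that dg[of "gs ! q"] gs(2) nth_mem[of q gs] by (simp_all add: C_def n_def)
  have gM: "gmat B C M" unfolding gmat_def
  proof (intro allI impI)
    fix p q assume "p < ?r" "q < length C"
    then show "M p q \<in> forms (C ! q - B ! p)"
      using gsq[of q] by (simp add: lC M_def gvec_def)
  qed
  have mvM: "mat_vec ?r n M w = (\<Sum>q<n. smul (w q) (gs ! q))" for w
    by (subst mat_vec_as_sum) (use gsq in \<open>auto simp: Mq gvec_def\<close>)
  have bij: "bij_betw ((!) gs) {..<n} G"
    using gs by (auto simp: n_def intro!: bij_betw_nth)
  show thesis
  proof (rule that)
    show "gmat B C M" by (rule gM)
    show "S = mat_vec ?r (length C) M ` fvec (length C)"
    proof (intro equalityI subsetI)
      fix x assume "x \<in> S"
      then have "x \<in> fmod.span G" using G(1) by (simp add: P_def)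
      then obtain u where u: "x = (\<Sum>g\<in>G. smul (u g) g)"
        using G(1) by (auto simp: P_def fmod.span_finite)
      define w where "w q = (if q < n then u (gs ! q) else 0)" for q
      have "x = (\<Sum>q<n. smul (u (gs ! q)) (gs ! q))"
        unfolding u by (rule sum.reindex_bij_betw[OF bij, symmetric])
      also have "\<dots> = mat_vec ?r n M w" unfolding mvM by (intro sum.cong) (auto simp: w_def)
      finally show "x \<in> mat_vec ?r (length C) M ` fvec (length C)"
        unfolding lC by (intro image_eqI[of _ _ w]) (auto simp: w_def fvec_def)
    next
      fix x assume "x \<in> mat_vec ?r (length C) M ` fvec (length C)"
      then obtain w where "x = mat_vec ?r n M w" by (auto simp: lC)
      then have "x = (\<Sum>q<n. smul (w q) (gs ! q))" using mvM by simp
      also have "\<dots> \<in> fmod.span G"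
        using gsq by (intro fmod.span_sum fmod.span_scale fmod.span_base) auto
      finally show "x \<in> S" using G(1) by (simp add: P_def)
    qed
    show "lookup (w q) 0 = 0"
      if w: "w \<in> fvec (length C)" "mat_vec ?r (length C) M w = 0" for w q
    proof (rule ccontr)
      assume c: "lookup (w q) 0 \<noteq> 0"
      define c where "c = lookup (w q) 0"
      have q: "q < n"
      proof (rule ccontr)
        assume "\<not> q < n"
        then have "w q = 0" using w(1) by (simp add: fvec_def lC)
        with c show False by simp
      qed
      \<comment> \<open>Only this degree keeps the constant term of the entry at place \<open>q\<close>.\<close>
      define v where "v = gcomp C (C ! q) w"
      have "mat_vec ?r n M v = 0"
        using gcomp_mat_vec[OF gM, of "C ! q" w] w(2) by (simp add: v_def lC)
      then have "(\<Sum>j<n. smul (v j) (gs ! j)) = 0" by (simp add: mvM)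
      moreover have "(\<Sum>j<n. smul (v j) (gs ! j))
          = smul (v q) (gs ! q) + (\<Sum>j\<in>{..<n} - {q}. smul (v j) (gs ! j))"
        using q by (intro sum.remove) auto
      ultimately have e: "smul (v q) (gs ! q) = - (\<Sum>j\<in>{..<n} - {q}. smul (v j) (gs ! j))"
        by (simp add: eq_neg_iff_add_eq_0)
      have "v q = Poly_Mapping.single 0 c"
        using q by (simp add: v_def gcomp_def lC hcomp_zero_degree c_def)
      then have "smul (Poly_Mapping.single 0 (inverse c)) (smul (v q) (gs ! q)) = gs ! q"
        using c by (simp add: fun_eq_iff mult.assoc[symmetric] mult_single c_def)
      then have "gs ! q = smul (Poly_Mapping.single 0 (inverse c)) (- (\<Sum>j\<in>{..<n} - {q}. smul (v j) (gs ! j)))"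
        by (simp add: e)
      also have "\<dots> \<in> fmod.span (G - {gs ! q})"
      proof (intro fmod.span_scale fmod.span_neg fmod.span_sum fmod.span_base)
        fix j assume "j \<in> {..<n} - {q}"
        then show "gs ! j \<in> G - {gs ! q}"
          using gsq(2)[of j] gs(1) q by (auto simp: nth_eq_iff_index_eq n_def)
      qed
      finally have mem: "gs ! q \<in> fmod.span (G - {gs ! q})" .
      have "fmod.span G \<subseteq> fmod.span (G - {gs ! q})"
      proof (rule fmod.span_minimal)
        show "G \<subseteq> fmod.span (G - {gs ! q})"
          using mem fmod.span_base[of _ "G - {gs ! q}"] by auto
      qed simp
      moreover have "fmod.span (G - {gs ! q}) \<subseteq> fmod.span G" by (rule fmod.span_mono) auto
      ultimately have "P (G - {gs ! q})" using G(1) by (auto simp: P_def)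
      from G(2)[OF this] have "card G \<le> card (G - {gs ! q})" .
      moreover have "card (G - {gs ! q}) < card G"
        using G(1) gsq(2)[OF q] by (intro psubset_card_mono) (auto simp: P_def)
      ultimately show False by simp
    qed
  qed
qed

section \<open>Existence of minimal graded free resolutions\<close>

definition diff_map :: "(nat \<Rightarrow> int list) \<Rightarrow> (nat \<Rightarrow> nat \<Rightarrow> nat \<Rightarrow> 'a::comm_ring_1) \<Rightarrow> nat \<Rightarrow> (nat \<Rightarrow> 'a) \<Rightarrow> nat \<Rightarrow> 'a" where
  "diff_map B D i = mat_vec (length (B i)) (length (B (Suc i))) (D i)"

text \<open>A sequence of graded free modules that is exact everywhere except possibly at the last module
  \<open>F 0\<close>; no augmentation is fixed.\<close>

definition graded_exact :: "(nat \<Rightarrow> int list) \<Rightarrow> (nat \<Rightarrow> nat \<Rightarrow> nat \<Rightarrow> ('v::finite, 'k::comm_ring_1) mpoly) \<Rightarrow> bool" where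
  "graded_exact B D \<longleftrightarrow> (\<forall>i. gmat (B i) (B (Suc i)) (D i)) \<and>
     (\<forall>i. \<forall>x\<in>fvec (length (B (Suc i))).
        diff_map B D i x = 0 \<longleftrightarrow> (\<exists>w\<in>fvec (length (B (Suc (Suc i)))). x = diff_map B D (Suc i) w))"

definition minimal_complex :: "(nat \<Rightarrow> int list) \<Rightarrow> (nat \<Rightarrow> nat \<Rightarrow> nat \<Rightarrow> ('v, 'k::zero) mpoly) \<Rightarrow> bool" where
  "minimal_complex B D \<longleftrightarrow>
     (\<forall>i. \<forall>p<length (B i). \<forall>q<length (B (Suc i)). lookup (D i p q) 0 = 0)"

text \<open>The row \<open>e\<close> maps \<open>F 0\<close> onto \<open>A/J\<close> with kernel the image of \<open>F 1\<close>.\<close>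

definition augments ::
  "('v::finite, 'k::comm_ring_1) mpoly set \<Rightarrow> (nat \<Rightarrow> int list) \<Rightarrow> (nat \<Rightarrow> ('v, 'k) mpoly) \<Rightarrow> (nat \<Rightarrow> nat \<Rightarrow> nat \<Rightarrow> ('v, 'k) mpoly) \<Rightarrow> bool" where
  "augments J B e D \<longleftrightarrow> (\<forall>q<length (B 0). e q \<in> forms (B 0 ! q)) \<and>
     (\<forall>g. \<exists>x\<in>fvec (length (B 0)). g - (\<Sum>q<length (B 0). e q * x q) \<in> J) \<and>
     (\<forall>x\<in>fvec (length (B 0)). (\<Sum>q<length (B 0). e q * x q) \<in> J \<longleftrightarrow>
        (\<exists>w\<in>fvec (length (B 1)). x = diff_map B D 0 w))"

lemma graded_submodule_ker:
  assumes "gmat B C M"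
  shows "graded_submodule C {w \<in> fvec (length C). mat_vec (length B) (length C) M w = 0}"
  unfolding graded_submodule_def
proof (intro conjI ballI allI)
  show "fmod.subspace {w \<in> fvec (length C). mat_vec (length B) (length C) M w = 0}"
    by (rule fmod.subspaceI) (auto simp: fvec_closed mat_vec_add mat_vec_smul fun_eq_iff)
  fix x k assume "x \<in> {w \<in> fvec (length C). mat_vec (length B) (length C) M w = 0}"
  then have x: "mat_vec (length B) (length C) M x = 0" by simp
  have "gcomp C k x \<in> fvec (length C)" using gcomp_in_gvec[of C k x] by (simp add: gvec_def)
  moreover have "mat_vec (length B) (length C) M (gcomp C k x) = 0"
    using gcomp_mat_vec[OF assms, of k x] x by simp
  ultimately show "gcomp C k x \<in> {w \<in> fvec (length C). mat_vec (length B) (length C) M w = 0}" by simp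
qed auto

lemma graded_submodule_ideal:
  assumes "homogeneous J"
  shows "graded_submodule [0] {x \<in> fvec 1. x 0 \<in> J}"
  unfolding graded_submodule_def
proof (intro conjI ballI allI)
  show "fmod.subspace {x \<in> fvec 1. x 0 \<in> J}"
    using homogeneousD(1)[OF assms] by (intro fmod.subspaceI) (auto simp: fvec_closed is_idealD)
  fix x k assume "x \<in> {x \<in> fvec 1. x 0 \<in> J}"
  then show "gcomp [0] k x \<in> {x \<in> fvec 1. x 0 \<in> J}"
    using homogeneousD(2)[OF assms] by (auto simp: gcomp_def fvec_def)
qed auto

text \<open>A nonzero constant term would be itself an element of the ideal, and a unit.\<close>

lemma proper_homogeneous_lookup_0:
  fixes J :: "('v::finite, 'k::field) mpoly set"
  assumes J: "homogeneous J" "1 \<notin> J" and x: "x \<in> J"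
  shows "lookup x 0 = 0"
proof (rule ccontr)
  assume c: "lookup x 0 \<noteq> 0"
  have "hcomp 0 x \<in> J" using homogeneousD(2)[OF J(1) x] .
  then have "Poly_Mapping.single 0 (inverse (lookup x 0)) * hcomp 0 x \<in> J"
    using homogeneousD(1)[OF J(1)] by (simp add: is_idealD)
  then show False using c J(2) by (simp add: hcomp_zero_degree mult_single)
qed

text \<open>Iterating the choice of minimal generators: the syzygies of minimal generators have their entries in
  the irrelevant ideal, so the next map is minimal again.\<close>

lemma exists_minimal_complex:
  fixes J :: "('v::{finite,linorder}, 'k::field) mpoly set"
  assumes J: "homogeneous J" "1 \<notin> J"
  obtains B D where "B 0 = [0]" "graded_exact B D" "minimal_complex B D"
    "{x \<in> fvec 1. x 0 \<in> J} = diff_map B D 0 ` fvec (length (B 1))"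
proof -
  define P where "P i s \<longleftrightarrow> (i = 0 \<longrightarrow> s = ([0], {x \<in> fvec 1. x 0 \<in> J})) \<and>
      graded_submodule (fst s) (snd s) \<and> (\<forall>x\<in>snd s. \<forall>q. lookup (x q) 0 = 0)"
    for i :: nat and s :: "int list \<times> (nat \<Rightarrow> ('v, 'k) mpoly) set"
  define im where "im B C M = mat_vec (length B) (length C) M ` fvec (length C)"
    for B C :: "int list" and M :: "nat \<Rightarrow> nat \<Rightarrow> ('v, 'k) mpoly"
  define Q where "Q s s' \<longleftrightarrow> (\<exists>M. gmat (fst s) (fst s') M \<and> snd s = im (fst s) (fst s') M \<and>
      snd s' = {w \<in> fvec (length (fst s')). mat_vec (length (fst s)) (length (fst s')) M w = 0})"
    for s s' :: "int list \<times> (nat \<Rightarrow> ('v, 'k) mpoly) set"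
  have "\<exists>s. \<forall>i. P i (s i) \<and> Q (s i) (s (Suc i))"
  proof (rule dependent_nat_choice[where Q = "\<lambda>i. Q"])
    have "lookup (x q) 0 = 0" if "x \<in> fvec 1" "x 0 \<in> J" for x q
      using that proper_homogeneous_lookup_0[OF J] by (cases "q = 0") (auto simp: fvec_def)
    then have "P 0 ([0], {x \<in> fvec 1. x 0 \<in> J})"
      using graded_submodule_ideal[OF J(1)] by (simp add: P_def)
    then show "\<exists>s. P 0 s" ..
  next
    fix s i assume "P i s"
    then have S: "graded_submodule (fst s) (snd s)" by (simp add: P_def)
    obtain C M where CM: "gmat (fst s) C M" "snd s = im (fst s) C M"
      "\<And>w q. w \<in> fvec (length C) \<Longrightarrow> mat_vec (length (fst s)) (length C) M w = 0 \<Longrightarrow> lookup (w q) 0 = 0"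
      using minimal_generators[OF S] unfolding im_def by blast
    define s' where "s' = (C, {w \<in> fvec (length C). mat_vec (length (fst s)) (length C) M w = 0})"
    have "P (Suc i) s'" using graded_submodule_ker[OF CM(1)] CM(3) by (simp add: P_def s'_def)
    moreover have "Q s s'" unfolding Q_def s'_def using CM(1,2) by (intro exI[of _ M]) simp
    ultimately show "\<exists>s'. P (Suc i) s' \<and> Q s s'" by blast
  qed
  then obtain s where s: "\<And>i. P i (s i)" "\<And>i. Q (s i) (s (Suc i))" by blast
  define B where "B i = fst (s i)" for i
  have "\<forall>i. \<exists>M. gmat (B i) (B (Suc i)) M \<and> snd (s i) = im (B i) (B (Suc i)) M \<and>
      snd (s (Suc i)) = {w \<in> fvec (length (B (Suc i))). mat_vec (length (B i)) (length (B (Suc i))) M w = 0}"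
    using s(2) by (simp add: Q_def B_def)
  from choice[OF this] obtain D where "\<forall>i. gmat (B i) (B (Suc i)) (D i) \<and> snd (s i) = im (B i) (B (Suc i)) (D i) \<and>
      snd (s (Suc i)) = {w \<in> fvec (length (B (Suc i))). mat_vec (length (B i)) (length (B (Suc i))) (D i) w = 0}" ..
  then have "gmat (B i) (B (Suc i)) (D i) \<and> snd (s i) = im (B i) (B (Suc i)) (D i) \<and>
      snd (s (Suc i)) = {w \<in> fvec (length (B (Suc i))). mat_vec (length (B i)) (length (B (Suc i))) (D i) w = 0}" for i
    by (rule spec)
  then have D: "gmat (B i) (B (Suc i)) (D i)" "snd (s i) = diff_map B D i ` fvec (length (B (Suc i)))"
      "snd (s (Suc i)) = {w \<in> fvec (length (B (Suc i))). diff_map B D i w = 0}" for i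
    unfolding diff_map_def im_def by blast+
  have s0: "s 0 = ([0], {x \<in> fvec 1. x 0 \<in> J})" using s(1)[of 0] by (simp add: P_def)
  show thesis
  proof (rule that)
    show "B 0 = [0]" by (simp add: B_def s0)
    show "graded_exact B D" unfolding graded_exact_def
    proof (intro conjI allI ballI)
      fix i and x :: "nat \<Rightarrow> ('v, 'k) mpoly" assume "x \<in> fvec (length (B (Suc i)))"
      then have "diff_map B D i x = 0 \<longleftrightarrow> x \<in> snd (s (Suc i))" using D(3) by simp
      also have "\<dots> \<longleftrightarrow> x \<in> diff_map B D (Suc i) ` fvec (length (B (Suc (Suc i))))" using D(2)[of "Suc i"] by simp
      finally show "diff_map B D i x = 0 \<longleftrightarrow> (\<exists>w\<in>fvec (length (B (Suc (Suc i)))). x = diff_map B D (Suc i) w)"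
        by auto
    qed (rule D(1))
    show "{x \<in> fvec 1. x 0 \<in> J} = diff_map B D 0 ` fvec (length (B 1))" using D(2)[of 0] by (simp add: s0)
    show "minimal_complex B D" unfolding minimal_complex_def
    proof (intro allI impI)
      fix i p q assume pq: "p < length (B i)" "q < length (B (Suc i))"
      define w where "w = (\<lambda>j. if j = q then 1 else 0 :: ('v, 'k) mpoly)"
      have "w \<in> fvec (length (B (Suc i)))" using pq by (simp add: w_def fvec_def)
      then have "diff_map B D i w \<in> snd (s i)" using D(2) by simp
      then have "lookup (diff_map B D i w p) 0 = 0" using s(1)[of i] by (auto simp: P_def)
      moreover have "diff_map B D i w p = D i p q"
        using pq by (simp add: diff_map_def mat_vec_def w_def if_distrib cong: if_cong)
      ultimately show "lookup (D i p q) 0 = 0" by simp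
    qed
  qed
qed

lemma exists_minimal_resolution:
  fixes J :: "('v::{finite,linorder}, 'k::field) mpoly set"
  assumes J: "homogeneous J"
  shows "\<exists>B e D. graded_exact B D \<and> minimal_complex B D \<and> augments J B e D"
proof (cases "1 \<in> J")
  case True
  then have "x \<in> J" for x using homogeneousD(1)[OF J] is_idealD(3)[of J 1 x] by simp
  then have "graded_exact (\<lambda>_. []) (\<lambda>_ _ _. 0) \<and> minimal_complex (\<lambda>_. []) (\<lambda>_ _ _. 0) \<and>
      augments J (\<lambda>_. []) (\<lambda>_. 0) (\<lambda>_ _ _. 0)"
    by (auto simp: graded_exact_def minimal_complex_def augments_def gmat_def fvec_def diff_map_def
        mat_vec_def fun_eq_iff)
  then show ?thesis by blast
next
  case False
  from exists_minimal_complex[OF J False] obtain B and D :: "nat \<Rightarrow> nat \<Rightarrow> nat \<Rightarrow> ('v, 'k) mpoly"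
    where BD: "B 0 = [0]" "graded_exact B D" "minimal_complex B D"
    "{x \<in> fvec 1. x 0 \<in> J} = diff_map B D 0 ` fvec (length (B 1))" .
  have "augments J B (\<lambda>_. 1) D" unfolding augments_def
  proof (intro conjI allI ballI impI)
    show "1 \<in> forms (B 0 ! q)" if "q < length (B 0)" for q
      using that BD(1) by (simp add: forms_one)
    show "\<exists>x\<in>fvec (length (B 0)). g - (\<Sum>q<length (B 0). 1 * x q) \<in> J" for g
      using is_idealD(1)[OF homogeneousD(1)[OF J]]
      by (intro bexI[of _ "\<lambda>q. if q = 0 then g else 0"]) (auto simp: BD(1) fvec_def)
    fix x :: "nat \<Rightarrow> ('v, 'k) mpoly" assume x: "x \<in> fvec (length (B 0))"
    then have "(\<Sum>q<length (B 0). 1 * x q) \<in> J \<longleftrightarrow> x \<in> {x \<in> fvec 1. x 0 \<in> J}" by (simp add: BD(1))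
    then show "(\<Sum>q<length (B 0). 1 * x q) \<in> J \<longleftrightarrow> (\<exists>w\<in>fvec (length (B 1)). x = diff_map B D 0 w)"
      unfolding BD(4) by auto
  qed
  with BD(2,3) show ?thesis by blast
qed

text \<open>Extension by zero.  On \<open>fvec r\<close> it is inverse to \<open>vec r\<close>, which turns statements about vectors and matrices
  into statements about functions.\<close>

definition vec_fun :: "'a::zero vec \<Rightarrow> nat \<Rightarrow> 'a" where
  "vec_fun v = (\<lambda>q. if q < dim_vec v then v $ q else 0)"

lemma vec_fun_vec: "x \<in> fvec r \<Longrightarrow> vec_fun (vec r x) = x"
  by (auto simp: vec_fun_def fvec_def fun_eq_iff)

lemma ball_carrier_vec: "(\<forall>v\<in>carrier_vec r. P v) \<longleftrightarrow> (\<forall>x\<in>fvec r. P (vec r x))"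
  for P :: "'b::zero vec \<Rightarrow> bool"
proof safe
  fix v :: "'b vec" assume "\<forall>x\<in>fvec r. P (vec r x)" "v \<in> carrier_vec r"
  moreover have "vec r (vec_fun v) = v" "vec_fun v \<in> fvec r" if "v \<in> carrier_vec r"
    using that by (auto simp: vec_fun_def fvec_def)
  ultimately show "P v" by metis
qed simp

lemma bex_carrier_vec: "(\<exists>v\<in>carrier_vec r. P v) \<longleftrightarrow> (\<exists>x\<in>fvec r. P (vec r x))"
  for P :: "'b::zero vec \<Rightarrow> bool"
  using ball_carrier_vec[of r "\<lambda>v. \<not> P v"] by blast

lemma vec_eq_iff_fvec: "x \<in> fvec r \<Longrightarrow> y \<in> fvec r \<Longrightarrow> vec r x = vec r y \<longleftrightarrow> x = y"
  by (metis vec_fun_vec)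

lemma mult_mat_vec_eq:
  assumes "M \<in> carrier_mat r s"
  shows "M *\<^sub>v vec s x = vec r (mat_vec r s (\<lambda>p q. M $$ (p, q)) x)"
  using assms by (intro eq_vecI) (auto simp: scalar_prod_def mat_vec_def lessThan_atLeast0)

lemma zero_vec_eq: "0\<^sub>v r = vec r 0"
  by (intro eq_vecI) auto

lemma scalar_prod_vec:
  assumes "e \<in> carrier_vec r"
  shows "e \<bullet> vec r x = (\<Sum>q<r. e $ q * x q)"
  using assms by (simp add: scalar_prod_def lessThan_atLeast0)

lemma minimal_graded_free_resolution_iff:
  "minimal_graded_free_resolution J B e D \<longleftrightarrow>
     e \<in> carrier_vec (length (B 0)) \<and> (\<forall>i. D i \<in> carrier_mat (length (B i)) (length (B (Suc i)))) \<and>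
     graded_exact B (\<lambda>i p q. D i $$ (p, q)) \<and> minimal_complex B (\<lambda>i p q. D i $$ (p, q)) \<and>
     augments J B (\<lambda>q. e $ q) (\<lambda>i p q. D i $$ (p, q))"
proof (cases "e \<in> carrier_vec (length (B 0)) \<and> (\<forall>i. D i \<in> carrier_mat (length (B i)) (length (B (Suc i))))")
  case True
  then have e: "e \<in> carrier_vec (length (B 0))" and D: "D i \<in> carrier_mat (length (B i)) (length (B (Suc i)))" for i
    by auto
  have mat_vec: "D i *\<^sub>v vec (length (B (Suc i))) x
      = vec (length (B i)) (diff_map B (\<lambda>i p q. D i $$ (p, q)) i x)" for i x
    using mult_mat_vec_eq[OF D] by (simp add: diff_map_def)
  have df: "diff_map B (\<lambda>i p q. D i $$ (p, q)) i x \<in> fvec (length (B i))" for i x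
    by (simp add: diff_map_def)
  show ?thesis
    unfolding minimal_graded_free_resolution_def Let_def ball_carrier_vec bex_carrier_vec
      graded_exact_def minimal_complex_def augments_def gmat_def irrelevant_ideal_def
    using e D by (auto simp: mat_vec df scalar_prod_vec[OF e] vec_eq_iff_fvec zero_vec_eq fvec_closed)
next
  case False
  then show ?thesis by (auto simp: minimal_graded_free_resolution_def Let_def)
qed

section \<open>Double complexes\<close>

text \<open>The tensor product of two exact sequences of free modules in a fixed degree: all rows and all columns
  are exact away from the edge.  The last assumption expresses the minimality of the first sequence,
  if the second one resolves the residue field: the image of \<open>dF\<close> in \<open>F a\<close> lies in
  the product of the irrelevant ideal with \<open>F a\<close>, which is the image of \<open>dE 0\<close>.\<close>

locale double_complex =
  fixes G :: "nat \<Rightarrow> nat \<Rightarrow> 'g::ab_group_add set" and dF dE :: "nat \<Rightarrow> 'g \<Rightarrow> 'g"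
  assumes G_diff: "x \<in> G a b \<Longrightarrow> y \<in> G a b \<Longrightarrow> x - y \<in> G a b"
    and dF_closed: "x \<in> G (Suc a) b \<Longrightarrow> dF a x \<in> G a b"
    and dE_closed: "x \<in> G a (Suc b) \<Longrightarrow> dE b x \<in> G a b"
    and dF_diff: "dF a (x - y) = dF a x - dF a y"
    and dE_diff: "dE b (x - y) = dE b x - dE b y"
    and comm: "x \<in> G (Suc a) (Suc b) \<Longrightarrow> dF a (dE b x) = dE b (dF a x)"
    and exF: "x \<in> G (Suc a) b \<Longrightarrow> dF a x = 0 \<longleftrightarrow> (\<exists>w\<in>G (Suc (Suc a)) b. x = dF (Suc a) w)"
    and exE: "x \<in> G a (Suc b) \<Longrightarrow> dE b x = 0 \<longleftrightarrow> (\<exists>w\<in>G a (Suc (Suc b)). x = dE (Suc b) w)"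
    and dF_minimal: "y \<in> G (Suc a) 0 \<Longrightarrow> \<exists>z\<in>G a (Suc 0). dF a y = dE 0 z"
begin

text \<open>The homology at place \<open>b\<close> of the sequence \<open>E\<close> tensored with the cokernel of
  \<open>dF a\<close> is zero; for \<open>b = 0\<close> every element counts as a cycle.\<close>

definition vanishes :: "nat \<Rightarrow> nat \<Rightarrow> bool" where
  "vanishes a b \<longleftrightarrow> (\<forall>x\<in>G a b. (b = 0 \<or> (\<exists>y\<in>G (Suc a) (b - 1). dE (b - 1) x = dF a y)) \<longrightarrow>
     (\<exists>z\<in>G a (Suc b). \<exists>w\<in>G (Suc a) b. x = dE b z + dF a w))"

lemma dF_add: "dF a (x + y) = dF a x + dF a y"
proof -
  have "dF a 0 = 0" using dF_diff[of a 0 0] by simp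
  then have "dF a (- y) = - dF a y" using dF_diff[of a 0 y] by simp
  then show ?thesis using dF_diff[of a x "- y"] by simp
qed

lemma dE_add: "dE a (x + y) = dE a x + dE a y"
proof -
  have "dE a 0 = 0" using dE_diff[of a 0 0] by simp
  then have "dE a (- y) = - dE a y" using dE_diff[of a 0 y] by simp
  then show ?thesis using dE_diff[of a x "- y"] by simp
qed

lemma vanishesD:
  assumes "vanishes a b" "x \<in> G a b" "b = 0 \<or> (\<exists>y\<in>G (Suc a) (b - 1). dE (b - 1) x = dF a y)"
  obtains z w where "z \<in> G a (Suc b)" "w \<in> G (Suc a) b" "x = dE b z + dF a w"
  using assms unfolding vanishes_def by meson

text \<open>Dimension shifting along a syzygy module, by a diagram chase.\<close>

lemma vanishes_shift: "vanishes a (Suc b) \<longleftrightarrow> vanishes (Suc a) b"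
proof
  assume V: "vanishes a (Suc b)"
  show "vanishes (Suc a) b" unfolding vanishes_def
  proof (intro ballI impI)
    fix y assume y: "y \<in> G (Suc a) b"
      and c: "b = 0 \<or> (\<exists>y'\<in>G (Suc (Suc a)) (b - 1). dE (b - 1) y = dF (Suc a) y')"
    have "\<exists>z\<in>G a (Suc b). dF a y = dE b z"
    proof (cases b)
      case 0
      with dF_minimal y show ?thesis by simp
    next
      case (Suc c)
      with c obtain y' where y': "y' \<in> G (Suc (Suc a)) c" "dE c y = dF (Suc a) y'" by auto
      have "dE c (dF a y) = dF a (dE c y)" using comm y Suc by simp
      also have "\<dots> = 0" using exF[OF dE_closed, of y a c] y Suc y' by auto
      finally show ?thesis using exE[OF dF_closed, of y a c] y Suc by simp
    qed
    then obtain z where z: "z \<in> G a (Suc b)" "dF a y = dE b z" by blast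
    have "\<exists>y\<in>G (Suc a) b. dE b z = dF a y" using y z(2) by (intro bexI[of _ y]) simp_all
    then obtain z' w where zw: "z' \<in> G a (Suc (Suc b))" "w \<in> G (Suc a) (Suc b)" "z = dE (Suc b) z' + dF a w"
      using vanishesD[OF V z(1)] by auto
    have "dE b (dE (Suc b) z') = 0" using exE[OF dE_closed[OF zw(1)]] zw(1) by auto
    then have "dF a (y - dE b w) = 0"
      using z(2) comm[OF zw(2)] zw(3) by (simp add: dF_diff dE_add)
    moreover have "y - dE b w \<in> G (Suc a) b" using y zw(2) by (intro G_diff dE_closed)
    ultimately obtain u where "u \<in> G (Suc (Suc a)) b" "y - dE b w = dF (Suc a) u" using exF by blast
    then show "\<exists>z\<in>G (Suc a) (Suc b). \<exists>w\<in>G (Suc (Suc a)) b. y = dE b z + dF (Suc a) w"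
      using zw(2) by (intro bexI[of _ w] bexI[of _ u]) (auto simp: algebra_simps)
  qed
next
  assume V: "vanishes (Suc a) b"
  show "vanishes a (Suc b)" unfolding vanishes_def
  proof (intro ballI impI)
    fix x assume x: "x \<in> G a (Suc b)"
      and c: "Suc b = 0 \<or> (\<exists>y\<in>G (Suc a) (Suc b - 1). dE (Suc b - 1) x = dF a y)"
    from c obtain y where y: "y \<in> G (Suc a) b" "dE b x = dF a y" by auto
    have "b = 0 \<or> (\<exists>y'\<in>G (Suc (Suc a)) (b - 1). dE (b - 1) y = dF (Suc a) y')"
    proof (cases b)
      case (Suc c)
      have "dE c (dE b x) = 0" using exE[OF dE_closed, of x a c] x Suc by auto
      then have "dF a (dE c y) = 0" using comm[of y a c] y Suc by simp
      then show ?thesis using exF[OF dE_closed, of y a c] y(1) Suc by simp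
    qed simp
    then obtain z w where zw: "z \<in> G (Suc a) (Suc b)" "w \<in> G (Suc (Suc a)) b" "y = dE b z + dF (Suc a) w"
      using vanishesD[OF V y(1)] by blast
    have "dF a (dF (Suc a) w) = 0" using exF[OF dF_closed[OF zw(2)]] zw(2) by auto
    then have "dE b (x - dF a z) = 0"
      using y(2) comm[OF zw(1)] zw(3) by (simp add: dE_diff dF_add)
    moreover have "x - dF a z \<in> G a (Suc b)" using x zw(1) by (intro G_diff dF_closed)
    ultimately obtain u where "u \<in> G a (Suc (Suc b))" "x - dF a z = dE (Suc b) u" using exE by blast
    then show "\<exists>z\<in>G a (Suc (Suc b)). \<exists>w\<in>G (Suc a) (Suc b). x = dE (Suc b) z + dF a w"
      using zw(1) by (intro bexI[of _ z] bexI[of _ u]) (auto simp: algebra_simps)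
  qed
qed

lemma vanishes_diagonal: "vanishes a b \<longleftrightarrow> vanishes (a + b) 0"
  by (induction b arbitrary: a) (simp_all add: vanishes_shift)

end

section \<open>Betti numbers as Tor\<close>

lemma homogeneous_irrelevant: "homogeneous (irrelevant_ideal :: ('v::finite, 'k::field) mpoly set)"
  by (auto simp: homogeneous_def is_ideal_def irrelevant_ideal_def lookup_add lookup_mult_0 lookup_hcomp)

text \<open>A graded free resolution of \<open>K\<close>, the residue field of the irrelevant ideal.  The sequence that the
  existence theorem provides serves instead of a Koszul complex.\<close>

definition resolves_field :: "(nat \<Rightarrow> int list) \<Rightarrow> (nat \<Rightarrow> nat \<Rightarrow> nat \<Rightarrow> ('v::finite, 'k::field) mpoly) \<Rightarrow> bool" where
  "resolves_field C T \<longleftrightarrow> C 0 = [0] \<and> graded_exact C T \<and>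
     {x \<in> fvec 1. x 0 \<in> irrelevant_ideal} = diff_map C T 0 ` fvec (length (C 1))"

lemma resolves_field_exists: "\<exists>C T. resolves_field C (T :: nat \<Rightarrow> nat \<Rightarrow> nat \<Rightarrow> ('v::{finite,linorder}, 'k::field) mpoly)"
proof -
  have "(1 :: ('v, 'k) mpoly) \<notin> irrelevant_ideal" by (simp add: irrelevant_ideal_def)
  from exists_minimal_complex[OF homogeneous_irrelevant this] obtain C
    and T :: "nat \<Rightarrow> nat \<Rightarrow> nat \<Rightarrow> ('v, 'k) mpoly"
    where "C 0 = [0]" "graded_exact C T"
    "{x \<in> fvec 1. x 0 \<in> irrelevant_ideal} = diff_map C T 0 ` fvec (length (C 1))" .
  then show ?thesis unfolding resolves_field_def by blast
qed

lemma diff_map_diff: "diff_map B D i (x - y) = diff_map B D i x - diff_map B D i y"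
  by (simp add: diff_map_def mat_vec_diff)

lemma diff_map_add: "diff_map B D i (x + y) = diff_map B D i x + diff_map B D i y"
  by (simp add: diff_map_def mat_vec_add)

lemma diff_map_0: "diff_map B D i 0 = 0"
  by (simp add: diff_map_def)

lemma diff_map_smul: "diff_map B D i (smul a x) = smul a (diff_map B D i x)"
  by (simp add: diff_map_def mat_vec_smul)

lemma diff_map_in_ideal: "is_ideal J \<Longrightarrow> (\<And>q. x q \<in> J) \<Longrightarrow> diff_map B D i x p \<in> J"
  by (simp add: diff_map_def mat_vec_in_ideal)

lemma diff_map_in_gvec: "graded_exact B D \<Longrightarrow> w \<in> gvec (B (Suc i)) k \<Longrightarrow> diff_map B D i w \<in> gvec (B i) k"
  by (simp add: diff_map_def graded_exact_def mat_vec_in_gvec)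

lemma diff_map_graded_preimage:
  assumes "graded_exact B D" "diff_map B D i w \<in> gvec (B i) k"
  shows "diff_map B D i (gcomp (B (Suc i)) k w) = diff_map B D i w"
  using gcomp_mat_vec[of "B i" "B (Suc i)" "D i" k w] gcomp_id[OF assms(2)] assms(1)
  by (simp add: graded_exact_def diff_map_def)

lemma graded_exact_gvec:
  assumes "graded_exact B D" "x \<in> gvec (B (Suc i)) k"
  shows "diff_map B D i x = 0 \<longleftrightarrow> (\<exists>w\<in>gvec (B (Suc (Suc i))) k. x = diff_map B D (Suc i) w)"
proof -
  have x: "x \<in> fvec (length (B (Suc i)))" using assms(2) by (simp add: gvec_def)
  have *: "diff_map B D i x = 0 \<longleftrightarrow> (\<exists>w\<in>fvec (length (B (Suc (Suc i)))). x = diff_map B D (Suc i) w)"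
    using assms(1) x by (simp add: graded_exact_def)
  show ?thesis unfolding *
  proof
    assume "\<exists>w\<in>fvec (length (B (Suc (Suc i)))). x = diff_map B D (Suc i) w"
    then obtain w where w: "x = diff_map B D (Suc i) w" by blast
    have "diff_map B D (Suc i) (gcomp (B (Suc (Suc i))) k w) = x"
      using diff_map_graded_preimage[OF assms(1), of "Suc i" w k] assms(2) by (simp add: w)
    then show "\<exists>w\<in>gvec (B (Suc (Suc i))) k. x = diff_map B D (Suc i) w"
      by (intro bexI[of _ "gcomp (B (Suc (Suc i))) k w"]) simp_all
  qed (auto simp: gvec_def)
qed

lemma resolves_field_image_0:
  assumes "resolves_field C T" "x \<in> gvec (C 0) k"
  shows "(\<exists>z\<in>gvec (C 1) k. x = diff_map C T 0 z) \<longleftrightarrow> lookup (x 0) 0 = 0"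
proof -
  have C0: "C 0 = [0]" and ex: "graded_exact C T"
    and im: "{x \<in> fvec 1. x 0 \<in> irrelevant_ideal} = diff_map C T 0 ` fvec (length (C 1))"
    using assms(1) by (auto simp: resolves_field_def)
  have "x \<in> fvec 1" using assms(2) by (simp add: gvec_def C0)
  then have "lookup (x 0) 0 = 0 \<longleftrightarrow> x \<in> {x \<in> fvec 1. x 0 \<in> irrelevant_ideal}"
    by (simp add: irrelevant_ideal_def)
  also have "\<dots> \<longleftrightarrow> (\<exists>z\<in>gvec (C 1) k. x = diff_map C T 0 z)" unfolding im
  proof
    assume "x \<in> diff_map C T 0 ` fvec (length (C 1))"
    then obtain w where w: "x = diff_map C T 0 w" by blast
    have "diff_map C T 0 (gcomp (C 1) k w) = x"
      using diff_map_graded_preimage[OF ex, of 0 w k] assms(2) by (simp add: w)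
    then show "\<exists>z\<in>gvec (C 1) k. x = diff_map C T 0 z"
      by (intro bexI[of _ "gcomp (C 1) k w"]) simp_all
  qed (auto simp: gvec_def)
  finally show ?thesis by simp
qed

text \<open>The degree-\<open>k\<close> component of \<open>Tor\<^sub>i(A/J, K)\<close> vanishes, computed from a resolution of \<open>K\<close>.  In this form
  all dependence on \<open>J\<close> is explicit, which makes the comparison of different ideals easy.\<close>

definition tor_zero ::
  "(nat \<Rightarrow> int list) \<Rightarrow> (nat \<Rightarrow> nat \<Rightarrow> nat \<Rightarrow> ('v::finite, 'k::comm_ring_1) mpoly) \<Rightarrow> ('v, 'k) mpoly set \<Rightarrow> nat \<Rightarrow> int \<Rightarrow> bool" where
  "tor_zero C T J i k \<longleftrightarrow> (\<forall>x\<in>gvec (C i) k. (i = 0 \<or> (\<forall>p. diff_map C T (i - 1) x p \<in> J)) \<longrightarrow>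
     (\<exists>z\<in>gvec (C (Suc i)) k. \<forall>p. x p - diff_map C T i z p \<in> J))"

text \<open>The double complex of a minimal resolution of \<open>A/J\<close> and a resolution of \<open>K\<close>, in degree \<open>k\<close>.  One side
  of it shows the generators of the first resolution, the other side shows \<open>tor_zero\<close>.\<close>

locale resolution_pair =
  fixes J :: "('v::{finite,linorder}, 'k::field) mpoly set"
    and B C :: "nat \<Rightarrow> int list" and e :: "nat \<Rightarrow> ('v, 'k) mpoly"
    and D T :: "nat \<Rightarrow> nat \<Rightarrow> nat \<Rightarrow> ('v, 'k) mpoly" and k :: int
  assumes J: "homogeneous J"
    and B: "graded_exact B D" "minimal_complex B D" "augments J B e D"
    and C: "resolves_field C T"
begin

text \<open>Elements of \<open>F a \<otimes> E b\<close> are matrices; the two differentials multiply from the two sides.\<close>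

definition tensor :: "nat \<Rightarrow> nat \<Rightarrow> (nat \<Rightarrow> nat \<Rightarrow> ('v, 'k) mpoly) set" where
  "tensor a b = {x. \<forall>p q. (p < length (B a) \<and> q < length (C b) \<longrightarrow> x p q \<in> forms (k - B a ! p - C b ! q)) \<and>
     (\<not> (p < length (B a) \<and> q < length (C b)) \<longrightarrow> x p q = 0)}"

definition left_diff :: "nat \<Rightarrow> (nat \<Rightarrow> nat \<Rightarrow> ('v, 'k) mpoly) \<Rightarrow> nat \<Rightarrow> nat \<Rightarrow> ('v, 'k) mpoly" where
  "left_diff a x = (\<lambda>p q. diff_map B D a (\<lambda>i. x i q) p)"

definition right_diff :: "nat \<Rightarrow> (nat \<Rightarrow> nat \<Rightarrow> ('v, 'k) mpoly) \<Rightarrow> nat \<Rightarrow> nat \<Rightarrow> ('v, 'k) mpoly" where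
  "right_diff b x = (\<lambda>p. diff_map C T b (x p))"

lemma C_exact: "graded_exact C T" and C_0: "C 0 = [0]"
  using C by (auto simp: resolves_field_def)

lemma tensor_row: "x \<in> tensor a b \<Longrightarrow> p < length (B a) \<Longrightarrow> x p \<in> gvec (C b) (k - B a ! p)"
  "x \<in> tensor a b \<Longrightarrow> \<not> p < length (B a) \<Longrightarrow> x p = 0"
  by (auto simp: tensor_def gvec_def fvec_def fun_eq_iff)

lemma tensor_col: "x \<in> tensor a b \<Longrightarrow> q < length (C b) \<Longrightarrow> (\<lambda>p. x p q) \<in> gvec (B a) (k - C b ! q)"
  "x \<in> tensor a b \<Longrightarrow> \<not> q < length (C b) \<Longrightarrow> (\<lambda>p. x p q) = 0"
  by (auto simp: tensor_def gvec_def fvec_def fun_eq_iff algebra_simps)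

lemma tensor_rowI:
  assumes "\<And>p. p < length (B a) \<Longrightarrow> x p \<in> gvec (C b) (k - B a ! p)" "\<And>p. \<not> p < length (B a) \<Longrightarrow> x p = 0"
  shows "x \<in> tensor a b"
  unfolding tensor_def
proof (intro CollectI allI conjI impI)
  fix p q assume "p < length (B a) \<and> q < length (C b)"
  then show "x p q \<in> forms (k - B a ! p - C b ! q)" using assms(1)[of p] by (simp add: gvec_def)
next
  fix p q assume "\<not> (p < length (B a) \<and> q < length (C b))"
  then show "x p q = 0" using assms(1)[of p] assms(2)[of p]
    by (cases "p < length (B a)") (auto simp: gvec_def fvec_def)
qed

lemma tensor_colI:
  assumes "\<And>q. q < length (C b) \<Longrightarrow> (\<lambda>p. x p q) \<in> gvec (B a) (k - C b ! q)" "\<And>q. \<not> q < length (C b) \<Longrightarrow> (\<lambda>p. x p q) = 0"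
  shows "x \<in> tensor a b"
  unfolding tensor_def
proof (intro CollectI allI conjI impI)
  fix p q assume "p < length (B a) \<and> q < length (C b)"
  then show "x p q \<in> forms (k - B a ! p - C b ! q)" using assms(1)[of q] by (simp add: gvec_def algebra_simps)
next
  fix p q assume "\<not> (p < length (B a) \<and> q < length (C b))"
  then show "x p q = 0" using assms(1)[of q] fun_cong[OF assms(2)[of q], of p]
    by (cases "q < length (C b)") (auto simp: gvec_def fvec_def)
qed

lemma left_diff_col: "(\<lambda>p. left_diff a x p q) = diff_map B D a (\<lambda>p. x p q)"
  by (simp add: left_diff_def)

lemma right_diff_row: "right_diff b x p = diff_map C T b (x p)"
  by (simp add: right_diff_def)

lemma eq_by_cols: "(\<And>q. (\<lambda>p. x p q) = (\<lambda>p. y p q)) \<Longrightarrow> x = y" for x y :: "nat \<Rightarrow> nat \<Rightarrow> 'c"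
  by (intro ext) metis

lemma left_diff_exact:
  assumes x: "x \<in> tensor (Suc a) b"
  shows "left_diff a x = 0 \<longleftrightarrow> (\<exists>w\<in>tensor (Suc (Suc a)) b. x = left_diff (Suc a) w)"
proof
  assume "left_diff a x = 0"
  then have z: "diff_map B D a (\<lambda>p. x p q) = 0" for q
    using left_diff_col[of a x q] by (simp add: fun_eq_iff)
  have "\<exists>v\<in>gvec (B (Suc (Suc a))) (k - C b ! q). (\<lambda>p. x p q) = diff_map B D (Suc a) v" if "q < length (C b)" for q
    using graded_exact_gvec[OF B(1) tensor_col(1)[OF x that]] z by simp
  then obtain v where v: "\<And>q. q < length (C b) \<Longrightarrow> v q \<in> gvec (B (Suc (Suc a))) (k - C b ! q)"
      "\<And>q. q < length (C b) \<Longrightarrow> (\<lambda>p. x p q) = diff_map B D (Suc a) (v q)" by metis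
  define w where "w p q = (if q < length (C b) then v q p else 0)" for p q
  have wc: "(\<lambda>p. w p q) = (if q < length (C b) then v q else 0)" for q by (auto simp: w_def fun_eq_iff)
  have "w \<in> tensor (Suc (Suc a)) b" by (rule tensor_colI) (auto simp: wc v)
  moreover have "x = left_diff (Suc a) w"
  proof (rule eq_by_cols)
    show "(\<lambda>p. x p q) = (\<lambda>p. left_diff (Suc a) w p q)" for q
      unfolding left_diff_col wc using v(2)[of q] tensor_col(2)[OF x, of q] by (simp add: diff_map_0)
  qed
  ultimately show "\<exists>w\<in>tensor (Suc (Suc a)) b. x = left_diff (Suc a) w" by blast
next
  assume "\<exists>w\<in>tensor (Suc (Suc a)) b. x = left_diff (Suc a) w"
  then obtain w where w: "w \<in> tensor (Suc (Suc a)) b" "x = left_diff (Suc a) w" by blast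
  show "left_diff a x = 0"
  proof (rule eq_by_cols)
    fix q
    have "diff_map B D a (\<lambda>p. x p q) = 0"
    proof (cases "q < length (C b)")
      case True
      have "(\<lambda>p. x p q) = diff_map B D (Suc a) (\<lambda>p. w p q)" by (simp add: w(2) left_diff_col)
      then show ?thesis using graded_exact_gvec[OF B(1) tensor_col(1)[OF x True]] tensor_col(1)[OF w(1) True] by blast
    qed (simp add: tensor_col(2)[OF x] diff_map_0)
    then show "(\<lambda>p. left_diff a x p q) = (\<lambda>p. 0 p q)" by (simp add: left_diff_col fun_eq_iff)
  qed
qed

lemma right_diff_exact:
  assumes x: "x \<in> tensor a (Suc b)"
  shows "right_diff b x = 0 \<longleftrightarrow> (\<exists>w\<in>tensor a (Suc (Suc b)). x = right_diff (Suc b) w)"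
proof
  assume "right_diff b x = 0"
  then have z: "diff_map C T b (x p) = 0" for p
    using right_diff_row[of b x p] by simp
  have "\<exists>v\<in>gvec (C (Suc (Suc b))) (k - B a ! p). x p = diff_map C T (Suc b) v" if "p < length (B a)" for p
    using graded_exact_gvec[OF C_exact tensor_row(1)[OF x that]] z by simp
  then obtain v where v: "\<And>p. p < length (B a) \<Longrightarrow> v p \<in> gvec (C (Suc (Suc b))) (k - B a ! p)"
      "\<And>p. p < length (B a) \<Longrightarrow> x p = diff_map C T (Suc b) (v p)" by metis
  define w where "w p = (if p < length (B a) then v p else 0)" for p
  have "w \<in> tensor a (Suc (Suc b))" by (rule tensor_rowI) (auto simp: w_def v)
  moreover have "x = right_diff (Suc b) w"
  proof
    show "x p = right_diff (Suc b) w p" for p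
      unfolding right_diff_row w_def using v(2)[of p] tensor_row(2)[OF x, of p] by (simp add: diff_map_0)
  qed
  ultimately show "\<exists>w\<in>tensor a (Suc (Suc b)). x = right_diff (Suc b) w" by blast
next
  assume "\<exists>w\<in>tensor a (Suc (Suc b)). x = right_diff (Suc b) w"
  then obtain w where w: "w \<in> tensor a (Suc (Suc b))" "x = right_diff (Suc b) w" by blast
  show "right_diff b x = 0"
  proof
    fix p
    have "diff_map C T b (x p) = 0"
    proof (cases "p < length (B a)")
      case True
      have "x p = diff_map C T (Suc b) (w p)" by (simp add: w(2) right_diff_row)
      then show ?thesis using graded_exact_gvec[OF C_exact tensor_row(1)[OF x True]] tensor_row(1)[OF w(1) True] by blast
    qed (simp add: tensor_row(2)[OF x] diff_map_0)
    then show "right_diff b x p = 0 p" by (simp add: right_diff_row)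
  qed
qed

lemma left_diff_closed: "x \<in> tensor (Suc a) b \<Longrightarrow> left_diff a x \<in> tensor a b"
proof (rule tensor_colI)
  fix q assume x: "x \<in> tensor (Suc a) b"
  show "(\<lambda>p. left_diff a x p q) \<in> gvec (B a) (k - C b ! q)" if "q < length (C b)"
    unfolding left_diff_col by (intro diff_map_in_gvec B(1) tensor_col(1)[OF x that])
  show "(\<lambda>p. left_diff a x p q) = 0" if "\<not> q < length (C b)"
    unfolding left_diff_col tensor_col(2)[OF x that] by (rule diff_map_0)
qed

lemma right_diff_closed: "x \<in> tensor a (Suc b) \<Longrightarrow> right_diff b x \<in> tensor a b"
proof (rule tensor_rowI)
  fix p assume x: "x \<in> tensor a (Suc b)"
  show "right_diff b x p \<in> gvec (C b) (k - B a ! p)" if "p < length (B a)"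
    unfolding right_diff_row by (intro diff_map_in_gvec C_exact tensor_row(1)[OF x that])
  show "right_diff b x p = 0" if "\<not> p < length (B a)"
    unfolding right_diff_row tensor_row(2)[OF x that] by (rule diff_map_0)
qed

lemma left_diff_diff: "left_diff a (x - y) = left_diff a x - left_diff a y"
proof (rule eq_by_cols)
  fix q
  have "(\<lambda>p. (x - y) p q) = (\<lambda>p. x p q) - (\<lambda>p. y p q)" by (simp add: fun_diff_def)
  then show "(\<lambda>p. left_diff a (x - y) p q) = (\<lambda>p. (left_diff a x - left_diff a y) p q)"
    unfolding left_diff_col by (simp only: diff_map_diff) (simp add: fun_diff_def left_diff_def)
qed

lemma right_diff_diff: "right_diff b (x - y) = right_diff b x - right_diff b y"
  by (intro ext) (simp add: right_diff_def diff_map_diff)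

lemma diffs_commute: "left_diff a (right_diff b x) = right_diff b (left_diff a x)"
proof (intro ext)
  fix p q
  have "(\<Sum>i<length (B (Suc a)). \<Sum>j<length (C (Suc b)). D a p i * (T b q j * x i j))
     = (\<Sum>j<length (C (Suc b)). \<Sum>i<length (B (Suc a)). T b q j * (D a p i * x i j))"
    by (subst sum.swap) (simp add: mult.left_commute)
  then show "left_diff a (right_diff b x) p q = right_diff b (left_diff a x) p q"
    by (simp add: left_diff_def right_diff_def diff_map_def mat_vec_def sum_distrib_left)
qed

lemma left_diff_minimal: "lookup (left_diff a y p q) 0 = 0"
  using B(2) by (simp add: left_diff_def diff_map_def mat_vec_def lookup_sum lookup_mult_0 minimal_complex_def)

lemma right_diff_image_0:
  assumes x: "x \<in> tensor a 0"
  shows "(\<exists>z\<in>tensor a (Suc 0). x = right_diff 0 z) \<longleftrightarrow> (\<forall>p. lookup (x p 0) 0 = 0)"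
proof
  assume "\<exists>z\<in>tensor a (Suc 0). x = right_diff 0 z"
  then obtain z where z: "z \<in> tensor a (Suc 0)" "x = right_diff 0 z" by blast
  show "\<forall>p. lookup (x p 0) 0 = 0"
  proof
    fix p show "lookup (x p 0) 0 = 0"
    proof (cases "p < length (B a)")
      case True
      have "x p = diff_map C T 0 (z p)" by (simp add: z(2) right_diff_row)
      then show ?thesis
        using resolves_field_image_0[OF C tensor_row(1)[OF x True]] tensor_row(1)[OF z(1) True] by auto
    qed (simp add: tensor_row(2)[OF x])
  qed
next
  assume l: "\<forall>p. lookup (x p 0) 0 = 0"
  have "\<exists>v\<in>gvec (C (Suc 0)) (k - B a ! p). x p = diff_map C T 0 v" if "p < length (B a)" for p
    using resolves_field_image_0[OF C tensor_row(1)[OF x that]] l by simp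
  then obtain v where v: "\<And>p. p < length (B a) \<Longrightarrow> v p \<in> gvec (C (Suc 0)) (k - B a ! p)"
      "\<And>p. p < length (B a) \<Longrightarrow> x p = diff_map C T 0 (v p)" by metis
  define w where "w p = (if p < length (B a) then v p else 0)" for p
  have "w \<in> tensor a (Suc 0)" by (rule tensor_rowI) (auto simp: w_def v)
  moreover have "x = right_diff 0 w"
  proof
    show "x p = right_diff 0 w p" for p
      unfolding right_diff_row w_def using v(2)[of p] tensor_row(2)[OF x, of p] by (simp add: diff_map_0)
  qed
  ultimately show "\<exists>z\<in>tensor a (Suc 0). x = right_diff 0 z" by blast
qed

sublocale double_complex tensor left_diff right_diff
proof
  show "x - y \<in> tensor a b" if "x \<in> tensor a b" "y \<in> tensor a b" for x y a b
    using that by (intro tensor_rowI) (auto simp: tensor_row gvec_closed)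
  show "\<exists>z\<in>tensor a (Suc 0). left_diff a y = right_diff 0 z" if "y \<in> tensor (Suc a) 0" for a y
    using right_diff_image_0[OF left_diff_closed[OF that]] left_diff_minimal by simp
qed (rule left_diff_closed right_diff_closed left_diff_diff right_diff_diff diffs_commute
  left_diff_exact right_diff_exact; assumption)+

text \<open>\<open>F i\<close> modulo the irrelevant ideal has a basis vector in degree \<open>k\<close> precisely if \<open>k\<close> is among its
  shifts, and minimality makes all differentials vanish there.\<close>

lemma vanishes_row_0: "vanishes i 0 \<longleftrightarrow> k \<notin> set (B i)"
proof
  assume V: "vanishes i 0"
  show "k \<notin> set (B i)"
  proof
    assume "k \<in> set (B i)"
    then obtain p where p: "p < length (B i)" "B i ! p = k" by (auto simp: in_set_conv_nth)
    define x where "x = (\<lambda>p' (q::nat). if p' = p \<and> q = 0 then 1 else 0 :: ('v, 'k) mpoly)"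
    have x: "x \<in> tensor i 0" using p by (auto simp: tensor_def x_def C_0 forms_one)
    obtain z w where zw: "z \<in> tensor i (Suc 0)" "w \<in> tensor (Suc i) 0" "x = right_diff 0 z + left_diff i w"
      using vanishesD[OF V x] by auto
    have "\<forall>p. lookup (right_diff 0 z p 0) 0 = 0"
      using right_diff_image_0[OF right_diff_closed[OF zw(1)]] zw(1) by blast
    then have "lookup (x p 0) 0 = 0" by (simp add: zw(3) lookup_add left_diff_minimal)
    then show False by (simp add: x_def)
  qed
next
  assume k: "k \<notin> set (B i)"
  show "vanishes i 0" unfolding vanishes_def
  proof (intro ballI impI)
    fix x assume x: "x \<in> tensor i 0"
    have "lookup (x p 0) 0 = 0" for p
    proof (cases "p < length (B i)")
      case True
      then have "x p 0 \<in> forms (k - B i ! p)" using x by (auto simp: tensor_def C_0)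
      moreover have "k - B i ! p \<noteq> 0" using k True nth_mem[OF True] by auto
      ultimately show ?thesis by (rule lookup_form_at_0)
    qed (simp add: tensor_row(2)[OF x])
    then obtain z where "z \<in> tensor i (Suc 0)" "x = right_diff 0 z" using right_diff_image_0[OF x] by blast
    moreover have "0 \<in> tensor (Suc i) 0" by (auto simp: tensor_def)
    moreover have "left_diff i 0 = 0" using left_diff_diff[of i 0 0] by simp
    ultimately show "\<exists>z\<in>tensor i (Suc 0). \<exists>w\<in>tensor (Suc i) 0. x = right_diff 0 z + left_diff i w"
      by (intro bexI[of _ z] bexI[of _ 0]) simp_all
  qed
qed

text \<open>The map from \<open>F 0 \<otimes> E b\<close> to \<open>A \<otimes> E b\<close> that is induced by the augmentation; the values matter
  modulo \<open>J\<close>.\<close>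

definition aug :: "(nat \<Rightarrow> nat \<Rightarrow> ('v, 'k) mpoly) \<Rightarrow> nat \<Rightarrow> ('v, 'k) mpoly" where
  "aug x = (\<lambda>q. \<Sum>p<length (B 0). e p * x p q)"

lemma aug_add: "aug (x + y) q = aug x q + aug y q" and aug_diff: "aug (x - y) q = aug x q - aug y q"
  by (simp_all add: aug_def sum.distrib sum_subtractf algebra_simps)

lemma aug_in_gvec:
  assumes "x \<in> tensor 0 b"
  shows "aug x \<in> gvec (C b) k"
  unfolding gvec_def fvec_def
proof (intro CollectI conjI allI impI)
  show "aug x q = 0" if "q \<ge> length (C b)" for q
    using assms that by (simp add: aug_def tensor_def)
  fix q assume q: "q < length (C b)"
  show "aug x q \<in> forms (k - C b ! q)" unfolding aug_def
  proof (rule forms_sum)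
    fix p assume p: "p \<in> {..<length (B 0)}"
    have "e p \<in> forms (B 0 ! p)" using B(3) p by (simp add: augments_def)
    moreover have "x p q \<in> forms (k - B 0 ! p - C b ! q)" using assms p q by (simp add: tensor_def)
    ultimately have "e p * x p q \<in> forms (B 0 ! p + (k - B 0 ! p - C b ! q))" by (rule forms_mult)
    then show "e p * x p q \<in> forms (k - C b ! q)" by simp
  qed
qed

lemma aug_surj:
  assumes x: "x \<in> gvec (C b) k"
  obtains y where "y \<in> tensor 0 b" "\<And>q. x q - aug y q \<in> J"
proof -
  have J0: "0 \<in> J" using is_idealD(1)[OF homogeneousD(1)[OF J]] .
  have "\<exists>v\<in>gvec (B 0) (k - C b ! q). x q - (\<Sum>p<length (B 0). e p * v p) \<in> J" if q: "q < length (C b)" for q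
  proof -
    from B(3) have "\<exists>v\<in>fvec (length (B 0)). x q - (\<Sum>p<length (B 0). e p * v p) \<in> J"
      by (simp add: augments_def)
    then obtain v where v: "x q - (\<Sum>p<length (B 0). e p * v p) \<in> J" by blast
    have "hcomp (k - C b ! q) (x q - (\<Sum>p<length (B 0). e p * v p))
        = x q - (\<Sum>p<length (B 0). e p * gcomp (B 0) (k - C b ! q) v p)"
    proof -
      have "hcomp (k - C b ! q) (e p * v p) = e p * gcomp (B 0) (k - C b ! q) v p"
        if "p < length (B 0)" for p
      proof -
        have "e p \<in> forms (B 0 ! p)" using B(3) that by (simp add: augments_def)
        then show ?thesis using that by (simp add: hcomp_mult_form gcomp_def)
      qed
      moreover have "hcomp (k - C b ! q) (x q) = x q"
        using x q by (intro hcomp_id) (simp add: gvec_def)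
      ultimately show ?thesis by (simp add: hcomp_diff hcomp_sum)
    qed
    with homogeneousD(2)[OF J v, of "k - C b ! q"] show ?thesis
      by (intro bexI[of _ "gcomp (B 0) (k - C b ! q) v"]) simp_all
  qed
  then obtain v where v: "\<And>q. q < length (C b) \<Longrightarrow> v q \<in> gvec (B 0) (k - C b ! q)"
      "\<And>q. q < length (C b) \<Longrightarrow> x q - (\<Sum>p<length (B 0). e p * v q p) \<in> J" by metis
  define y where "y p q = (if q < length (C b) then v q p else 0)" for p q
  have yc: "(\<lambda>p. y p q) = (if q < length (C b) then v q else 0)" for q by (auto simp: y_def fun_eq_iff)
  show thesis
  proof (rule that)
    show "y \<in> tensor 0 b" by (rule tensor_colI) (auto simp: yc v)
    fix q show "x q - aug y q \<in> J"
    proof (cases "q < length (C b)")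
      case True
      then show ?thesis using v(2)[OF True] by (simp add: aug_def y_def)
    next
      case False
      then show ?thesis using J0 x by (simp add: aug_def y_def gvec_def fvec_def)
    qed
  qed
qed

lemma aug_in_ideal_iff:
  assumes x: "x \<in> tensor 0 b"
  shows "(\<forall>q. aug x q \<in> J) \<longleftrightarrow> (\<exists>w\<in>tensor (Suc 0) b. x = left_diff 0 w)"
proof
  assume a: "\<forall>q. aug x q \<in> J"
  have "\<exists>v\<in>gvec (B (Suc 0)) (k - C b ! q). (\<lambda>p. x p q) = diff_map B D 0 v" if q: "q < length (C b)" for q
  proof -
    have xq: "(\<lambda>p. x p q) \<in> gvec (B 0) (k - C b ! q)" using tensor_col(1)[OF x q] .
    then have "(\<lambda>p. x p q) \<in> fvec (length (B 0))" by (simp add: gvec_def)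
    moreover have "(\<Sum>p<length (B 0). e p * x p q) \<in> J" using a by (simp add: aug_def)
    ultimately obtain w where w: "(\<lambda>p. x p q) = diff_map B D 0 w"
      using B(3) unfolding augments_def by blast
    have "diff_map B D 0 (gcomp (B (Suc 0)) (k - C b ! q) w) = (\<lambda>p. x p q)"
      using diff_map_graded_preimage[OF B(1), of 0 w "k - C b ! q"] xq by (simp add: w[symmetric])
    then show ?thesis by (intro bexI[of _ "gcomp (B (Suc 0)) (k - C b ! q) w"]) simp_all
  qed
  then obtain v where v: "\<And>q. q < length (C b) \<Longrightarrow> v q \<in> gvec (B (Suc 0)) (k - C b ! q)"
      "\<And>q. q < length (C b) \<Longrightarrow> (\<lambda>p. x p q) = diff_map B D 0 (v q)" by metis
  define w where "w p q = (if q < length (C b) then v q p else 0)" for p q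
  have wc: "(\<lambda>p. w p q) = (if q < length (C b) then v q else 0)" for q by (auto simp: w_def fun_eq_iff)
  have "w \<in> tensor (Suc 0) b" by (rule tensor_colI) (auto simp: wc v)
  moreover have "x = left_diff 0 w"
  proof (rule eq_by_cols)
    show "(\<lambda>p. x p q) = (\<lambda>p. left_diff 0 w p q)" for q
      unfolding left_diff_col wc using v(2)[of q] tensor_col(2)[OF x, of q] by (simp add: diff_map_0)
  qed
  ultimately show "\<exists>w\<in>tensor (Suc 0) b. x = left_diff 0 w" by blast
next
  assume "\<exists>w\<in>tensor (Suc 0) b. x = left_diff 0 w"
  then obtain w where w: "w \<in> tensor (Suc 0) b" "x = left_diff 0 w" by blast
  show "\<forall>q. aug x q \<in> J"
  proof
    fix q
    have xq: "(\<lambda>p. x p q) = diff_map B D 0 (\<lambda>p. w p q)" by (simp add: w(2) left_diff_col)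
    have "(\<lambda>p. w p q) \<in> fvec (length (B 1))" using w(1) by (auto simp: tensor_def fvec_def)
    moreover have "(\<lambda>p. x p q) \<in> fvec (length (B 0))" using x by (auto simp: tensor_def fvec_def)
    moreover have "(\<Sum>p<length (B 0). e p * y p) \<in> J \<longleftrightarrow> (\<exists>w\<in>fvec (length (B 1)). y = diff_map B D 0 w)"
      if "y \<in> fvec (length (B 0))" for y
      using B(3) that by (simp add: augments_def)
    ultimately have "(\<Sum>p<length (B 0). e p * x p q) \<in> J" using xq by blast
    then show "aug x q \<in> J" by (simp add: aug_def)
  qed
qed

lemma aug_right_diff: "aug (right_diff b x) = diff_map C T b (aug x)"
proof
  fix q
  have "(\<Sum>p<length (B 0). \<Sum>j<length (C (Suc b)). e p * (T b q j * x p j))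
     = (\<Sum>j<length (C (Suc b)). \<Sum>p<length (B 0). T b q j * (e p * x p j))"
    by (subst sum.swap) (simp add: mult.left_commute)
  then show "aug (right_diff b x) q = diff_map C T b (aug x) q"
    by (simp add: aug_def right_diff_def diff_map_def mat_vec_def sum_distrib_left)
qed

text \<open>The augmentation identifies the cokernel of \<open>F 1 \<rightarrow> F 0\<close> with \<open>A/J\<close>.\<close>

lemma vanishes_col_0: "vanishes 0 i \<longleftrightarrow> tor_zero C T J i k"
proof
  have J_ideal: "is_ideal J" using homogeneousD(1)[OF J] .
  {
    assume V: "vanishes 0 i"
    show "tor_zero C T J i k" unfolding tor_zero_def
    proof (intro ballI impI)
      fix x assume x: "x \<in> gvec (C i) k" and c: "i = 0 \<or> (\<forall>p. diff_map C T (i - 1) x p \<in> J)"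
      obtain y where y: "y \<in> tensor 0 i" "\<And>q. x q - aug y q \<in> J" using aug_surj[OF x] by metis
      have "i = 0 \<or> (\<exists>w\<in>tensor (Suc 0) (i - 1). right_diff (i - 1) y = left_diff 0 w)"
      proof (cases i)
        case (Suc j)
        have "aug (right_diff j y) q \<in> J" for q
        proof -
          have "diff_map C T j (x - aug y) q \<in> J" using y(2) by (intro diff_map_in_ideal J_ideal) simp
          moreover have "diff_map C T j x q \<in> J" using c Suc by simp
          ultimately have "diff_map C T j x q - diff_map C T j (x - aug y) q \<in> J" by (intro is_idealD(6)[OF J_ideal])
          then show ?thesis by (simp add: diff_map_diff aug_right_diff)
        qed
        moreover have "y \<in> tensor 0 (Suc j)" using y(1) Suc by simp
        ultimately have "\<exists>w\<in>tensor (Suc 0) j. right_diff j y = left_diff 0 w"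
          using aug_in_ideal_iff[OF right_diff_closed] by blast
        then show ?thesis using Suc by simp
      qed simp
      then obtain z w where zw: "z \<in> tensor 0 (Suc i)" "w \<in> tensor (Suc 0) i" "y = right_diff i z + left_diff 0 w"
        using vanishesD[OF V y(1)] by blast
      have "aug (left_diff 0 w) q \<in> J" for q
        using aug_in_ideal_iff[OF left_diff_closed[OF zw(2)]] zw(2) by blast
      then have "(x q - aug y q) + aug (left_diff 0 w) q \<in> J" for q
        using y(2) by (intro is_idealD(2)[OF J_ideal])
      then have "x q - diff_map C T i (aug z) q \<in> J" for q
        by (simp add: zw(3) aug_add aug_right_diff)
      then show "\<exists>z\<in>gvec (C (Suc i)) k. \<forall>p. x p - diff_map C T i z p \<in> J"
        using aug_in_gvec[OF zw(1)] by blast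
    qed
  next
    assume V: "tor_zero C T J i k"
    show "vanishes 0 i" unfolding vanishes_def
    proof (intro ballI impI)
      fix x assume x: "x \<in> tensor 0 i"
        and c: "i = 0 \<or> (\<exists>y\<in>tensor (Suc 0) (i - 1). right_diff (i - 1) x = left_diff 0 y)"
      have "i = 0 \<or> (\<forall>q. diff_map C T (i - 1) (aug x) q \<in> J)"
      proof (cases i)
        case (Suc j)
        have "right_diff j x \<in> tensor 0 j" using x Suc by (intro right_diff_closed) simp
        moreover have "\<exists>w\<in>tensor (Suc 0) j. right_diff j x = left_diff 0 w" using c Suc by simp
        ultimately have "\<forall>q. aug (right_diff j x) q \<in> J" using aug_in_ideal_iff by blast
        then show ?thesis using Suc by (simp add: aug_right_diff)
      qed simp
      then obtain z where z: "z \<in> gvec (C (Suc i)) k" "\<And>q. aug x q - diff_map C T i z q \<in> J"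
        using V aug_in_gvec[OF x] unfolding tor_zero_def by blast
      obtain y where y: "y \<in> tensor 0 (Suc i)" "\<And>q. z q - aug y q \<in> J" using aug_surj[OF z(1)] by metis
      have "aug (x - right_diff i y) q \<in> J" for q
      proof -
        have "diff_map C T i (z - aug y) q \<in> J" using y(2) by (intro diff_map_in_ideal J_ideal) simp
        then have "(aug x q - diff_map C T i z q) + diff_map C T i (z - aug y) q \<in> J"
          using z(2) by (intro is_idealD(2)[OF J_ideal])
        then show ?thesis by (simp add: diff_map_diff aug_diff aug_right_diff)
      qed
      moreover have "x - right_diff i y \<in> tensor 0 i" by (intro G_diff x right_diff_closed y)
      ultimately obtain w where "w \<in> tensor (Suc 0) i" "x - right_diff i y = left_diff 0 w"
        using aug_in_ideal_iff by blast
      then show "\<exists>z\<in>tensor 0 (Suc i). \<exists>w\<in>tensor (Suc 0) i. x = right_diff i z + left_diff 0 w"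
        using y(1) by (intro bexI[of _ y] bexI[of _ w]) (auto simp: algebra_simps)
    qed
  }
qed

lemma degree_in_resolution_iff: "k \<in> set (B i) \<longleftrightarrow> \<not> tor_zero C T J i k"
proof -
  have "tor_zero C T J i k \<longleftrightarrow> vanishes i 0"
    using vanishes_col_0 vanishes_diagonal[of 0 i] by simp
  then show ?thesis using vanishes_row_0 by blast
qed

end

text \<open>Whatever minimal resolution is chosen in the definition of the Betti numbers, its shifts are
  determined by \<open>Tor\<close>.\<close>

lemma betti_nonzero_iff:
  fixes J :: "('v::{finite,linorder}, 'k::field) mpoly set"
  assumes J: "homogeneous J" and C: "resolves_field C T"
  shows "betti J i k \<noteq> 0 \<longleftrightarrow> \<not> tor_zero C T J i k"
proof -
  define B where "B = (SOME B. \<exists>e D. minimal_graded_free_resolution J B e D)"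
  obtain B' e' D' where *: "graded_exact B' D'" "minimal_complex B' D'" "augments J B' e' D'"
    using exists_minimal_resolution[OF J] by blast
  define e where "e = vec (length (B' 0)) e'"
  define D where "D i = mat (length (B' i)) (length (B' (Suc i))) (\<lambda>(p, q). D' i p q)" for i
  have "minimal_graded_free_resolution J B' e D"
  proof -
    have D': "D i $$ (p, q) = D' i p q" if "p < length (B' i)" "q < length (B' (Suc i))" for i p q
      using that by (simp add: D_def)
    have "diff_map B' (\<lambda>i p q. D i $$ (p, q)) = diff_map B' D'"
      by (intro ext) (simp add: diff_map_def mat_vec_def D')
    with * show ?thesis
      unfolding minimal_graded_free_resolution_iff graded_exact_def minimal_complex_def augments_def
        gmat_def by (simp add: D') (simp add: D_def e_def)
  qed
  then have "\<exists>B e D. minimal_graded_free_resolution J B e D" by blast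
  from someI_ex[OF this] obtain e D where "minimal_graded_free_resolution J B e D"
    unfolding B_def by blast
  then interpret resolution_pair J B C "\<lambda>q. e $ q" "\<lambda>i p q. D i $$ (p, q)" T k
    unfolding minimal_graded_free_resolution_iff using J C by unfold_locales auto
  have "betti J i k \<noteq> 0 \<longleftrightarrow> k \<in> set (B i)"
    by (simp add: betti_def B_def[symmetric] count_list_0_iff)
  then show ?thesis by (simp add: degree_in_resolution_iff)
qed

section \<open>Regularity and short exact sequences\<close>

lemma diff_map_diff_map:
  assumes "graded_exact B D" "w \<in> fvec (length (B (Suc (Suc i))))"
  shows "diff_map B D i (diff_map B D (Suc i) w) = 0"
proof -
  have "diff_map B D (Suc i) w \<in> fvec (length (B (Suc i)))" by (simp add: diff_map_def)
  then show ?thesis using assms unfolding graded_exact_def by blast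
qed

text \<open>For a form \<open>f\<close> of degree \<open>d\<close> the ideals \<open>colon J f\<close>, \<open>J\<close> and \<open>adjoin J f\<close> are related by the exact sequence
  \<open>0 \<rightarrow> (A/(J : f))(-d) \<rightarrow> A/J \<rightarrow> A/(J + \<langle>f\<rangle>) \<rightarrow> 0\<close>.\<close>

definition colon :: "'a::comm_ring_1 set \<Rightarrow> 'a \<Rightarrow> 'a set" where
  "colon J f = {x. x * f \<in> J}"

definition adjoin :: "'a::comm_ring_1 set \<Rightarrow> 'a \<Rightarrow> 'a set" where
  "adjoin J f = {x + a * f | x a. x \<in> J}"

lemma is_ideal_adjoin:
  assumes J: "is_ideal J"
  shows "is_ideal (adjoin J f)"
  unfolding is_ideal_def
proof (intro conjI ballI allI)
  have "0 = 0 + 0 * f" by simp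
  then show "0 \<in> adjoin J f" unfolding adjoin_def using is_idealD(1)[OF J] by blast
  fix x assume "x \<in> adjoin J f"
  then obtain j a where x: "j \<in> J" "x = j + a * f" by (auto simp: adjoin_def)
  show "x + y \<in> adjoin J f" if y: "y \<in> adjoin J f" for y
  proof -
    obtain j' a' where y: "j' \<in> J" "y = j' + a' * f" using y by (auto simp: adjoin_def)
    have "x + y = (j + j') + (a + a') * f" by (simp add: x y algebra_simps)
    moreover have "j + j' \<in> J" using x y is_idealD(2)[OF J] by simp
    ultimately show ?thesis unfolding adjoin_def by blast
  qed
  show "c * x \<in> adjoin J f" for c
  proof -
    have "c * x = c * j + (c * a) * f" by (simp add: x algebra_simps)
    moreover have "c * j \<in> J" using x is_idealD(3)[OF J] by simp
    ultimately show ?thesis unfolding adjoin_def by blast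
  qed
qed

lemma adjoin_superset: "J \<subseteq> adjoin J f"
proof
  fix x assume "x \<in> J"
  moreover have "x = x + 0 * f" by simp
  ultimately show "x \<in> adjoin J f" unfolding adjoin_def by blast
qed

lemma adjoin_generator:
  assumes "is_ideal J"
  shows "f \<in> adjoin J f"
proof -
  have "f = 0 + 1 * f" by simp
  then show ?thesis unfolding adjoin_def using is_idealD(1)[OF assms] by blast
qed

lemma adjoin_least: "is_ideal L \<Longrightarrow> J \<subseteq> L \<Longrightarrow> f \<in> L \<Longrightarrow> adjoin J f \<subseteq> L"
  unfolding adjoin_def using is_idealD(2,3)[of L] by blast

lemma hcomp_adjoin:
  fixes f :: "('v::finite, 'k::comm_ring_1) mpoly"
  assumes J: "homogeneous J" and f: "f \<in> forms d" and x: "x \<in> adjoin J f"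
  obtains a where "a \<in> forms (k - d)" "hcomp k x - f * a \<in> J"
proof -
  obtain j a where x: "j \<in> J" "x = j + a * f" using x by (auto simp: adjoin_def)
  have "hcomp k x = hcomp k j + f * hcomp (k - d) a"
    by (simp add: x hcomp_add mult.commute[of a f] hcomp_mult_form[OF f])
  then have "hcomp k x - f * hcomp (k - d) a \<in> J" using homogeneousD(2)[OF J x(1)] by simp
  then show thesis by (intro that[of "hcomp (k - d) a"]) simp_all
qed

lemma homogeneous_adjoin:
  fixes f :: "('v::finite, 'k::comm_ring_1) mpoly"
  assumes J: "homogeneous J" and f: "f \<in> forms d"
  shows "homogeneous (adjoin J f)"
  unfolding homogeneous_def
proof (intro conjI ballI allI)
  show "is_ideal (adjoin J f)" by (rule is_ideal_adjoin[OF homogeneousD(1)[OF J]])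
  fix x k assume "x \<in> adjoin J f"
  then obtain a where "hcomp k x - f * a \<in> J" using hcomp_adjoin[OF J f] by metis
  moreover have "hcomp k x = (hcomp k x - f * a) + a * f" by (simp add: mult.commute)
  ultimately show "hcomp k x \<in> adjoin J f" unfolding adjoin_def by blast
qed

locale field_resolution =
  fixes C :: "nat \<Rightarrow> int list" and T :: "nat \<Rightarrow> nat \<Rightarrow> nat \<Rightarrow> ('v::{finite,linorder}, 'k::field) mpoly"
  assumes C: "resolves_field C T"
begin

abbreviation \<delta> :: "nat \<Rightarrow> (nat \<Rightarrow> ('v, 'k) mpoly) \<Rightarrow> nat \<Rightarrow> ('v, 'k) mpoly" where
  "\<delta> \<equiv> diff_map C T"

lemma exact: "graded_exact C T" and C_0: "C 0 = [0]"
  using C by (auto simp: resolves_field_def)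

lemma \<delta>_\<delta>: "w \<in> gvec (C (Suc (Suc i))) k \<Longrightarrow> \<delta> i (\<delta> (Suc i) w) = 0"
  using diff_map_diff_map[OF exact] by (auto simp: gvec_def)

lemma tor_zeroI:
  assumes "\<And>x. x \<in> gvec (C i) k \<Longrightarrow> (\<And>j p. i = Suc j \<Longrightarrow> \<delta> j x p \<in> J) \<Longrightarrow>
     \<exists>z\<in>gvec (C (Suc i)) k. \<forall>p. x p - \<delta> i z p \<in> J"
  shows "tor_zero C T J i k"
  unfolding tor_zero_def
proof (intro ballI impI)
  fix x assume "x \<in> gvec (C i) k" "i = 0 \<or> (\<forall>p. \<delta> (i - 1) x p \<in> J)"
  then show "\<exists>z\<in>gvec (C (Suc i)) k. \<forall>p. x p - \<delta> i z p \<in> J"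
    by (intro assms) auto
qed

lemma tor_zeroD:
  assumes "tor_zero C T J i k" "x \<in> gvec (C i) k" "\<And>j p. i = Suc j \<Longrightarrow> \<delta> j x p \<in> J"
  shows "\<exists>z\<in>gvec (C (Suc i)) k. \<forall>p. x p - \<delta> i z p \<in> J"
proof -
  have "i = 0 \<or> (\<forall>p. \<delta> (i - 1) x p \<in> J)" using assms(3) by (cases i) auto
  then show ?thesis using assms(1,2) unfolding tor_zero_def by blast
qed

context
  fixes J :: "('v, 'k) mpoly set" and f :: "('v, 'k) mpoly" and d :: int
  assumes J: "homogeneous J" and f: "f \<in> forms d"
begin

lemma J_ideal: "is_ideal J"
  using homogeneousD(1)[OF J] .

text \<open>Exactness in the middle: what vanishes modulo \<open>J + \<langle>f\<rangle>\<close> is, modulo \<open>J\<close>, a multiple of \<open>f\<close>, and the factor can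
  be taken homogeneous of degree lower by \<open>d\<close>.\<close>

lemma lift_adjoin:
  assumes u: "u \<in> gvec B k" "\<And>p. u p \<in> adjoin J f"
  shows "\<exists>y\<in>gvec B (k - d). \<forall>p. u p - f * y p \<in> J"
proof -
  have "\<exists>a. a \<in> forms (k - B ! p - d) \<and> u p - f * a \<in> J" if "p < length B" for p
  proof -
    have "hcomp (k - B ! p) (u p) = u p" using u(1) that by (intro hcomp_id) (simp add: gvec_def)
    then show ?thesis using hcomp_adjoin[OF J f u(2)[of p], of "k - B ! p"] by metis
  qed
  then obtain a where a: "\<And>p. p < length B \<Longrightarrow> a p \<in> forms (k - B ! p - d)"
      "\<And>p. p < length B \<Longrightarrow> u p - f * a p \<in> J" by metis
  define y where "y p = (if p < length B then a p else 0)" for p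
  show ?thesis
  proof (intro bexI[of _ y] allI)
    show "y \<in> gvec B (k - d)" using a(1) by (simp add: gvec_def fvec_def y_def algebra_simps)
    show "u p - f * y p \<in> J" for p
      using a(2)[of p] u(1) is_idealD(1)[OF J_ideal]
      by (cases "p < length B") (auto simp: y_def gvec_def fvec_def)
  qed
qed

lemma smul_gvec: "y \<in> gvec B (k - d) \<Longrightarrow> smul f y \<in> gvec B k"
  using gvec_smul[OF _ f, of y B "k - d"] by simp

lemma \<delta>_mem: "(\<And>q. x q \<in> J) \<Longrightarrow> \<delta> i x p \<in> J"
  by (intro diff_map_in_ideal J_ideal)

text \<open>The next three lemmas are the exactness of the long sequence of \<open>Tor\<close> modules, one at each of
  its three kinds of terms.\<close>

lemma tor_zero_middle:
  assumes Q: "tor_zero C T (colon J f) i (k - d)" and P: "tor_zero C T (adjoin J f) i k"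
  shows "tor_zero C T J i k"
proof (rule tor_zeroI)
  fix x assume x: "x \<in> gvec (C i) k" and cyc: "\<And>j p. i = Suc j \<Longrightarrow> \<delta> j x p \<in> J"
  have "\<exists>z\<in>gvec (C (Suc i)) k. \<forall>p. x p - \<delta> i z p \<in> adjoin J f"
  proof (rule tor_zeroD[OF P x])
    show "\<delta> j x p \<in> adjoin J f" if "i = Suc j" for j p
      using cyc[OF that] adjoin_superset by blast
  qed
  then obtain z where z: "z \<in> gvec (C (Suc i)) k" "\<And>p. x p - \<delta> i z p \<in> adjoin J f" by blast
  have "x - \<delta> i z \<in> gvec (C i) k" by (intro gvec_closed x diff_map_in_gvec exact z)
  then obtain y where y: "y \<in> gvec (C i) (k - d)" "\<And>p. (x - \<delta> i z) p - f * y p \<in> J"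
    using lift_adjoin[of "x - \<delta> i z"] z(2) by (simp only: fun_diff_def) blast
  have "\<exists>w\<in>gvec (C (Suc i)) (k - d). \<forall>p. y p - \<delta> i w p \<in> colon J f"
  proof (rule tor_zeroD[OF Q y(1)])
    fix j p assume i: "i = Suc j"
    have "\<delta> j (x - \<delta> i z - smul f y) p \<in> J" using y(2) by (intro \<delta>_mem) simp
    then have "\<delta> j x p - \<delta> j (x - \<delta> i z - smul f y) p \<in> J" using cyc[OF i] by (intro is_idealD(6)[OF J_ideal])
    then show "\<delta> j y p \<in> colon J f"
      using \<delta>_\<delta>[of z j k] z(1) i by (simp add: diff_map_diff diff_map_smul colon_def mult.commute)
  qed
  then obtain w where w: "w \<in> gvec (C (Suc i)) (k - d)" "\<And>p. y p - \<delta> i w p \<in> colon J f" by blast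
  have "z + smul f w \<in> gvec (C (Suc i)) k" by (intro gvec_closed z smul_gvec w)
  moreover have "x p - \<delta> i (z + smul f w) p \<in> J" for p
  proof -
    have "f * (y p - \<delta> i w p) \<in> J" using w(2) by (simp add: colon_def mult.commute)
    then have "((x - \<delta> i z) p - f * y p) + f * (y p - \<delta> i w p) \<in> J" using y(2) by (intro is_idealD(2)[OF J_ideal])
    then show ?thesis by (simp add: diff_map_add diff_map_smul algebra_simps)
  qed
  ultimately show "\<exists>z\<in>gvec (C (Suc i)) k. \<forall>p. x p - \<delta> i z p \<in> J" by blast
qed

lemma tor_zero_right:
  assumes N: "tor_zero C T J i k" and Q: "\<And>c. i = Suc c \<Longrightarrow> tor_zero C T (colon J f) c (k - d)"
  shows "tor_zero C T (adjoin J f) i k"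
proof (rule tor_zeroI)
  fix x assume x: "x \<in> gvec (C i) k" and cyc: "\<And>j p. i = Suc j \<Longrightarrow> \<delta> j x p \<in> adjoin J f"
  have "\<exists>w\<in>gvec (C i) (k - d). \<forall>j p. i = Suc j \<longrightarrow> \<delta> j (x - smul f w) p \<in> J"
  proof (cases i)
    case 0
    then show ?thesis by (intro bexI[of _ 0]) (auto simp: gvec_closed)
  next
    case (Suc c)
    have "\<delta> c x \<in> gvec (C c) k" using x Suc by (intro diff_map_in_gvec exact) simp
    then obtain y where y: "y \<in> gvec (C c) (k - d)" "\<And>p. \<delta> c x p - f * y p \<in> J"
      using lift_adjoin[of "\<delta> c x"] cyc[OF Suc] by blast
    have "\<exists>w\<in>gvec (C (Suc c)) (k - d). \<forall>p. y p - \<delta> c w p \<in> colon J f"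
    proof (rule tor_zeroD[OF Q[OF Suc] y(1)])
      fix j p assume c: "c = Suc j"
      have "\<delta> j (\<delta> c x - smul f y) p \<in> J" using y(2) by (intro \<delta>_mem) simp
      then have "- \<delta> j (\<delta> c x - smul f y) p \<in> J" by (rule is_idealD(5)[OF J_ideal])
      then show "\<delta> j y p \<in> colon J f"
        using \<delta>_\<delta>[of x j k] x c Suc by (simp add: diff_map_diff diff_map_smul colon_def mult.commute)
    qed
    then obtain w where w: "w \<in> gvec (C (Suc c)) (k - d)" "\<And>p. y p - \<delta> c w p \<in> colon J f" by blast
    have "\<delta> c (x - smul f w) p \<in> J" for p
    proof -
      have "f * (y p - \<delta> c w p) \<in> J" using w(2) by (simp add: colon_def mult.commute)
      then have "(\<delta> c x p - f * y p) + f * (y p - \<delta> c w p) \<in> J" using y(2) by (intro is_idealD(2)[OF J_ideal])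
      then show ?thesis by (simp add: diff_map_diff diff_map_smul algebra_simps)
    qed
    then show ?thesis using w(1) Suc by auto
  qed
  then obtain w where w: "w \<in> gvec (C i) (k - d)" "\<And>j p. i = Suc j \<Longrightarrow> \<delta> j (x - smul f w) p \<in> J" by blast
  have "x - smul f w \<in> gvec (C i) k" by (intro gvec_closed x smul_gvec w)
  from tor_zeroD[OF N this w(2)] obtain z
    where z: "z \<in> gvec (C (Suc i)) k" "\<And>p. (x - smul f w) p - \<delta> i z p \<in> J" by metis
  have "x p - \<delta> i z p \<in> adjoin J f" for p
  proof -
    have "x p - \<delta> i z p = ((x - smul f w) p - \<delta> i z p) + w p * f" by (simp add: mult.commute)
    with z(2)[of p] show ?thesis unfolding adjoin_def by blast
  qed
  with z(1) show "\<exists>z\<in>gvec (C (Suc i)) k. \<forall>p. x p - \<delta> i z p \<in> adjoin J f" by blast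
qed

lemma tor_zero_left:
  assumes P: "tor_zero C T (adjoin J f) (Suc i) k" and N: "tor_zero C T J i k"
  shows "tor_zero C T (colon J f) i (k - d)"
proof (rule tor_zeroI)
  fix y assume y: "y \<in> gvec (C i) (k - d)" and cyc: "\<And>j p. i = Suc j \<Longrightarrow> \<delta> j y p \<in> colon J f"
  have "\<exists>z\<in>gvec (C (Suc i)) k. \<forall>p. smul f y p - \<delta> i z p \<in> J"
  proof (rule tor_zeroD[OF N smul_gvec[OF y]])
    show "\<delta> j (smul f y) p \<in> J" if "i = Suc j" for j p
      using cyc[OF that, of p] by (simp add: diff_map_smul colon_def mult.commute)
  qed
  then obtain z where z: "z \<in> gvec (C (Suc i)) k" "\<And>p. smul f y p - \<delta> i z p \<in> J" by blast
  have "\<exists>w\<in>gvec (C (Suc (Suc i))) k. \<forall>p. z p - \<delta> (Suc i) w p \<in> adjoin J f"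
  proof (rule tor_zeroD[OF P z(1)])
    fix j p assume "Suc i = Suc j"
    then have j: "j = i" by simp
    have "- (smul f y p - \<delta> i z p) \<in> J" using z(2) by (rule is_idealD(5)[OF J_ideal])
    \<comment> \<open>The boundary of \<open>z\<close> is \<open>f * y\<close> modulo \<open>J\<close>, so \<open>z\<close> is a cycle modulo \<open>J + \<langle>f\<rangle>\<close>.\<close>
    moreover have "\<delta> i z p = - (smul f y p - \<delta> i z p) + y p * f" by (simp add: mult.commute)
    ultimately show "\<delta> j z p \<in> adjoin J f" unfolding adjoin_def j by blast
  qed
  then obtain w where w: "w \<in> gvec (C (Suc (Suc i))) k" "\<And>p. z p - \<delta> (Suc i) w p \<in> adjoin J f" by blast
  have "z - \<delta> (Suc i) w \<in> gvec (C (Suc i)) k" by (intro gvec_closed z diff_map_in_gvec exact w)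
  then obtain u where u: "u \<in> gvec (C (Suc i)) (k - d)" "\<And>p. (z - \<delta> (Suc i) w) p - f * u p \<in> J"
    using lift_adjoin[of "z - \<delta> (Suc i) w"] w(2) by (simp only: fun_diff_def) blast
  have "y p - \<delta> i u p \<in> colon J f" for p
  proof -
    have "\<delta> i (z - \<delta> (Suc i) w - smul f u) p \<in> J" using u(2) by (intro \<delta>_mem) simp
    then have "(smul f y p - \<delta> i z p) + \<delta> i (z - \<delta> (Suc i) w - smul f u) p \<in> J"
      using z(2) by (intro is_idealD(2)[OF J_ideal])
    then show ?thesis
      using \<delta>_\<delta>[OF w(1)]
      by (simp add: diff_map_diff diff_map_smul colon_def left_diff_distrib) (simp add: mult.commute)
  qed
  with u(1) show "\<exists>z\<in>gvec (C (Suc i)) (k - d). \<forall>p. y p - \<delta> i z p \<in> colon J f" by blast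
qed

end

text \<open>Upper bounds for the regularity by an integer.  All the estimates are made in this form, which
  covers infinite regularity and the zero module without distinction of cases.\<close>

definition reg_le :: "('v, 'k) mpoly set \<Rightarrow> int \<Rightarrow> bool" where
  "reg_le J r \<longleftrightarrow> (\<forall>i k. \<not> tor_zero C T J i k \<longrightarrow> k - int i \<le> r)"

lemma reg_le_mono: "reg_le J r \<Longrightarrow> r \<le> r' \<Longrightarrow> reg_le J r'"
  unfolding reg_le_def by (meson order_trans)

lemma reg_le_middle:
  assumes "homogeneous J" "f \<in> forms d" "reg_le (colon J f) (r - d)" "reg_le (adjoin J f) r"
  shows "reg_le J r"
  unfolding reg_le_def
proof (intro allI impI)
  fix i k assume "\<not> tor_zero C T J i k"
  then consider "\<not> tor_zero C T (colon J f) i (k - d)" | "\<not> tor_zero C T (adjoin J f) i k"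
    using tor_zero_middle[OF assms(1,2)] by blast
  then show "k - int i \<le> r"
  proof cases
    case 1
    with assms(3) have "k - d - int i \<le> r - d" by (simp add: reg_le_def)
    then show ?thesis by simp
  next
    case 2
    with assms(4) show ?thesis by (simp add: reg_le_def)
  qed
qed

lemma reg_le_right:
  assumes "homogeneous J" "f \<in> forms d" "reg_le J r" "reg_le (colon J f) (r + 1 - d)"
  shows "reg_le (adjoin J f) r"
  unfolding reg_le_def
proof (intro allI impI)
  fix i k assume "\<not> tor_zero C T (adjoin J f) i k"
  then consider "\<not> tor_zero C T J i k" | c where "i = Suc c" "\<not> tor_zero C T (colon J f) c (k - d)"
    using tor_zero_right[OF assms(1,2)] by blast
  then show "k - int i \<le> r"
  proof cases
    case 1
    with assms(3) show ?thesis by (simp add: reg_le_def)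
  next
    case 2
    with assms(4) have "k - d - int c \<le> r + 1 - d" by (simp add: reg_le_def)
    then show ?thesis using 2(1) by simp
  qed
qed

lemma reg_le_left:
  assumes "homogeneous J" "f \<in> forms d" "reg_le (adjoin J f) (r - 1)" "reg_le J r"
  shows "reg_le (colon J f) (r - d)"
  unfolding reg_le_def
proof (intro allI impI)
  fix i k' assume a: "\<not> tor_zero C T (colon J f) i k'"
  define k where "k = k' + d"
  have "\<not> tor_zero C T (colon J f) i (k - d)" using a by (simp add: k_def)
  then consider "\<not> tor_zero C T (adjoin J f) (Suc i) k" | "\<not> tor_zero C T J i k"
    using tor_zero_left[OF assms(1,2)] by blast
  then have "k - int i \<le> r"
  proof cases
    case 1
    with assms(3) have "k - int (Suc i) \<le> r - 1" unfolding reg_le_def by blast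
    then show ?thesis by simp
  next
    case 2
    with assms(4) show ?thesis by (simp add: reg_le_def)
  qed
  then show "k' - int i \<le> r - d" by (simp add: k_def)
qed

lemma reg_quotient_eq_Sup:
  assumes "homogeneous J"
  shows "reg_quotient J = Sup {ereal (of_int (k - int i)) | i k. \<not> tor_zero C T J i k}"
  unfolding reg_quotient_def betti_nonzero_iff[OF assms C] ..

lemma reg_quotient_le_iff:
  assumes "homogeneous J"
  shows "reg_quotient J \<le> ereal (of_int r) \<longleftrightarrow> reg_le J r"
proof -
  have "reg_quotient J \<le> ereal (of_int r) \<longleftrightarrow>
      (\<forall>i k. \<not> tor_zero C T J i k \<longrightarrow> ereal (of_int (k - int i)) \<le> ereal (of_int r))"
    unfolding reg_quotient_eq_Sup[OF assms] Sup_le_iff by blast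
  then show ?thesis unfolding reg_le_def ereal_less_eq(3) of_int_le_iff .
qed

lemma reg_quotient_less_iff:
  assumes "homogeneous J"
  shows "reg_quotient J < ereal (of_int r) \<longleftrightarrow> reg_le J (r - 1)"
proof
  assume "reg_le J (r - 1)"
  then have "reg_quotient J \<le> ereal (of_int (r - 1))" using reg_quotient_le_iff[OF assms] by blast
  also have "\<dots> < ereal (of_int r)" by simp
  finally show "reg_quotient J < ereal (of_int r)" .
next
  assume a: "reg_quotient J < ereal (of_int r)"
  show "reg_le J (r - 1)" unfolding reg_le_def
  proof (intro allI impI)
    fix i k assume "\<not> tor_zero C T J i k"
    then have "ereal (of_int (k - int i)) \<le> reg_quotient J"
      unfolding reg_quotient_eq_Sup[OF assms] by (intro Sup_upper) blast
    then have "ereal (of_int (k - int i)) < ereal (of_int r)" using a by (rule le_less_trans)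
    then have "k - int i < r" unfolding less_ereal.simps(1) of_int_less_iff .
    then show "k - int i \<le> r - 1" by simp
  qed
qed

lemma reg_quotient_eq_iff:
  assumes "homogeneous J"
  shows "reg_quotient J = ereal (of_int r) \<longleftrightarrow> reg_le J r \<and> \<not> reg_le J (r - 1)"
  using reg_quotient_le_iff[OF assms, of r] reg_quotient_less_iff[OF assms, of r] by auto

text \<open>The class of \<open>1\<close> is a minimal generator of \<open>A/J\<close> in degree \<open>0\<close>.\<close>

lemma reg_ge_0_of_proper:
  assumes "homogeneous J" "1 \<notin> J"
  shows "\<not> reg_le J (-1)"
proof -
  have "\<not> tor_zero C T J 0 0"
  proof
    assume t: "tor_zero C T J 0 0"
    define x where "x = (\<lambda>p::nat. if p = 0 then 1 else 0 :: ('v, 'k) mpoly)"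
    have "x \<in> gvec (C 0) 0" by (simp add: x_def gvec_def fvec_def C_0 forms_one)
    from tor_zeroD[OF t this] obtain z where z: "z \<in> gvec (C (Suc 0)) 0" "\<And>p. x p - \<delta> 0 z p \<in> J"
      by blast
    have "\<delta> 0 z \<in> gvec (C 0) 0" by (intro diff_map_in_gvec exact z)
    then have "lookup (\<delta> 0 z 0) 0 = 0" using resolves_field_image_0[OF C] z(1) by auto
    moreover have "lookup (x 0 - \<delta> 0 z 0) 0 = 0" using proper_homogeneous_lookup_0[OF assms z(2)] .
    ultimately show False by (simp add: x_def lookup_minus)
  qed
  then show ?thesis unfolding reg_le_def by force
qed

lemma reg_zero_ideal: "reg_le {0} 0"
proof -
  have "tor_zero C T {0} (Suc i) k" for i k
  proof (rule tor_zeroI)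
    fix x assume x: "x \<in> gvec (C (Suc i)) k" and "\<And>j p. Suc i = Suc j \<Longrightarrow> \<delta> j x p \<in> {0}"
    then have "\<delta> i x = 0" by (auto simp: fun_eq_iff)
    then obtain w where "w \<in> gvec (C (Suc (Suc i))) k" "x = \<delta> (Suc i) w"
      using graded_exact_gvec[OF exact x] by blast
    then show "\<exists>z\<in>gvec (C (Suc (Suc i))) k. \<forall>p. x p - \<delta> (Suc i) z p \<in> {0}" by auto
  qed
  moreover have "tor_zero C T {0} 0 k" if k: "k > 0" for k
  proof (rule tor_zeroI)
    fix x :: "nat \<Rightarrow> ('v, 'k) mpoly" assume x: "x \<in> gvec (C 0) k"
    then have "x 0 \<in> forms k" by (simp add: gvec_def C_0)
    then have "lookup (x 0) 0 = 0" using k by (intro lookup_form_at_0[of _ k]) simp_all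
    then obtain z where "z \<in> gvec (C 1) k" "x = \<delta> 0 z" using resolves_field_image_0[OF C x] by blast
    then show "\<exists>z\<in>gvec (C (Suc 0)) k. \<forall>p. x p - \<delta> 0 z p \<in> {0}" by auto
  qed
  ultimately show ?thesis unfolding reg_le_def by (metis diff_zero not_le of_nat_0 old.nat.exhaust)
qed

end

section \<open>Sums, products and powers of ideals\<close>

lemma ring_of_type_simps [simp]:
  "carrier (ring_of_type_algebra :: 'a::ring_1 ring) = UNIV"
  "monoid.mult (ring_of_type_algebra :: 'a ring) = (*)"
  "add (ring_of_type_algebra :: 'a ring) = (+)"
  "zero (ring_of_type_algebra :: 'a ring) = 0"
  "one (ring_of_type_algebra :: 'a ring) = 1"
  by (simp_all add: ring_of_type_algebra_def)

lemma ideal_iff_is_ideal: "ideal J (ring_of_type_algebra :: 'a::comm_ring_1 ring) \<longleftrightarrow> is_ideal J"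
proof
  assume "ideal J (ring_of_type_algebra :: 'a ring)"
  then interpret ideal J "ring_of_type_algebra :: 'a ring" .
  show "is_ideal J" unfolding is_ideal_def
    using additive_subgroup.zero_closed[OF is_additive_subgroup]
      additive_subgroup.a_closed[OF is_additive_subgroup] I_l_closed by simp
next
  assume J: "is_ideal J"
  interpret cring "ring_of_type_algebra :: 'a ring" by (rule cring_from_type_algebra)
  show "ideal J (ring_of_type_algebra :: 'a ring)"
  proof (rule idealI[OF ring_axioms])
    have inv: "inv\<^bsub>add_monoid (ring_of_type_algebra :: 'a ring)\<^esub> x = - x" for x
      using minus_equality[of "- x" x] by (simp add: a_inv_def)
    show "subgroup J (add_monoid (ring_of_type_algebra :: 'a ring))"
    proof (rule subgroup.intro)
      show "inv\<^bsub>add_monoid (ring_of_type_algebra :: 'a ring)\<^esub> x \<in> J" if "x \<in> J" for x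
        unfolding inv using that is_idealD(5)[OF J] by simp
    qed (use is_idealD[OF J] in auto)
  qed (use is_idealD[OF J] in auto)
qed

lemma is_ideal_Idl: "is_ideal (Idl\<^bsub>ring_of_type_algebra\<^esub> S)" for S :: "'a::comm_ring_1 set"
  using ring.genideal_ideal[OF ring_from_type_algebra, of S] ideal_iff_is_ideal by auto

lemma Idl_superset: "S \<subseteq> Idl\<^bsub>ring_of_type_algebra\<^esub> S" for S :: "'a::comm_ring_1 set"
  by (auto simp: genideal_def)

lemma Idl_least: "is_ideal J \<Longrightarrow> S \<subseteq> J \<Longrightarrow> Idl\<^bsub>ring_of_type_algebra\<^esub> S \<subseteq> J" for S :: "'a::comm_ring_1 set"
  using ideal_iff_is_ideal[of J] by (auto simp: genideal_def)

lemma Idl_empty: "Idl\<^bsub>ring_of_type_algebra\<^esub> {} = {0 :: 'a::comm_ring_1}"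
proof
  have "is_ideal {0 :: 'a}" by (simp add: is_ideal_def)
  then show "Idl\<^bsub>ring_of_type_algebra\<^esub> {} \<subseteq> {0 :: 'a}" by (rule Idl_least) simp
qed (simp add: is_idealD is_ideal_Idl)

lemma Idl_insert:
  "Idl\<^bsub>ring_of_type_algebra\<^esub> (insert a S) = adjoin (Idl\<^bsub>ring_of_type_algebra\<^esub> S) a" for S :: "'a::comm_ring_1 set"
proof
  show "Idl\<^bsub>ring_of_type_algebra\<^esub> (insert a S) \<subseteq> adjoin (Idl\<^bsub>ring_of_type_algebra\<^esub> S) a"
    using adjoin_generator[OF is_ideal_Idl] adjoin_superset Idl_superset
    by (intro Idl_least is_ideal_adjoin is_ideal_Idl) blast
  show "adjoin (Idl\<^bsub>ring_of_type_algebra\<^esub> S) a \<subseteq> Idl\<^bsub>ring_of_type_algebra\<^esub> (insert a S)"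
  proof (rule adjoin_least[OF is_ideal_Idl])
    show "Idl\<^bsub>ring_of_type_algebra\<^esub> S \<subseteq> Idl\<^bsub>ring_of_type_algebra\<^esub> (insert a S)"
      using Idl_superset[of "insert a S"] by (intro Idl_least is_ideal_Idl) blast
  qed (use Idl_superset[of "insert a S"] in blast)
qed

abbreviation prod_ideal :: "'a::comm_ring_1 set \<Rightarrow> 'a set \<Rightarrow> 'a set" where
  "prod_ideal I J \<equiv> ideal_prod ring_of_type_algebra I J"

abbreviation sum_ideal :: "'a::comm_ring_1 set \<Rightarrow> 'a set \<Rightarrow> 'a set" where
  "sum_ideal I J \<equiv> I <+>\<^bsub>ring_of_type_algebra\<^esub> J"

abbreviation power_ideal :: "'a::comm_ring_1 set \<Rightarrow> nat \<Rightarrow> 'a set" where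
  "power_ideal I s \<equiv> I [^]\<^bsub>ideals_set ring_of_type_algebra\<^esub> s"

lemma prod_idealI: "x \<in> I \<Longrightarrow> y \<in> J \<Longrightarrow> x * y \<in> prod_ideal I J"
  using ideal_prod.prod[of x I y J ring_of_type_algebra] by simp

lemma prod_ideal_add: "x \<in> prod_ideal I J \<Longrightarrow> y \<in> prod_ideal I J \<Longrightarrow> x + y \<in> prod_ideal I J"
  using ideal_prod.sum[of x ring_of_type_algebra I J y] by simp

lemma prod_ideal_induct [consumes 1, case_names mult add]:
  assumes "x \<in> prod_ideal I J" "\<And>a b. a \<in> I \<Longrightarrow> b \<in> J \<Longrightarrow> P (a * b)" "\<And>x y. P x \<Longrightarrow> P y \<Longrightarrow> P (x + y)"
  shows "P x"
  using assms(1) by induction (use assms(2,3) in auto)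

lemma is_ideal_prod: "is_ideal I \<Longrightarrow> is_ideal J \<Longrightarrow> is_ideal (prod_ideal I J)"
  using ring.ideal_prod_is_ideal[OF ring_from_type_algebra] ideal_iff_is_ideal by metis

lemma prod_ideal_subset: "is_ideal I \<Longrightarrow> is_ideal J \<Longrightarrow> prod_ideal I J \<subseteq> I \<inter> J"
  using ring.ideal_prod_inter[OF ring_from_type_algebra] ideal_iff_is_ideal by metis

lemma prod_ideal_commute: "prod_ideal I J \<subseteq> prod_ideal J I"
proof
  fix x assume "x \<in> prod_ideal I J"
  then show "x \<in> prod_ideal J I"
  proof (induction rule: prod_ideal_induct)
    case (mult a b)
    then show ?case using prod_idealI[of b J a I] by (simp add: mult.commute)
  qed (rule prod_ideal_add)
qed

lemma sum_ideal_iff: "x \<in> sum_ideal I J \<longleftrightarrow> (\<exists>a\<in>I. \<exists>b\<in>J. x = a + b)"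
  by (auto simp: set_add_def set_mult_def)

lemma is_ideal_sum_ideal:
  assumes "is_ideal I" "is_ideal J"
  shows "is_ideal (sum_ideal I J)"
  unfolding is_ideal_def
proof (intro conjI ballI allI)
  show "0 \<in> sum_ideal I J"
    unfolding sum_ideal_iff using is_idealD(1)[OF assms(1)] is_idealD(1)[OF assms(2)] by force
  fix x assume "x \<in> sum_ideal I J"
  then obtain a b where x: "a \<in> I" "b \<in> J" "x = a + b" by (auto simp: sum_ideal_iff)
  show "x + y \<in> sum_ideal I J" if y: "y \<in> sum_ideal I J" for y
  proof -
    obtain a' b' where y: "a' \<in> I" "b' \<in> J" "y = a' + b'" using y by (auto simp: sum_ideal_iff)
    show ?thesis unfolding sum_ideal_iff using x y is_idealD(2)[OF assms(1)] is_idealD(2)[OF assms(2)]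
      by (intro bexI[of _ "a + a'"] bexI[of _ "b + b'"]) (simp_all add: algebra_simps)
  qed
  show "c * x \<in> sum_ideal I J" for c
    unfolding sum_ideal_iff using x is_idealD(3)[OF assms(1)] is_idealD(3)[OF assms(2)]
    by (intro bexI[of _ "c * a"] bexI[of _ "c * b"]) (simp_all add: algebra_simps)
qed

lemma sum_ideal_superset:
  assumes "is_ideal I" "is_ideal J"
  shows "I \<subseteq> sum_ideal I J" "J \<subseteq> sum_ideal I J"
proof -
  show "I \<subseteq> sum_ideal I J"
  proof
    fix x assume "x \<in> I"
    then show "x \<in> sum_ideal I J" unfolding sum_ideal_iff
      using is_idealD(1)[OF assms(2)] by (intro bexI[of _ x] bexI[of _ 0]) simp_all
  qed
  show "J \<subseteq> sum_ideal I J"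
  proof
    fix x assume "x \<in> J"
    then show "x \<in> sum_ideal I J" unfolding sum_ideal_iff
      using is_idealD(1)[OF assms(1)] by (intro bexI[of _ 0] bexI[of _ x]) simp_all
  qed
qed

lemma sum_ideal_least: "is_ideal L \<Longrightarrow> I \<subseteq> L \<Longrightarrow> J \<subseteq> L \<Longrightarrow> sum_ideal I J \<subseteq> L"
  using is_idealD(2)[of L] by (auto simp: sum_ideal_iff subset_eq)

lemma power_ideal_0: "power_ideal I 0 = UNIV" for I :: "'a::comm_ring_1 set"
  by (simp add: nat_pow_def ideals_set_def)

lemma power_ideal_Suc: "power_ideal I (Suc s) = prod_ideal (power_ideal I s) I" for I :: "'a::comm_ring_1 set"
  by (simp add: nat_pow_def ideals_set_def)

lemma is_ideal_power: "is_ideal I \<Longrightarrow> is_ideal (power_ideal I s)"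
proof (induction s)
  case 0
  show ?case unfolding power_ideal_0 by (simp add: is_ideal_def)
next
  case (Suc s)
  then show ?case unfolding power_ideal_Suc by (intro is_ideal_prod)
qed

lemma power_ideal_1:
  assumes "is_ideal I"
  shows "power_ideal I (Suc 0) = I"
proof
  show "power_ideal I (Suc 0) \<subseteq> I"
    unfolding power_ideal_Suc using prod_ideal_subset[OF is_ideal_power[OF assms] assms] by blast
  show "I \<subseteq> power_ideal I (Suc 0)"
  proof
    fix x assume "x \<in> I"
    then have "1 * x \<in> prod_ideal (power_ideal I 0) I" unfolding power_ideal_0 by (intro prod_idealI) simp_all
    then show "x \<in> power_ideal I (Suc 0)" unfolding power_ideal_Suc by simp
  qed
qed

lemma homogeneous_sum_ideal:
  assumes "homogeneous I" "homogeneous J"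
  shows "homogeneous (sum_ideal I J)"
  unfolding homogeneous_def
proof (intro conjI ballI allI)
  show "is_ideal (sum_ideal I J)" by (intro is_ideal_sum_ideal homogeneousD(1) assms)
  fix x k assume "x \<in> sum_ideal I J"
  then obtain a b where x: "a \<in> I" "b \<in> J" "x = a + b" by (auto simp: sum_ideal_iff)
  show "hcomp k x \<in> sum_ideal I J" unfolding sum_ideal_iff
    using x homogeneousD(2)[OF assms(1)] homogeneousD(2)[OF assms(2)]
    by (intro bexI[of _ "hcomp k a"] bexI[of _ "hcomp k b"]) (simp_all add: hcomp_add)
qed

lemma homogeneous_prod_ideal:
  assumes "homogeneous I" "homogeneous J"
  shows "homogeneous (prod_ideal I J)"
  unfolding homogeneous_def
proof (intro conjI ballI allI)
  show ideal: "is_ideal (prod_ideal I J)" by (intro is_ideal_prod homogeneousD(1) assms)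
  fix x k assume "x \<in> prod_ideal I J"
  then show "hcomp k x \<in> prod_ideal I J"
  proof (induction rule: prod_ideal_induct)
    case (mult a b)
    obtain U where U: "finite U" "\<And>Y. finite Y \<Longrightarrow> U \<subseteq> Y \<Longrightarrow> (\<Sum>k\<in>Y. hcomp k a) = a"
      using hcomp_decomposition by blast
    have "a * b = (\<Sum>l\<in>U. hcomp l a * b)" using U(2)[OF U(1)] by (simp add: sum_distrib_right[symmetric])
    then have "hcomp k (a * b) = (\<Sum>l\<in>U. hcomp l a * hcomp (k - l) b)"
      by (simp add: hcomp_sum hcomp_mult_form[OF hcomp_in_forms])
    also have "\<dots> \<in> prod_ideal I J"
      using mult homogeneousD(2)[OF assms(1)] homogeneousD(2)[OF assms(2)]
      by (intro is_ideal_sum ideal prod_idealI)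
    finally show ?case .
  qed (simp add: hcomp_add prod_ideal_add)
qed

lemma homogeneous_power_ideal: "homogeneous I \<Longrightarrow> homogeneous (power_ideal I s)"
proof (induction s)
  case 0
  show ?case unfolding power_ideal_0 by (simp add: homogeneous_def is_ideal_def)
next
  case (Suc s)
  then show ?case unfolding power_ideal_Suc by (intro homogeneous_prod_ideal)
qed

text \<open>Products with elements of \<open>J + \<langle>f\<rangle>\<close> split off a multiple of \<open>f\<close>.\<close>

lemma prod_adjoin_decompose:
  assumes x: "x \<in> prod_ideal (adjoin J f) L" and J: "is_ideal J" and L: "is_ideal L"
  shows "\<exists>u\<in>prod_ideal J L. \<exists>y\<in>L. x = u + y * f"
  using x
proof (induction rule: prod_ideal_induct)
  case (mult a b)
  then obtain j c where a: "j \<in> J" "a = j + c * f" by (auto simp: adjoin_def)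
  have "a * b = j * b + (c * b) * f" by (simp add: a algebra_simps)
  moreover have "j * b \<in> prod_ideal J L" using a mult by (intro prod_idealI)
  moreover have "c * b \<in> L" using mult is_idealD(3)[OF L] by blast
  ultimately show ?case by blast
next
  case (add x y)
  then obtain u v u' v' where *: "u \<in> prod_ideal J L" "v \<in> L" "x = u + v * f"
      "u' \<in> prod_ideal J L" "v' \<in> L" "y = u' + v' * f" by blast
  have "x + y = (u + u') + (v + v') * f" by (simp add: * algebra_simps)
  moreover have "u + u' \<in> prod_ideal J L" "v + v' \<in> L"
    using * prod_ideal_add is_idealD(2)[OF L] by blast+
  ultimately show ?case by blast
qed

lemma prod_ideal_mult_right:
  assumes "x \<in> prod_ideal J L" "f \<in> I"
  shows "x * f \<in> prod_ideal J (prod_ideal L I)"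
  using assms(1)
proof (induction rule: prod_ideal_induct)
  case (mult a b)
  have "a * (b * f) \<in> prod_ideal J (prod_ideal L I)" using mult assms(2) by (intro prod_idealI)
  then show ?case by (simp add: mult.assoc)
next
  case (add x y)
  then show ?case using prod_ideal_add[of "x * f" J "prod_ideal L I" "y * f"] by (simp add: distrib_right)
qed

section \<open>Powers of an ideal generated by a d-sequence\<close>

locale d_sequence_ideal =
  fixes f :: "nat \<Rightarrow> 'a::comm_ring_1" and n :: nat
  assumes d_seq: "d_sequence ring_of_type_algebra n f"
begin

definition gen :: "nat \<Rightarrow> 'a set" where
  "gen i = Idl\<^bsub>ring_of_type_algebra\<^esub> (f ` {1..i})"

lemma gen_0: "gen 0 = {0}"
  by (simp add: gen_def Idl_empty)

lemma gen_Suc: "gen (Suc i) = adjoin (gen i) (f (Suc i))"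
  by (simp add: gen_def Idl_insert atLeastAtMostSuc_conv)

lemma is_ideal_gen: "is_ideal (gen i)"
  by (simp add: gen_def is_ideal_Idl)

lemma gen_mono: "i \<le> j \<Longrightarrow> gen i \<subseteq> gen j"
proof (induction j rule: dec_induct)
  case (step j)
  then show ?case using adjoin_superset[of "gen j"] by (auto simp: gen_Suc)
qed simp

lemma gen_member: "1 \<le> l \<Longrightarrow> l \<le> i \<Longrightarrow> f l \<in> gen i"
  unfolding gen_def by (rule subsetD[OF Idl_superset]) simp

lemma cancel:
  assumes "Suc i \<le> n" "x \<in> gen n" "x * f (Suc i) \<in> gen i"
  shows "x \<in> gen i"
proof -
  have "Suc i \<in> {1..n}" using assms(1) by simp
  with d_seq have "colon_ideal ring_of_type_algebra (gen (Suc i - 1)) (f (Suc i)) \<inter> gen n = gen (Suc i - 1)"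
    unfolding d_sequence_def gen_def by blast
  moreover have "x \<in> colon_ideal ring_of_type_algebra (gen i) (f (Suc i))"
    using assms(3) by (simp add: colon_ideal_def)
  ultimately show ?thesis using assms(2) by auto
qed

abbreviation pow :: "nat \<Rightarrow> 'a set" where
  "pow s \<equiv> power_ideal (gen n) s"

lemma is_ideal_pow: "is_ideal (pow s)"
  by (intro is_ideal_power is_ideal_gen)

lemma pow_Suc_subset: "pow (Suc s) \<subseteq> gen n"
  unfolding power_ideal_Suc using prod_ideal_subset[OF is_ideal_pow is_ideal_gen] by blast

text \<open>The characteristic property of d-sequences, with \<open>I = gen n\<close>: the ideal \<open>gen i\<close> meets a power of \<open>I\<close> only as far
  as its product with the next lower power requires.  For \<open>x\<close> in the intersection, descending
  induction on \<open>i\<close> yields \<open>x = u + y * f (Suc i)\<close> with \<open>u\<close> in the product and \<open>y\<close> in the lower power.  The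
  d-sequence condition puts \<open>y\<close> into \<open>gen i\<close>, and induction on the exponent applies to \<open>y\<close>.\<close>

lemma inter_pow: "i \<le> n \<Longrightarrow> gen i \<inter> pow (Suc s) \<subseteq> prod_ideal (gen i) (pow s)"
proof (induction s arbitrary: i)
  case 0
  show ?case
  proof
    fix x assume "x \<in> gen i \<inter> pow (Suc 0)"
    then have "x * 1 \<in> prod_ideal (gen i) (pow 0)" unfolding power_ideal_0 by (intro prod_idealI) simp_all
    then show "x \<in> prod_ideal (gen i) (pow 0)" by simp
  qed
next
  case (Suc s)
  from Suc.prems show ?case
  proof (induction i rule: inc_induct)
    case base
    show ?case unfolding power_ideal_Suc[of "gen n" "Suc s"]
      using prod_ideal_commute[of "pow (Suc s)" "gen n"] by blast
  next
    case (step i)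
    show ?case
    proof
      fix x assume x: "x \<in> gen i \<inter> pow (Suc (Suc s))"
      then have "x \<in> prod_ideal (gen (Suc i)) (pow (Suc s))" using step.IH gen_mono[of i "Suc i"] by auto
      then obtain u y where uy: "u \<in> prod_ideal (gen i) (pow (Suc s))" "y \<in> pow (Suc s)" "x = u + y * f (Suc i)"
        using prod_adjoin_decompose[OF _ is_ideal_gen is_ideal_pow] unfolding gen_Suc by blast
      have "u \<in> gen i" using uy(1) prod_ideal_subset[OF is_ideal_gen is_ideal_pow] by blast
      then have "x - u \<in> gen i" using x is_idealD(6)[OF is_ideal_gen] by blast
      then have "y * f (Suc i) \<in> gen i" by (simp add: uy(3))
      moreover have "y \<in> gen n" using uy(2) pow_Suc_subset by blast
      ultimately have "y \<in> gen i" using cancel[of i y] step.hyps by simp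
      then have "y \<in> prod_ideal (gen i) (pow s)" using Suc.IH[of i] uy(2) step.hyps by auto
      then have "y * f (Suc i) \<in> prod_ideal (gen i) (pow (Suc s))"
        unfolding power_ideal_Suc[of "gen n" s] using step.hyps by (intro prod_ideal_mult_right gen_member) simp_all
      then show "x \<in> prod_ideal (gen i) (pow (Suc s))" unfolding uy(3) by (intro prod_ideal_add uy(1))
    qed
  qed
qed

text \<open>If \<open>f (Suc i)\<close> is a nonzerodivisor modulo \<open>gen i\<close>, dividing by it lowers the power by one.  This is the
  algebraic input for the descent on \<open>i\<close> in the main proof.\<close>

lemma colon_sum_pow:
  assumes i: "Suc i \<le> n" and reg: "\<And>x. x * f (Suc i) \<in> gen i \<Longrightarrow> x \<in> gen i"
  shows "colon (sum_ideal (gen i) (pow (Suc s))) (f (Suc i)) = sum_ideal (gen i) (pow s)"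
proof (intro equalityI subsetI)
  fix x assume "x \<in> colon (sum_ideal (gen i) (pow (Suc s))) (f (Suc i))"
  then obtain a b where ab: "a \<in> gen i" "b \<in> pow (Suc s)" "x * f (Suc i) = a + b"
    by (auto simp: colon_def sum_ideal_iff)
  have "a \<in> gen (Suc i)" using ab(1) gen_mono[of i "Suc i"] by auto
  moreover have "x * f (Suc i) \<in> gen (Suc i)" using gen_member[of "Suc i" "Suc i"] by (intro is_idealD(3)[OF is_ideal_gen]) simp
  ultimately have "x * f (Suc i) - a \<in> gen (Suc i)" by (intro is_idealD(6)[OF is_ideal_gen])
  then have "b \<in> prod_ideal (gen (Suc i)) (pow s)" using inter_pow[OF i, of s] ab by auto
  then obtain u y where uy: "u \<in> prod_ideal (gen i) (pow s)" "y \<in> pow s" "b = u + y * f (Suc i)"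
    using prod_adjoin_decompose[OF _ is_ideal_gen is_ideal_pow] unfolding gen_Suc by blast
  have "u \<in> gen i" using uy(1) prod_ideal_subset[OF is_ideal_gen is_ideal_pow] by blast
  then have "a + u \<in> gen i" using ab(1) by (intro is_idealD(2)[OF is_ideal_gen])
  moreover have "(x - y) * f (Suc i) = a + u" using ab(3) uy(3) by (simp add: algebra_simps)
  ultimately have "x - y \<in> gen i" using reg[of "x - y"] by simp
  then show "x \<in> sum_ideal (gen i) (pow s)"
    unfolding sum_ideal_iff using uy(2) by (intro bexI[of _ "x - y"] bexI[of _ y]) simp_all
next
  fix x assume "x \<in> sum_ideal (gen i) (pow s)"
  then obtain a b where ab: "a \<in> gen i" "b \<in> pow s" "x = a + b" by (auto simp: sum_ideal_iff)
  have "a * f (Suc i) \<in> gen i" using ab(1) by (intro is_idealD(4)[OF is_ideal_gen])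
  moreover have "b * f (Suc i) \<in> pow (Suc s)"
    unfolding power_ideal_Suc using ab(2) i by (intro prod_idealI gen_member) simp_all
  moreover have "x * f (Suc i) = a * f (Suc i) + b * f (Suc i)" by (simp add: ab(3) distrib_right)
  ultimately show "x \<in> colon (sum_ideal (gen i) (pow (Suc s))) (f (Suc i))"
    unfolding colon_def sum_ideal_iff by blast
qed

lemma adjoin_sum_pow: "adjoin (sum_ideal (gen i) (pow s)) (f (Suc i)) = sum_ideal (gen (Suc i)) (pow s)"
proof
  show "adjoin (sum_ideal (gen i) (pow s)) (f (Suc i)) \<subseteq> sum_ideal (gen (Suc i)) (pow s)"
  proof (rule adjoin_least)
    have sup: "gen (Suc i) \<subseteq> sum_ideal (gen (Suc i)) (pow s)" "pow s \<subseteq> sum_ideal (gen (Suc i)) (pow s)"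
      using sum_ideal_superset[OF is_ideal_gen is_ideal_pow] by blast+
    show id: "is_ideal (sum_ideal (gen (Suc i)) (pow s))" by (intro is_ideal_sum_ideal is_ideal_gen is_ideal_pow)
    show "sum_ideal (gen i) (pow s) \<subseteq> sum_ideal (gen (Suc i)) (pow s)"
      using sup gen_mono[of i "Suc i"] by (intro sum_ideal_least id) auto
    show "f (Suc i) \<in> sum_ideal (gen (Suc i)) (pow s)" using sup(1) gen_member[of "Suc i" "Suc i"] by auto
  qed
  have id: "is_ideal (sum_ideal (gen i) (pow s))" by (intro is_ideal_sum_ideal is_ideal_gen is_ideal_pow)
  note sup = sum_ideal_superset[OF is_ideal_gen[of i] is_ideal_pow[of s]]
  note ad = adjoin_superset[of "sum_ideal (gen i) (pow s)" "f (Suc i)"]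
  show "sum_ideal (gen (Suc i)) (pow s) \<subseteq> adjoin (sum_ideal (gen i) (pow s)) (f (Suc i))"
    unfolding gen_Suc using sup ad adjoin_generator[OF id]
    by (intro sum_ideal_least adjoin_least is_ideal_adjoin id) blast+
qed

lemma power_subset_adjoin:
  assumes "is_ideal J"
  shows "power_ideal (adjoin J g) s \<subseteq> adjoin J (g ^ s)"
proof (induction s)
  case 0
  have "x = 0 + x * g ^ 0" for x by simp
  then show ?case unfolding adjoin_def using is_idealD(1)[OF assms] by blast
next
  case (Suc s)
  have id: "is_ideal (adjoin J (g ^ Suc s))" by (intro is_ideal_adjoin assms)
  show ?case
  proof
    fix x assume "x \<in> power_ideal (adjoin J g) (Suc s)"
    then have "x \<in> prod_ideal (power_ideal (adjoin J g) s) (adjoin J g)" unfolding power_ideal_Suc .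
    then show "x \<in> adjoin J (g ^ Suc s)"
    proof (induction rule: prod_ideal_induct)
      case (mult a b)
      from mult(1) Suc.IH obtain j c where a: "j \<in> J" "a = j + c * g ^ s" by (auto simp: adjoin_def)
      from mult(2) obtain j' c' where b: "j' \<in> J" "b = j' + c' * g" by (auto simp: adjoin_def)
      have "a * b = (j * b + (c * g ^ s) * j') + (c * c') * g ^ Suc s" by (simp add: a b algebra_simps)
      moreover have "j * b + (c * g ^ s) * j' \<in> J"
        using a b by (intro is_idealD(2)[OF assms] is_idealD(4)[OF assms, of j] is_idealD(3)[OF assms, of j'])
      ultimately show ?case unfolding adjoin_def by blast
    qed (rule is_idealD(2)[OF id])
  qed
qed

text \<open>Modulo all generators but the last, powers of \<open>I\<close> are principal.\<close>

lemma sum_pow_last: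
  assumes n: "n = Suc m"
  shows "sum_ideal (gen m) (pow s) = adjoin (gen m) (f n ^ s)"
proof
  show "sum_ideal (gen m) (pow s) \<subseteq> adjoin (gen m) (f n ^ s)"
    using power_subset_adjoin[OF is_ideal_gen, of m "f n" s] adjoin_superset gen_Suc[of m] n
    by (intro sum_ideal_least is_ideal_adjoin is_ideal_gen) auto
  have "f n ^ s \<in> pow s"
  proof (induction s)
    case 0
    show ?case unfolding power_ideal_0 by simp
  next
    case (Suc s)
    have "f n ^ s * f n \<in> pow (Suc s)"
      unfolding power_ideal_Suc using Suc n by (intro prod_idealI gen_member) simp_all
    then show ?case by (simp add: mult.commute)
  qed
  then show "adjoin (gen m) (f n ^ s) \<subseteq> sum_ideal (gen m) (pow s)"
    using sum_ideal_superset[OF is_ideal_gen[of m] is_ideal_pow[of s]]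
    by (intro adjoin_least is_ideal_sum_ideal is_ideal_gen is_ideal_pow) auto
qed

text \<open>A multiple of \<open>f n\<close> that \<open>f n\<close> sends into \<open>gen m\<close> lies in \<open>gen m\<close> already, by the d-sequence condition.\<close>

lemma colon_power_last:
  assumes n: "n = Suc m"
  shows "colon (gen m) (f n ^ Suc s) = colon (gen m) (f n)"
proof (induction s)
  case (Suc s)
  have "x * f n ^ Suc (Suc s) \<in> gen m \<longleftrightarrow> x * f n ^ Suc s \<in> gen m" for x
  proof
    assume "x * f n ^ Suc (Suc s) \<in> gen m"
    then have "(x * f n ^ Suc s) * f (Suc m) \<in> gen m" by (simp add: n algebra_simps)
    moreover have "x * f n ^ Suc s \<in> gen n"
    proof -
      have "(x * f n ^ s) * f n \<in> gen n" using n by (intro is_idealD(3)[OF is_ideal_gen] gen_member) simp_all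
      then show ?thesis by (simp add: algebra_simps)
    qed
    ultimately show "x * f n ^ Suc s \<in> gen m" using cancel[of m "x * f n ^ Suc s"] n by simp
  next
    assume "x * f n ^ Suc s \<in> gen m"
    then have "(x * f n ^ Suc s) * f n \<in> gen m" by (rule is_idealD(4)[OF is_ideal_gen])
    then show "x * f n ^ Suc (Suc s) \<in> gen m" by (simp add: algebra_simps)
  qed
  with Suc show ?case by (simp add: colon_def)
qed simp

end

section \<open>Almost complete intersections generated by a d-sequence\<close>

lemma prime_proper: "primeideal P (ring_of_type_algebra :: 'a::comm_ring_1 ring) \<Longrightarrow> P \<noteq> UNIV"
  using primeideal.I_notcarr[of P "ring_of_type_algebra :: 'a ring"] by simp

text \<open>No prime contains the unit ideal, so its height is the infimum of the empty set, while one generator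
  suffices.\<close>

lemma unit_ideal_not_almost_complete_intersection:
  assumes "1 \<in> J" "is_ideal J"
  shows "\<not> almost_complete_intersection (J :: 'a::idom set)"
proof
  assume a: "almost_complete_intersection J"
  have J: "J = UNIV"
  proof -
    have "x \<in> J" for x using is_idealD(3)[OF assms(2,1), of x] by simp
    then show ?thesis by blast
  qed
  have "height (ring_of_type_algebra :: 'a ring) J = \<infinity>"
  proof -
    have e: "{prime_height (ring_of_type_algebra :: 'a ring) P | P. primeideal P ring_of_type_algebra \<and> J \<subseteq> P} = {}"
      using prime_proper J by blast
    show ?thesis unfolding height_def e by (simp add: top_enat_def)
  qed
  moreover have "min_num_gens (ring_of_type_algebra :: 'a ring) J \<le> enat 1"
  proof -
    have "1 \<in> Idl\<^bsub>ring_of_type_algebra\<^esub> {1 :: 'a}" using Idl_superset by blast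
    then have "x \<in> Idl\<^bsub>ring_of_type_algebra\<^esub> {1 :: 'a}" for x
      using is_idealD(3)[OF is_ideal_Idl, of 1 "{1}" x] by simp
    then have "Idl\<^bsub>ring_of_type_algebra\<^esub> {1 :: 'a} = J" using J by blast
    then have "enat (card {1 :: 'a}) \<in> {enat (card S) | S. finite S \<and> S \<subseteq> carrier (ring_of_type_algebra :: 'a ring)
        \<and> Idl\<^bsub>ring_of_type_algebra\<^esub> S = J}"
      by (intro CollectI exI[of _ "{1}"]) simp
    then show ?thesis unfolding min_num_gens_def by (intro Inf_lower) simp
  qed
  ultimately show False using a by (simp add: almost_complete_intersection_def)
qed

locale graded_d_sequence = field_resolution C T + d_sequence_ideal f "Suc m"
  for C and T :: "nat \<Rightarrow> nat \<Rightarrow> nat \<Rightarrow> ('v::{finite,linorder}, 'k::field) mpoly"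
    and f :: "nat \<Rightarrow> ('v, 'k) mpoly" and m :: nat +
  fixes d :: "nat \<Rightarrow> nat"
  assumes degrees: "l \<in> {1..Suc m} \<Longrightarrow> f l \<in> forms (int (d l))"
    and regular: "regular_sequence ring_of_type_algebra m f"
begin

lemma homogeneous_gen: "i \<le> Suc m \<Longrightarrow> homogeneous (gen i)"
proof (induction i)
  case 0
  show ?case unfolding gen_0 by (auto simp: homogeneous_def is_ideal_def)
next
  case (Suc i)
  then show ?case unfolding gen_Suc by (intro homogeneous_adjoin[OF _ degrees]) simp_all
qed

lemma regular_cancel:
  assumes "Suc i \<le> m" "x * f (Suc i) \<in> gen i"
  shows "x \<in> gen i"
proof -
  have "\<forall>x. x * f (Suc i) \<in> gen (Suc i - 1) \<longrightarrow> x \<in> gen (Suc i - 1)"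
    using regular assms(1) unfolding regular_sequence_def gen_def by force
  then show ?thesis using assms(2) by simp
qed

lemma gen_proper: "i \<le> m \<Longrightarrow> 1 \<notin> gen i"
proof
  assume i: "i \<le> m" "1 \<in> gen i"
  then have "1 \<in> gen m" using gen_mono by blast
  then have "x \<in> gen m" for x using is_idealD(3)[OF is_ideal_gen, of 1 m x] by simp
  moreover have "gen m \<noteq> UNIV" using regular by (simp add: regular_sequence_def gen_def)
  ultimately show False by blast
qed

text \<open>A form of degree \<open>0\<close> in a proper homogeneous ideal is zero, which a regular sequence excludes.\<close>

lemma degree_pos:
  assumes l: "Suc i \<le> m"
  shows "d (Suc i) \<ge> 1"
proof (rule ccontr)
  assume "\<not> d (Suc i) \<ge> 1"
  then have "d (Suc i) = 0" by simp
  then have f0: "f (Suc i) \<in> forms 0" using degrees[of "Suc i"] l by simp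
  have "f (Suc i) \<in> gen m" using l by (intro gen_member) simp_all
  then have "lookup (f (Suc i)) 0 = 0"
    by (intro proper_homogeneous_lookup_0[of "gen m"] homogeneous_gen gen_proper) simp_all
  then have "f (Suc i) = 0" using hcomp_id[OF f0] by (simp add: hcomp_zero_degree)
  then have "1 * f (Suc i) \<in> gen i" by (simp add: is_idealD[OF is_ideal_gen])
  then have "1 \<in> gen i" using regular_cancel[OF l] by blast
  then show False using gen_proper[of i] l by simp
qed

text \<open>Dividing by a nonzerodivisor of degree \<open>d \<ge> 1\<close> raises the regularity by \<open>d - 1\<close>: then the left module
  \<open>(A/J)(-d)\<close> has larger regularity than the middle one, and determines the right one.\<close>

lemma reg_complete_intersection:
  "i \<le> m \<Longrightarrow> reg_le (gen i) ((\<Sum>l=1..i. int (d l)) - int i) \<and> \<not> reg_le (gen i) ((\<Sum>l=1..i. int (d l)) - int i - 1)"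
proof (induction i)
  case 0
  have "gen 0 = {0}" by (rule gen_0)
  then show ?case using reg_zero_ideal reg_ge_0_of_proper[of "gen 0"] homogeneous_gen[of 0] gen_proper[of 0] by simp
next
  case (Suc i)
  define r where "r = (\<Sum>l=1..i. int (d l)) - int i"
  define e where "e = int (d (Suc i))"
  have IH: "reg_le (gen i) r" "\<not> reg_le (gen i) (r - 1)" using Suc by (auto simp: r_def)
  have e_props: "e \<ge> 1" "f (Suc i) \<in> forms e" using degree_pos[of i] degrees[of "Suc i"] Suc.prems by (auto simp: e_def)
  have hom: "homogeneous (gen i)" using Suc.prems by (intro homogeneous_gen) simp
  have col: "colon (gen i) (f (Suc i)) = gen i"
  proof (intro equalityI subsetI)
    show "x \<in> gen i" if "x \<in> colon (gen i) (f (Suc i))" for x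
      by (rule regular_cancel[OF Suc.prems]) (use that in \<open>simp add: colon_def\<close>)
    show "x \<in> colon (gen i) (f (Suc i))" if "x \<in> gen i" for x
      using is_idealD(4)[OF is_ideal_gen that] by (simp add: colon_def)
  qed
  have le: "reg_le (gen i) (r + e - 1)" using e_props(1) by (intro reg_le_mono[OF IH(1)]) simp
  have "reg_le (gen (Suc i)) (r + e - 1)"
    using reg_le_right[OF hom e_props(2) le] IH(1) by (simp add: col gen_Suc)
  moreover have "\<not> reg_le (gen (Suc i)) (r + e - 1 - 1)"
  proof
    assume "reg_le (gen (Suc i)) (r + e - 1 - 1)"
    then have "reg_le (colon (gen i) (f (Suc i))) (r + e - 1 - e)"
      using reg_le_left[OF hom e_props(2) _ le] by (simp add: gen_Suc)
    then show False using IH(2) by (simp add: col)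
  qed
  moreover have sum_eq: "(\<Sum>l=1..Suc i. int (d l)) - int (Suc i) = r + e - 1" by (simp add: r_def e_def)
  ultimately show ?case unfolding sum_eq by blast
qed

lemma homogeneous_sum_pow: "i \<le> Suc m \<Longrightarrow> homogeneous (sum_ideal (gen i) (pow s))"
  by (intro homogeneous_sum_ideal homogeneous_power_ideal homogeneous_gen) simp_all

text \<open>The asserted value of the regularity, written with the degrees of the complete intersection
  \<open>f\<^sub>1, \<dots>, f\<^sub>m\<close> set apart.\<close>

definition target :: "nat \<Rightarrow> int" where
  "target s = (\<Sum>l=1..m. int (d l)) - int m + (int s - 1) * int (d (Suc m)) - 1"

context
  assumes reg_gen: "reg_le (gen (Suc m)) ((\<Sum>l=1..m. int (d l)) - int m - 1)"
    and m: "m \<ge> 1" and d_max: "\<And>l. l \<in> {1..Suc m} \<Longrightarrow> d l \<le> d (Suc m)"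
begin

lemma last_degree_pos: "d (Suc m) \<ge> 1"
  using degree_pos[of 0] d_max[of 1] m by simp

text \<open>Here the bound on the regularity of \<open>A/I\<close> enters: it lies below the regularity of \<open>A/gen m\<close>, so the latter is carried
  by \<open>A/(gen m : f (Suc m))\<close>, with the shift by the degree of \<open>f (Suc m)\<close>.\<close>

lemma reg_colon_last:
  defines "b \<equiv> (\<Sum>l=1..m. int (d l)) - int m"
  shows "reg_le (colon (gen m) (f (Suc m))) (b - int (d (Suc m)))"
    "\<not> reg_le (colon (gen m) (f (Suc m))) (b - int (d (Suc m)) - 1)"
proof -
  have hom: "homogeneous (gen m)" by (intro homogeneous_gen) simp
  have deg: "f (Suc m) \<in> forms (int (d (Suc m)))" by (intro degrees) simp
  have J: "reg_le (gen m) b" "\<not> reg_le (gen m) (b - 1)" using reg_complete_intersection[of m] by (simp_all add: b_def)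
  have I: "reg_le (adjoin (gen m) (f (Suc m))) (b - 1)" using reg_gen by (simp add: b_def gen_Suc)
  show "reg_le (colon (gen m) (f (Suc m))) (b - int (d (Suc m)))" by (rule reg_le_left[OF hom deg I J(1)])
  show "\<not> reg_le (colon (gen m) (f (Suc m))) (b - int (d (Suc m)) - 1)"
  proof
    assume "reg_le (colon (gen m) (f (Suc m))) (b - int (d (Suc m)) - 1)"
    then have "reg_le (colon (gen m) (f (Suc m))) (b - 1 - int (d (Suc m)))" by (simp add: algebra_simps)
    from reg_le_middle[OF hom deg this I] J(2) show False by simp
  qed
qed

text \<open>For \<open>i = m\<close> the power of \<open>I\<close> may be replaced by \<open>\<langle>f (Suc m) ^ s\<rangle>\<close>, and the colon ideal is the same for all \<open>s \<ge> 1\<close>.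
  From \<open>s = 2\<close> on, the shift makes the left module dominate, and the right one has regularity one less.\<close>

lemma reg_sum_pow_last:
  assumes s: "s \<ge> 2"
  shows "reg_le (sum_ideal (gen m) (pow s)) (target s) \<and> \<not> reg_le (sum_ideal (gen m) (pow s)) (target s - 1)"
proof -
  define b where "b = (\<Sum>l=1..m. int (d l)) - int m"
  define e where "e = int (d (Suc m))"
  define Q where "Q = colon (gen m) (f (Suc m))"
  obtain s' where s': "s = Suc s'" "s' \<ge> 1" using s by (cases s) auto
  have Q: "colon (gen m) (f (Suc m) ^ s) = Q" using colon_power_last[of m s'] by (simp add: s' Q_def)
  have hom: "homogeneous (gen m)" by (intro homogeneous_gen) simp
  have deg: "f (Suc m) ^ s \<in> forms (int s * e)"
    unfolding e_def by (intro forms_power degrees) simp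
  have t: "target s = b + (int s - 1) * e - 1" by (simp add: target_def b_def e_def)
  have "(int s - 1) * e \<ge> 1 * 1" using s last_degree_pos unfolding e_def by (intro mult_mono) simp_all
  then have tb: "b \<le> target s" by (simp add: t)
  have J: "reg_le (gen m) (target s)"
    using reg_complete_intersection[of m] tb reg_le_mono unfolding b_def by blast
  have Qle: "reg_le Q (b - e)" "\<not> reg_le Q (b - e - 1)" using reg_colon_last unfolding Q_def b_def e_def by blast+
  have "reg_le (adjoin (gen m) (f (Suc m) ^ s)) (target s)"
  proof (rule reg_le_right[OF hom deg J])
    have "target s + 1 - int s * e = b - e" by (simp add: t algebra_simps)
    then show "reg_le (colon (gen m) (f (Suc m) ^ s)) (target s + 1 - int s * e)" using Qle(1) Q by simp
  qed
  moreover have "\<not> reg_le (adjoin (gen m) (f (Suc m) ^ s)) (target s - 1)"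
  proof
    assume "reg_le (adjoin (gen m) (f (Suc m) ^ s)) (target s - 1)"
    from reg_le_left[OF hom deg this J] have "reg_le Q (target s - int s * e)" by (simp add: Q)
    moreover have "target s - int s * e = b - e - 1" by (simp add: t algebra_simps)
    ultimately show False using Qle(2) by simp
  qed
  ultimately show ?thesis using sum_pow_last[of m s] by simp
qed

text \<open>Descent from \<open>i + 1\<close> to \<open>i\<close>: the left module, obtained from the next lower power, has
  by assumption regularity at most that of the right one, so the middle module has the regularity of the right one.\<close>

lemma reg_descend:
  assumes i: "i \<le> m" and s: "s \<ge> 1"
    and colon: "\<And>j. j < m \<Longrightarrow> reg_le (sum_ideal (gen j) (pow s)) (target (Suc s) - int (d (Suc m)))"
  shows "reg_le (sum_ideal (gen i) (pow (Suc s))) (target (Suc s)) \<and>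
    \<not> reg_le (sum_ideal (gen i) (pow (Suc s))) (target (Suc s) - 1)"
  using i
proof (induction i rule: inc_induct)
  case base
  show ?case using reg_sum_pow_last[of "Suc s"] s by simp
next
  case (step i)
  let ?N = "sum_ideal (gen i) (pow (Suc s))" and ?r = "target (Suc s)"
  have hom: "homogeneous ?N" using step.hyps by (intro homogeneous_sum_pow) simp
  have deg: "f (Suc i) \<in> forms (int (d (Suc i)))" using step.hyps by (intro degrees) simp
  have ad: "adjoin ?N (f (Suc i)) = sum_ideal (gen (Suc i)) (pow (Suc s))" by (rule adjoin_sum_pow)
  have "colon ?N (f (Suc i)) = sum_ideal (gen i) (pow s)"
  proof (rule colon_sum_pow)
    show "x \<in> gen i" if "x * f (Suc i) \<in> gen i" for x
      by (rule regular_cancel) (use step.hyps that in simp_all)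
  qed (use step.hyps in simp)
  moreover have "reg_le (sum_ideal (gen i) (pow s)) (?r - int (d (Suc i)))"
    using step.hyps d_max[of "Suc i"] by (intro reg_le_mono[OF colon]) simp_all
  ultimately have col: "reg_le (colon ?N (f (Suc i))) (?r - int (d (Suc i)))" by (simp only:)
  show ?case
  proof
    show "reg_le ?N ?r" using reg_le_middle[OF hom deg col, unfolded ad] step.IH by blast
    show "\<not> reg_le ?N (?r - 1)"
    proof
      \<comment> \<open>If the middle module had smaller regularity, so would the right one.\<close>
      assume "reg_le ?N (?r - 1)"
      from reg_le_right[OF hom deg this] col have "reg_le (adjoin ?N (f (Suc i))) (?r - 1)"
        by (simp del: nat_pow_Suc)
      then show False using step.IH unfolding ad by blast
    qed
  qed
qed

text \<open>For \<open>s = 2\<close> the left modules are copies of \<open>A/I\<close>, bounded by hypothesis; for larger \<open>s\<close> the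
  induction hypothesis and the maximality of the last degree bound them.\<close>

lemma reg_sum_pow:
  assumes "s \<ge> 2" "i \<le> m"
  shows "reg_le (sum_ideal (gen i) (pow s)) (target s) \<and> \<not> reg_le (sum_ideal (gen i) (pow s)) (target s - 1)"
  using assms
proof (induction s arbitrary: i rule: dec_induct)
  case base
  have "reg_le (sum_ideal (gen j) (pow 1)) (target (Suc 1) - int (d (Suc m)))" if "j < m" for j
  proof -
    have p1: "pow 1 = gen (Suc m)" using power_ideal_1[OF is_ideal_gen] by simp
    have "sum_ideal (gen j) (pow 1) = gen (Suc m)"
      unfolding p1
    proof
      show "sum_ideal (gen j) (gen (Suc m)) \<subseteq> gen (Suc m)"
        using that by (intro sum_ideal_least is_ideal_gen gen_mono) simp_all
      show "gen (Suc m) \<subseteq> sum_ideal (gen j) (gen (Suc m))"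
        by (intro sum_ideal_superset is_ideal_gen)
    qed
    moreover have "target (Suc 1) - int (d (Suc m)) = (\<Sum>l=1..m. int (d l)) - int m - 1"
      by (simp add: target_def)
    ultimately show ?thesis using reg_gen by (simp only:)
  qed
  from reg_descend[OF base.prems _ this] show ?case by (simp add: numeral_2_eq_2 del: nat_pow_Suc)
next
  case (step s)
  have "reg_le (sum_ideal (gen j) (pow s)) (target (Suc s) - int (d (Suc m)))" if "j < m" for j
  proof -
    have "target (Suc s) - int (d (Suc m)) = target s" by (simp add: target_def algebra_simps)
    then show ?thesis using step.IH[of j] that by simp
  qed
  from reg_descend[OF step.prems _ this] show ?case using step.hyps by (simp del: nat_pow_Suc)
qed

end

end

theorem theorem2p3:
  fixes f :: "nat \<Rightarrow> ('v::{finite,linorder}, 'k::field_char_0) mpoly"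
    and n :: nat and d :: "nat \<Rightarrow> nat"
    and A :: "('v, 'k) mpoly ring" and I :: "('v, 'k) mpoly set"
  defines "A \<equiv> ring_of_type_algebra"
  assumes "n \<ge> 1"
    and "\<And>l. l \<in> {1..n} \<Longrightarrow> f l \<in> forms (int (d l))"
    and "I = Idl\<^bsub>A\<^esub> (f ` {1..n})"
    and "almost_complete_intersection I"
    and "d_sequence A n f"
    and "regular_sequence A (n - 1) f"
    and "reg_quotient I < ereal (of_int ((\<Sum>l=1..n-1. int (d l)) - int n + 1))"
    and "d n = Max (d ` {1..n})"
  shows "\<forall>s\<ge>2. \<forall>i\<in>{0..n-1}.
    reg_quotient (Idl\<^bsub>A\<^esub> (f ` {1..i}) <+>\<^bsub>A\<^esub> I [^]\<^bsub>ideals_set A\<^esub> (s::nat))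
      = ereal (of_int ((\<Sum>l=1..n. int (d l)) - int n + (int s - 2) * int (d n)))"
proof -
  note A = \<open>A \<equiv> ring_of_type_algebra\<close>
  obtain m where n: "n = Suc m" using \<open>n \<ge> 1\<close> by (cases n) auto
  obtain C and T :: "nat \<Rightarrow> nat \<Rightarrow> nat \<Rightarrow> ('v, 'k) mpoly" where "resolves_field C T"
    using resolves_field_exists by blast
  then interpret graded_d_sequence C T f m d
    using assms by unfold_locales (simp_all add: A n)
  have I: "I = gen (Suc m)" using assms(4) by (simp add: A n gen_def)
  have homI: "homogeneous I" unfolding I by (rule homogeneous_gen) simp
  have reg: "reg_le (gen (Suc m)) ((\<Sum>l=1..m. int (d l)) - int m - 1)"
  proof -
    have "reg_le I ((\<Sum>l=1..n-1. int (d l)) - int n + 1 - 1)"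
      using assms(8) unfolding reg_quotient_less_iff[OF homI] .
    moreover have "(\<Sum>l=1..n-1. int (d l)) - int n + 1 - 1 = (\<Sum>l=1..m. int (d l)) - int m - 1"
      by (simp add: n)
    ultimately show ?thesis unfolding I by (simp only:)
  qed
  \<comment> \<open>For a single generator the bound says that the regularity of \<open>A/I\<close> is negative, so \<open>I\<close> would be the unit ideal.\<close>
  have "m \<noteq> 0"
  proof
    assume m0: "m = 0"
    have "1 \<notin> I" using unit_ideal_not_almost_complete_intersection homogeneousD(1)[OF homI] assms(5) by blast
    then show False using reg_ge_0_of_proper[OF homI] reg m0 by (simp add: I)
  qed
  then have m: "m \<ge> 1" by simp
  have d_max: "d l \<le> d (Suc m)" if "l \<in> {1..Suc m}" for l
    using that assms(9) by (simp add: n)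
  show ?thesis
  proof (intro allI impI ballI)
    fix s i :: nat assume s: "s \<ge> 2" and i: "i \<in> {0..n - 1}"
    have hom: "homogeneous (sum_ideal (gen i) (pow s))" using i by (intro homogeneous_sum_pow) (simp add: n)
    have "reg_quotient (sum_ideal (gen i) (pow s)) = ereal (of_int (target s))"
      unfolding reg_quotient_eq_iff[OF hom] using reg_sum_pow[OF reg m d_max s] i by (simp add: n)
    moreover have "target s = (\<Sum>l=1..n. int (d l)) - int n + (int s - 2) * int (d n)"
      by (simp add: target_def n algebra_simps)
    ultimately show "reg_quotient (Idl\<^bsub>A\<^esub> (f ` {1..i}) <+>\<^bsub>A\<^esub> I [^]\<^bsub>ideals_set A\<^esub> s)
      = ereal (of_int ((\<Sum>l=1..n. int (d l)) - int n + (int s - 2) * int (d n)))"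
      unfolding A I gen_def[symmetric] by simp
  qed
qed

end
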